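(* Let $\tau>0$ and $\mu_0\in H^1(\mathbb{T}^d)$. For each $\varepsilon$ let $\mu_{\varepsilon,\tau}:(0,\infty)\to H^1(\mathbb{T}^d)$ be the solution of the weighted $L^2$ scheme with initial value $\mu_0$, that is, $\mu_{\varepsilon,\tau}(t)=\mu_\varepsilon^n$ for $(n-1)\tau<t\le n\tau$, where $\mu_\varepsilon^0=\mu_0$ and, for $n\ge 1$, $$\mu_\varepsilon^n=\arg\min_{\mu\in H^1(\mathbb{T}^d)}\ Q_\varepsilon(\mu)+\frac{1}{2\tau}K_\varepsilon(\mu,\mu_\varepsilon^{n-1})^2 .$$ Let $\mu_\tau(t)=\mu^n$ for $(n-1)\tau<t\le n\tau$, where $\mu^0=\mu_0$ and, for $n\ge1$, $$\mu^n=\arg\min_{\mu\in H^1(\mathbb{T}^d)}\ Q(\mu)+\frac{1}{2\tau}K(\mu,\mu^{n-1})^2 .$$ Then for all $t\in(0,\infty)$, $$\mu_{\varepsilon,\tau}(t)\to\mu_\tau(t)\quad\text{in } L^2(\mathbb{T}^d)\text{ as }\varepsilon\to0 .$$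
   Context: $\mathbb{T}^d=\mathbb{R}^d/\mathbb{Z}^d$ is the flat torus and $\langle\cdot,\cdot\rangle$ is the Euclidean inner product. Standing assumptions on the data: $A:\mathbb{R}^d\to\mathbb{R}^{d\times d}$ is 1-periodic ($A(x+e_j)=A(x)$ for all $x$ and all standard basis vectors $e_j$), of class at least $C^2$, and there are constants $\Lambda_0,\Lambda_1>0$ with $\Lambda_0I\preceq A(x)\preceq\Lambda_1I$ for all $x$ ($\preceq$ is the Loewner order on symmetric matrices, so $A(x)$ is symmetric). The parameter $\varepsilon>0$ ranges over values for which $x\mapsto A(x/\varepsilon)$ is $\mathbb{Z}^d$-periodic, so that it defines a function on $\mathbb{T}^d$ (e.g. $\varepsilon=1/m$, $m\in\mathbb{N}$). The potentials satisfy $V_\varepsilon\in C^1(\mathbb{T}^d)$, $V_\varepsilon\ge0$, and there is $\lambda>0$ with $V_\varepsilon(x)\le\lambda$ and $|\nabla V_\varepsilon(x)|\le\lambda$ for all $x,\varepsilon$; and there is a function $V$ on $\mathbb{T}^d$ with $\sup_x|V_\varepsilon(x)-V(x)|\to0$ as $\varepsilon\to0$. Put $\pi_\varepsilon=e^{-V_\varepsilon}$, $\pi_*=e^{-V}$. Define $$Q_\varepsilon(\mu)=\frac12\int_{\mathbb{T}^d}\Big\langle\pi_\varepsilon(x)A\Big(\frac{x}{\varepsilon}\Big)\nabla\frac{\mu}{\pi_\varepsilon},\nabla\frac{\mu}{\pi_\varepsilon}\Big\rangle dx,\qquad K_\varepsilon(\mu,\nu)=\Big[\int_{\mathbb{T}^d}\frac{(\mu-\nu)^2}{\pi_\varepsilon}dx\Big]^{1/2},$$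 $$Q(\mu)=\frac12\int_{\mathbb{T}^d}\Big\langle\pi_*(x)A_*\nabla\frac{\mu}{\pi_*},\nabla\frac{\mu}{\pi_*}\Big\rangle dx,\qquad K(\mu,\nu)=\Big[\int_{\mathbb{T}^d}\frac{(\mu-\nu)^2}{\pi_*}dx\Big]^{1/2}.$$ The effective diffusion matrix is $$(A_* )_{jk}=\int_{\mathbb{T}^d}\Big(A_{jk}(x)+\sum_{\ell=1}^dA_{j\ell}(x)\frac{\partial\chi_k}{\partial x_\ell}(x)\Big)dx,$$ where $\chi=(\chi_1,\dots,\chi_d)$ is the periodic solution, unique up to additive constants, of $-\nabla\cdot(A\nabla\chi)=\nabla\cdot A$, i.e. $-\sum_{j,\ell}\partial_j(A_{j\ell}\partial_\ell\chi_k)=\sum_j\partial_jA_{jk}$ for each $k$. *)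

theory Defs
  imports "HOL-Analysis.Analysis"
begin

text \<open>
  Functions on the flat torus are represented by \<open>\<int>\<^sup>d\<close>-periodic functions on \<^typ>\<open>real^'n\<close>, where
  \<open>d = CARD('n)\<close>, and integrals over the torus by integrals over the unit cube.
\<close>

definition periodic :: "(real^'n \<Rightarrow> 'b) \<Rightarrow> bool" where
  "periodic f \<longleftrightarrow> (\<forall>x j. f (x + axis j 1) = f x)"

definition torus :: "(real^'n) measure" where
  "torus = restrict_space lborel (cbox 0 One)"

definition partial :: "'n \<Rightarrow> (real^'n \<Rightarrow> real) \<Rightarrow> real^'n \<Rightarrow> real" where
  "partial j f x = frechet_derivative f (at x) (axis j 1)"

definition gradient :: "(real^'n \<Rightarrow> real) \<Rightarrow> real^'n \<Rightarrow> real^'n" where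
  "gradient f x = (\<chi> j. partial j f x)"

primrec Ck :: "nat \<Rightarrow> (real^'n \<Rightarrow> real) \<Rightarrow> bool" where
  "Ck 0 f \<longleftrightarrow> continuous_on UNIV f"
| "Ck (Suc k) f \<longleftrightarrow> (\<forall>x. f differentiable (at x)) \<and> (\<forall>j. Ck k (partial j f))"

definition loewner_le :: "real^'n^'n \<Rightarrow> real^'n^'n \<Rightarrow> bool" where
  "loewner_le M N \<longleftrightarrow> transpose M = M \<and> transpose N = N \<and>
     (\<forall>v. v \<bullet> (M *v v) \<le> v \<bullet> (N *v v))"


definition L2 :: "(real^'n \<Rightarrow> real) set" where
  "L2 = {f. periodic f \<and> f \<in> borel_measurable torus \<and> integrable torus (\<lambda>x. (f x)\<^sup>2)}"

definition L2_norm :: "(real^'n \<Rightarrow> real) \<Rightarrow> real" where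
  "L2_norm f = sqrt (\<integral>x. (f x)\<^sup>2 \<partial>torus)"

definition is_weak_gradient :: "(real^'n \<Rightarrow> real) \<Rightarrow> (real^'n \<Rightarrow> real^'n) \<Rightarrow> bool" where
  "is_weak_gradient u g \<longleftrightarrow>
     (\<forall>j. (\<lambda>x. g x $ j) \<in> L2) \<and>
     (\<forall>\<phi>. periodic \<phi> \<and> (\<forall>k. Ck k \<phi>) \<longrightarrow>
        (\<forall>j. (\<integral>x. u x * partial j \<phi> x \<partial>torus) = - (\<integral>x. g x $ j * \<phi> x \<partial>torus)))"

definition H1 :: "(real^'n \<Rightarrow> real) set" where
  "H1 = {u. u \<in> L2 \<and> (\<exists>g. is_weak_gradient u g)}"

text \<open>
  The weak gradient is determined only up to a null set; every use below is under an
  integral, so the choice of representative does not matter.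
\<close>

definition weak_gradient :: "(real^'n \<Rightarrow> real) \<Rightarrow> real^'n \<Rightarrow> real^'n" where
  "weak_gradient u = (SOME g. is_weak_gradient u g)"


text \<open>
  The energy and the weighted distance, for a general density \<open>p\<close> and coefficient field \<open>a\<close>.
  The functionals \<open>Q\<^sub>\<epsilon>, K\<^sub>\<epsilon>\<close> arise for \<open>p = exp (- V\<^sub>\<epsilon>)\<close> and \<open>a x = A (x / \<epsilon>)\<close>, the functionals
  \<open>Q, K\<close> for \<open>p = exp (- V)\<close> and the constant field \<open>a x = A\<^sub>*\<close>.
\<close>

definition energy :: "(real^'n \<Rightarrow> real) \<Rightarrow> (real^'n \<Rightarrow> real^'n^'n) \<Rightarrow> (real^'n \<Rightarrow> real) \<Rightarrow> real" where
  "energy p a u =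
     1/2 * (\<integral>x. (p x *\<^sub>R (a x *v weak_gradient (\<lambda>y. u y / p y) x))
                    \<bullet> weak_gradient (\<lambda>y. u y / p y) x \<partial>torus)"

definition weighted_dist :: "(real^'n \<Rightarrow> real) \<Rightarrow> (real^'n \<Rightarrow> real) \<Rightarrow> (real^'n \<Rightarrow> real) \<Rightarrow> real" where
  "weighted_dist p u v = sqrt (\<integral>x. (u x - v x)\<^sup>2 / p x \<partial>torus)"

definition weighted_L2_scheme ::
  "(real^'n \<Rightarrow> real) \<Rightarrow> (real^'n \<Rightarrow> real^'n^'n) \<Rightarrow> real \<Rightarrow> (real^'n \<Rightarrow> real)
     \<Rightarrow> (real \<Rightarrow> real^'n \<Rightarrow> real) \<Rightarrow> bool" where
  "weighted_L2_scheme p a \<tau> \<mu>0 \<mu> \<longleftrightarrow>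
     (\<exists>m :: nat \<Rightarrow> real^'n \<Rightarrow> real.
        m 0 = \<mu>0 \<and>
        (\<forall>n\<ge>1. is_arg_min (\<lambda>\<nu>. energy p a \<nu> + 1 / (2 * \<tau>) * (weighted_dist p \<nu> (m (n - 1)))\<^sup>2)
                   (\<lambda>\<nu>. \<nu> \<in> H1) (m n)) \<and>
        (\<forall>n\<ge>1. \<forall>t. (real n - 1) * \<tau> < t \<and> t \<le> real n * \<tau> \<longrightarrow> \<mu> t = m n))"


definition admissible_scales :: "(real^'n \<Rightarrow> real^'n^'n) \<Rightarrow> real set" where
  "admissible_scales A = {\<epsilon>. \<epsilon> > 0 \<and> periodic (\<lambda>x. A (x /\<^sub>R \<epsilon>))}"

text \<open>
  The cell problem, read classically (for \<open>A\<close> of class \<open>C\<^sup>2\<close> its periodic solutions are of class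
  \<open>C\<^sup>2\<close>). It fixes each \<open>cor k\<close> only up to an additive constant, which the effective matrix
  does not see.
\<close>

definition cell_solution :: "(real^'n \<Rightarrow> real^'n^'n) \<Rightarrow> ('n \<Rightarrow> real^'n \<Rightarrow> real) \<Rightarrow> bool" where
  "cell_solution A cor \<longleftrightarrow>
     (\<forall>k. periodic (cor k) \<and> Ck 2 (cor k) \<and>
       (\<forall>x. - (\<Sum>j\<in>UNIV. \<Sum>l\<in>UNIV. partial j (\<lambda>y. A y $ j $ l * partial l (cor k) y) x)
              = (\<Sum>j\<in>UNIV. partial j (\<lambda>y. A y $ j $ k) x)))"

definition effective_matrix ::
  "(real^'n \<Rightarrow> real^'n^'n) \<Rightarrow> ('n \<Rightarrow> real^'n \<Rightarrow> real) \<Rightarrow> real^'n^'n" where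
  "effective_matrix A cor =
     (\<chi> j k. \<integral>x. A x $ j $ k + (\<Sum>l\<in>UNIV. A x $ j $ l * partial l (cor k) x) \<partial>torus)"

end

theory Submission
  imports Defs
begin

text \<open>
  In the unknown \<open>u = \<mu> / \<pi>\<close> each time step is a linear elliptic equation
  \<open>\<pi>u - \<tau> \<nabla>\<cdot>(\<pi>A\<nabla>u) = previous density\<close>, so the claim is a homogenization statement with right-hand
  sides converging in \<open>L\<^sup>2\<close>, and the theorem follows by induction over the time steps. Approximate the
  limit solution in \<open>H\<^sup>1\<close> by a trigonometric polynomial \<open>w\<close> and insert the two-scale expansion
  \<open>w + \<epsilon> \<Sum>\<^sub>k \<chi>\<^sub>k(x/\<epsilon>) \<partial>\<^sub>k w\<close> into the equation at scale \<open>\<epsilon>\<close>. The residual contains the fluctuation of the flux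
  \<open>A(e\<^sub>k + \<nabla>\<chi>\<^sub>k)\<close>, which is divergence free and has mean zero: after replacing the merely Lipschitz weight by
  a trigonometric polynomial one integrates by parts and is left with integrals of a rapidly oscillating
  mean-zero function against an \<open>H\<^sup>1\<close> function, which are \<open>O(\<epsilon>)\<close>. Ellipticity turns the bound on the
  residual into an error bound, so neither compactness nor regularity of the limit is needed.
\<close>

subsection \<open>Integration over the torus\<close>

text \<open>The limit weight \<open>exp (- V)\<close> is only a uniform limit of C^1 weights with a
  common Lipschitz bound, and this obstacle shapes the proof twice. To vary the quotient by a test
  function \<phi>, the minimizer must be varied by the weight times \<phi>; hence H^1 has to be
  stable under multiplication by the limit weight and by its inverse, which is obtained by
  constructing a bounded gradient of \<open>V\<close> as an almost everywhere limit of gradients of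
  selected approximants. Secondly, exchanging the weight for a smooth one costs an error
  proportional to their uniform distance. The factor in front of that distance must not depend on
  the smooth weight, whereas the factor in front of \<epsilon> may, since the smooth weight is fixed
  before \<epsilon> tends to 0. Trigonometric polynomials are the smooth functions throughout: they
  form an algebra closed under differentiation, and convolution with one of them is a finite
  sum.\<close>

lemma space_torus [simp]: "space torus = cbox 0 One"
  by (simp add: torus_def space_restrict_space)

lemma finite_measure_torus: "finite_measure torus"
  by (rule finite_measureI) (simp add: torus_def emeasure_restrict_space emeasure_lborel_cbox_eq)

lemma measure_torus [simp]: "measure torus (cbox 0 One) = 1"
  by (simp add: torus_def measure_restrict_space)

lemma measurable_torus: "f \<in> borel_measurable borel \<Longrightarrow> f \<in> borel_measurable torus"
  unfolding torus_def by (rule measurable_restrict_space1) simp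

lemma continuous_measurable_torus:
  fixes f :: "real^'n \<Rightarrow> 'b::topological_space"
  shows "continuous_on UNIV f \<Longrightarrow> f \<in> borel_measurable torus"
  by (intro measurable_torus borel_measurable_continuous_onI)

lemma integrable_torus_continuous:
  fixes f :: "real^'n \<Rightarrow> real"
  assumes "continuous_on UNIV f"
  shows "integrable torus f"
  unfolding torus_def
  using borel_integrable_compact[OF compact_cbox continuous_on_subset[OF assms subset_UNIV], of 0 One]
  by (simp add: integrable_restrict_space)

lemma integral_torus_eq_integral:
  fixes f :: "real^'n \<Rightarrow> real"
  assumes "continuous_on UNIV f"
  shows "(\<integral>x. f x \<partial>torus) = integral (cbox 0 One) f"
proof -
  have "set_integrable lborel (cbox 0 One) f"
    unfolding set_integrable_def
    by (rule borel_integrable_compact[OF compact_cbox continuous_on_subset[OF assms subset_UNIV]])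
  then have "(LINT x:cbox 0 One|lborel. f x) = integral (cbox 0 One) f"
    by (rule set_borel_integral_eq_integral)
  then show ?thesis
    unfolding torus_def set_lebesgue_integral_def by (simp add: integral_restrict_space)
qed

lemma integral_torus_const [simp]: "(\<integral>x. (c::real) \<partial>(torus :: (real^'n) measure)) = c"
  by simp

lemma integrable_torus_const [simp]: "integrable (torus :: (real^'n) measure) (\<lambda>x. c::real)"
  by (rule finite_measure.integrable_const[OF finite_measure_torus])

lemma sigma_finite_torus: "sigma_finite_measure torus"
  using finite_measure_torus finite_measure.axioms(1) by blast

section \<open>Periodic functions under integer translations and on the fundamental cube\<close>

lemma periodicD: "periodic f \<Longrightarrow> f (x + axis j 1) = f x"
  by (simp add: periodic_def)

lemma periodic_int:
  assumes "periodic f"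
  shows "f (x + of_int z *\<^sub>R axis j 1) = f x"
proof (induction z arbitrary: x rule: int_induct[where k=0])
  case base then show ?case by simp
next
  case (step1 i)
  have "f (x + of_int (i+1) *\<^sub>R axis j 1) = f ((x + of_int i *\<^sub>R axis j 1) + axis j 1)"
    by (simp add: algebra_simps)
  then show ?case using step1 periodicD[OF assms] by simp
next
  case (step2 i)
  have "f (x + of_int (i-1) *\<^sub>R axis j 1) = f ((x + of_int (i-1) *\<^sub>R axis j 1) + axis j 1)"
    using periodicD[OF assms] by metis
  also have "\<dots> = f (x + of_int i *\<^sub>R axis j 1)" by (simp add: algebra_simps)
  finally show ?case using step2 by simp
qed

lemma vec_axis_sum: "(\<Sum>i\<in>UNIV. (v$i) *\<^sub>R axis i 1) = (v::real^'n)"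
  using basis_expansion[of v] by (simp add: scalar_mult_eq_scaleR)

lemma periodic_int_vec:
  assumes "periodic f"
  shows "f (x + (\<chi> i. of_int (z i))) = f x"
proof -
  have "f (x + (\<Sum>i\<in>I. of_int (z i) *\<^sub>R axis i 1)) = f x" if "finite I" for I
    using that
  proof (induction I arbitrary: x)
    case (insert i I)
    then have "f (x + (\<Sum>i\<in>insert i I. of_int (z i) *\<^sub>R axis i 1)) =
       f ((x + of_int (z i) *\<^sub>R axis i 1) + (\<Sum>i\<in>I. of_int (z i) *\<^sub>R axis i 1))"
      by (simp add: algebra_simps)
    then show ?case using insert periodic_int[OF assms] by simp
  qed simp
  from this[of UNIV] show ?thesis
    using vec_axis_sum[of "\<chi> i. of_int (z i)"] by simp
qed

text \<open>Representative of a point in the half-open fundamental cube. It jumps across every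
  hyperplane on which some coordinate is an integer, so composing with it destroys continuity unless
  a cutoff vanishes there.\<close>

definition frac_vec :: "real^'n \<Rightarrow> real^'n" where
  "frac_vec x = (\<chi> i. frac (x $ i))"

lemma periodic_frac_vec:
  assumes "periodic f"
  shows "f (frac_vec x) = f x"
proof -
  have "x = frac_vec x + (\<chi> i. of_int \<lfloor>x $ i\<rfloor>)"
    by (simp add: frac_vec_def frac_def vec_eq_iff)
  then show ?thesis using periodic_int_vec[OF assms] by metis
qed

lemma One_nth [simp]: "(\<Sum>b\<in>Basis. (b::real^'n) $ i) = 1"
proof -
  have "(\<Sum>b\<in>Basis. (b::real^'n) $ i) = (\<Sum>b\<in>Basis. 1 *\<^sub>R (b::real^'n)) \<bullet> axis i 1"
    by (simp add: inner_axis real_inner_1_right)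
  also have "\<dots> = 1"
    by (rule inner_sum_left_Basis) (simp add: axis_in_Basis_iff)
  finally show ?thesis .
qed

lemma frac_vec_in: "frac_vec x \<in> cbox 0 One"
  by (auto simp: frac_vec_def mem_box_cart intro: less_imp_le frac_lt_1)

lemma frac_vec_periodic: "periodic frac_vec"
  by (auto simp: periodic_def frac_vec_def vec_eq_iff axis_def frac_1_eq)

lemma periodic_bounded:
  fixes f :: "real^'n \<Rightarrow> real"
  assumes "periodic f" "continuous_on UNIV f"
  obtains B where "B > 0" "\<And>x. \<bar>f x\<bar> \<le> B"
proof -
  have "compact (f ` cbox 0 One)"
    by (intro compact_continuous_image continuous_on_subset[OF assms(2)]) auto
  then obtain B where B: "B > 0" "\<forall>y\<in>f ` cbox 0 One. norm y \<le> B"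
    using compact_imp_bounded bounded_pos by metis
  have "\<bar>f x\<bar> \<le> B" for x
    using B(2) frac_vec_in[of x] periodic_frac_vec[OF assms(1), of x] by (metis imageI real_norm_def)
  then show thesis using that B by blast
qed

text \<open>Continuity forces vanishing on the closed cube, and \<open>frac_vec\<close> carries this
  to every point. It serves twice: for the positivity of the normalizing constant of the kernel, and
  to conclude that a gradient vanishes in the uniqueness argument for correctors.\<close>

lemma integral_zero_imp_zero:
  fixes f :: "real^'n \<Rightarrow> real"
  assumes f: "periodic f" "continuous_on UNIV f" "\<And>x. f x \<ge> 0" "(\<integral>x. f x \<partial>torus) = 0"
  shows "f x = 0"
proof -
  have "integral (cbox 0 One) f = 0" using integral_torus_eq_integral[OF f(2)] f(4) by simp
  moreover have "f integrable_on cbox 0 One"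
    by (intro integrable_continuous continuous_on_subset[OF f(2)]) auto
  ultimately have "(f has_integral 0) (cbox 0 One)" by (simp add: has_integral_iff)
  then have "f (frac_vec x) = 0"
  proof (rule has_integral_0_cbox_imp_0[rotated 2])
    have "(1/2) *\<^sub>R One \<in> box 0 (One::real^'n)" by (simp add: mem_box_cart)
    then show "box 0 (One::real^'n) \<noteq> {}" by blast
    show "frac_vec x \<in> cbox 0 One" by (rule frac_vec_in)
  qed (use f in \<open>auto intro: continuous_on_subset\<close>)
  then show ?thesis by (simp add: periodic_frac_vec[OF f(1)])
qed

section \<open>Translation invariance of the integral over the torus\<close>

lemma periodic_shift:
  assumes "periodic f"
  shows "periodic (\<lambda>x. f (x + v))"
  unfolding periodic_def
proof (intro allI)
  fix x j
  have "f (x + axis j 1 + v) = f ((x + v) + axis j 1)" by (simp add: algebra_simps)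
  then show "f (x + axis j 1 + v) = f (x + v)" using periodicD[OF assms] by simp
qed

text \<open>\<open>S a b\<close> is the unit cube with its side in direction \<open>j\<close>
  replaced by \<open>[a, b]\<close>. Cutting such slabs, and moving them along the axis, is all that
  invariance under axis shifts requires.\<close>

lemma slab_split:
  fixes F :: "real^'n \<Rightarrow> real" and j :: 'n
  defines "S \<equiv> \<lambda>a b. cbox (\<chi> i. if i = j then a else 0) (\<chi> i. if i = j then b else 1)"
  assumes F: "continuous_on UNIV F" and ab: "a \<le> b" "b \<le> c"
  shows "integral (S a c) F = integral (S a b) F + integral (S b c) F"
proof -
  have mem: "x \<in> S a b \<longleftrightarrow> a \<le> x $ j \<and> x $ j \<le> b \<and> (\<forall>i. i \<noteq> j \<longrightarrow> 0 \<le> x $ i \<and> x $ i \<le> 1)" for x a b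
    by (auto simp: S_def mem_box_cart)
  have "F integrable_on S a c"
    unfolding S_def by (intro integrable_continuous continuous_on_subset[OF F]) auto
  then have "integral (S a c) F = integral (S a c \<inter> {x. x \<bullet> axis j 1 \<le> b}) F
     + integral (S a c \<inter> {x. x \<bullet> axis j 1 \<ge> b}) F"
    unfolding S_def by (intro integral_split) (auto simp: axis_in_Basis_iff)
  moreover have "S a c \<inter> {x. x \<bullet> axis j 1 \<le> b} = S a b" "S a c \<inter> {x. x \<bullet> axis j 1 \<ge> b} = S b c"
    using ab by (auto simp: mem inner_axis)
  ultimately show ?thesis by simp
qed

lemma slab_shift:
  fixes F :: "real^'n \<Rightarrow> real" and j :: 'n
  defines "S \<equiv> \<lambda>a b. cbox (\<chi> i. if i = j then a else 0) (\<chi> i. if i = j then b else 1)"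
  shows "integral (S (a+t) (b+t)) F = integral (S a b) (\<lambda>x. F (x + t *\<^sub>R axis j 1))"
proof -
  have eq: "(\<chi> i. if i = j then a else 0) + t *\<^sub>R axis j 1 = (\<chi> i. if i = j then a + t else 0)"
    "(\<chi> i. if i = j then b else 1) + t *\<^sub>R axis j 1 = (\<chi> i. if i = j then b + t else 1)"
    by (simp_all add: vec_eq_iff axis_def)
  show ?thesis
    unfolding S_def
    using integral_shift_cbox_plus[of "\<chi> i. if i = j then a else 0" "\<chi> i. if i = j then b else 1" F "t *\<^sub>R axis j 1"]
    unfolding eq by (simp add: o_def add.commute)
qed

text \<open>For a shift \<open>s\<close> in \<open>[0, 1]\<close> the shifted cube is cut at height
  1; by periodicity the overhanging slab \<open>S 1 (1 + s)\<close> can be moved back to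
  \<open>S 0 s\<close>, where it completes \<open>S s 1\<close> to the unit cube. A general shift is
  first reduced to its fractional part.\<close>

lemma integral_torus_shift_axis:
  fixes F :: "real^'n \<Rightarrow> real"
  assumes F: "continuous_on UNIV F" "periodic F"
  shows "(\<integral>x. F (x + t *\<^sub>R axis j 1) \<partial>torus) = (\<integral>x. F x \<partial>torus)"
proof -
  define S :: "real \<Rightarrow> real \<Rightarrow> (real^'n) set"
    where "S = (\<lambda>a b. cbox (\<chi> i. if i = j then a else 0) (\<chi> i. if i = j then b else 1))"
  have S01: "S 0 1 = cbox 0 One"
    by (auto simp: S_def mem_box_cart)
  have 1: "(\<integral>x. F (x + s *\<^sub>R axis j 1) \<partial>torus) = (\<integral>x. F x \<partial>torus)" if s: "0 \<le> s" "s \<le> 1" for s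
  proof -
    have c: "continuous_on UNIV (\<lambda>x. F (x + s *\<^sub>R axis j 1))"
      by (rule continuous_on_compose2[OF F(1)]) (auto intro!: continuous_intros)
    have "(\<integral>x. F (x + s *\<^sub>R axis j 1) \<partial>torus) = integral (S 0 1) (\<lambda>x. F (x + s *\<^sub>R axis j 1))"
      using integral_torus_eq_integral[OF c] S01 by simp
    also have "\<dots> = integral (S s (1+s)) F"
      unfolding S_def using slab_shift[of j 0 s 1 F] by (simp cong: if_cong)
    also have "\<dots> = integral (S s 1) F + integral (S 1 (1+s)) F"
      unfolding S_def using s by (intro slab_split F(1)) auto
    also have "integral (S 1 (1+s)) F = integral (S 0 s) (\<lambda>x. F (x + 1 *\<^sub>R axis j 1))"
      unfolding S_def using slab_shift[of j 0 1 s F] by (simp add: add.commute cong: if_cong)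
    also have "(\<lambda>x. F (x + 1 *\<^sub>R axis j 1)) = F"
      using F(2) by (auto simp: periodic_def)
    also have "integral (S s 1) F + integral (S 0 s) F = integral (S 0 1) F"
      unfolding S_def using s slab_split[OF F(1), of 0 s 1 j] by simp
    finally show ?thesis
      using integral_torus_eq_integral[OF F(1)] S01 by simp
  qed
  have "F (x + t *\<^sub>R axis j 1) = F (x + frac t *\<^sub>R axis j 1)" for x
    using periodic_int[OF F(2), of "x + frac t *\<^sub>R axis j 1" "\<lfloor>t\<rfloor>" j]
    by (simp add: frac_def algebra_simps)
  then have "(\<integral>x. F (x + t *\<^sub>R axis j 1) \<partial>torus) = (\<integral>x. F (x + frac t *\<^sub>R axis j 1) \<partial>torus)"
    by simp
  also have "\<dots> = (\<integral>x. F x \<partial>torus)"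
    by (rule 1) (auto intro: less_imp_le frac_lt_1)
  finally show ?thesis .
qed

lemma integral_torus_shift:
  fixes F :: "real^'n \<Rightarrow> real"
  assumes F: "continuous_on UNIV F" "periodic F"
  shows "(\<integral>x. F (x + v) \<partial>torus) = (\<integral>x. F x \<partial>torus)"
proof -
  have "(\<integral>x. F (x + (\<Sum>i\<in>I. (v$i) *\<^sub>R axis i 1)) \<partial>torus) = (\<integral>x. F x \<partial>torus)" if "finite I" for I
    using that
  proof (induction I)
    case (insert i I)
    let ?G = "\<lambda>x. F (x + (\<Sum>i\<in>I. (v$i) *\<^sub>R axis i 1))"
    have "continuous_on UNIV ?G"
      by (rule continuous_on_compose2[OF F(1)]) (auto intro!: continuous_intros)
    then have "(\<integral>x. ?G (x + (v$i) *\<^sub>R axis i 1) \<partial>torus) = (\<integral>x. ?G x \<partial>torus)"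
      by (rule integral_torus_shift_axis) (rule periodic_shift[OF F(2)])
    then show ?case using insert by (simp add: add.assoc)
  qed simp
  from this[of UNIV] show ?thesis by (simp add: vec_axis_sum)
qed

lemma continuous_shift:
  fixes f :: "real^'n \<Rightarrow> 'b::topological_space"
  shows "continuous_on UNIV f \<Longrightarrow> continuous_on UNIV (\<lambda>x. f (x + v))"
  by (rule continuous_on_compose2[where t=UNIV]) (auto intro!: continuous_intros)

lemma periodic_mult: "periodic f \<Longrightarrow> periodic g \<Longrightarrow> periodic (\<lambda>x. f x * (g x :: real))"
  and periodic_add: "periodic f \<Longrightarrow> periodic g \<Longrightarrow> periodic (\<lambda>x. f x + (g x :: real))"
  and periodic_diff: "periodic f \<Longrightarrow> periodic g \<Longrightarrow> periodic (\<lambda>x. f x - (g x :: real))"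
  and periodic_const [simp]: "periodic (\<lambda>x. c)"
  by (auto simp: periodic_def)

lemma periodic_compose: "periodic f \<Longrightarrow> periodic (\<lambda>x. h (f x))"
  by (auto simp: periodic_def)

lemma periodic_sum: "(\<And>i. i \<in> I \<Longrightarrow> periodic (f i)) \<Longrightarrow> periodic (\<lambda>x. \<Sum>i\<in>I. (f i x :: real))"
  by (auto simp: periodic_def intro!: sum.cong)

subsection \<open>Partial derivatives\<close>

lemma partial_eqI: "(f has_derivative f') (at x) \<Longrightarrow> partial j f x = f' (axis j 1)"
  unfolding partial_def using frechet_derivative_at by metis

lemma has_derivative_partial:
  assumes "f differentiable (at x)"
  shows "(f has_derivative (\<lambda>v. \<Sum>j\<in>UNIV. v $ j * partial j f x)) (at x)"
proof -
  have d: "(f has_derivative frechet_derivative f (at x)) (at x)"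
    using assms frechet_derivative_works by blast
  interpret bounded_linear "frechet_derivative f (at x)"
    using d has_derivative_bounded_linear by blast
  have "frechet_derivative f (at x) v = (\<Sum>j\<in>UNIV. v $ j * partial j f x)" for v
  proof -
    have "frechet_derivative f (at x) v = frechet_derivative f (at x) (\<Sum>j\<in>UNIV. (v$j) *\<^sub>R axis j 1)"
      by (simp add: vec_axis_sum)
    also have "\<dots> = (\<Sum>j\<in>UNIV. v $ j * partial j f x)"
      by (simp add: sum scale partial_def)
    finally show ?thesis .
  qed
  then have "frechet_derivative f (at x) = (\<lambda>v. \<Sum>j\<in>UNIV. v $ j * partial j f x)" by blast
  then show ?thesis using d by simp
qed

lemma partial_const [simp]: "partial j (\<lambda>x. c) = (\<lambda>x. 0)"
  by (rule ext) (rule partial_eqI[where f'="\<lambda>_. 0", simplified]; simp)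

lemma partial_add:
  "f differentiable (at x) \<Longrightarrow> g differentiable (at x) \<Longrightarrow>
    partial j (\<lambda>x. f x + g x) x = partial j f x + partial j g x"
  using partial_eqI[OF has_derivative_add] unfolding partial_def frechet_derivative_works by blast

lemma partial_diff:
  "f differentiable (at x) \<Longrightarrow> g differentiable (at x) \<Longrightarrow>
    partial j (\<lambda>x. f x - g x) x = partial j f x - partial j g x"
  using partial_eqI[OF has_derivative_diff] unfolding partial_def frechet_derivative_works by blast

lemma partial_mult:
  "f differentiable (at x) \<Longrightarrow> g differentiable (at x) \<Longrightarrow>
    partial j (\<lambda>x. f x * g x) x = f x * partial j g x + partial j f x * g x"
  using partial_eqI[OF has_derivative_mult] unfolding partial_def frechet_derivative_works by blast

lemma partial_cmult:
  "f differentiable (at x) \<Longrightarrow> partial j (\<lambda>x. c * f x) x = c * partial j f x"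
  using partial_mult[of "\<lambda>x. c" x f j] by simp

lemma partial_sum:
  assumes "\<And>i. i \<in> I \<Longrightarrow> f i differentiable (at x)"
  shows "partial j (\<lambda>x. \<Sum>i\<in>I. f i x) x = (\<Sum>i\<in>I. partial j (f i) x)"
  using partial_eqI[OF has_derivative_sum[of I f "\<lambda>i. frechet_derivative (f i) (at x)"]] assms
  unfolding partial_def frechet_derivative_works by blast

lemma partial_shift:
  assumes "f differentiable (at (x + v))"
  shows "(\<lambda>x. f (x + v)) differentiable (at x)" "partial j (\<lambda>x. f (x + v)) x = partial j f (x + v)"
proof -
  have "((\<lambda>x. f (x + v)) has_derivative (\<lambda>h. frechet_derivative f (at (x + v)) h)) (at x)"
    using assms unfolding frechet_derivative_works
    by (intro has_derivative_compose[of "\<lambda>x. x + v" "\<lambda>h. h" x UNIV f]) (auto intro!: derivative_eq_intros)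
  then show "(\<lambda>x. f (x + v)) differentiable (at x)" "partial j (\<lambda>x. f (x + v)) x = partial j f (x + v)"
    using partial_eqI[of "\<lambda>x. f (x + v)"] by (auto simp: differentiable_def partial_def)
qed

lemma partial_scale:
  assumes "f differentiable (at (c *\<^sub>R x))"
  shows "(\<lambda>x. f (c *\<^sub>R x)) differentiable (at x)" "partial j (\<lambda>x. f (c *\<^sub>R x)) x = c * partial j f (c *\<^sub>R x)"
proof -
  have d: "(f has_derivative frechet_derivative f (at (c *\<^sub>R x))) (at (c *\<^sub>R x))"
    using assms unfolding frechet_derivative_works .
  interpret bounded_linear "frechet_derivative f (at (c *\<^sub>R x))"
    using d has_derivative_bounded_linear by blast
  have "((\<lambda>x. f (c *\<^sub>R x)) has_derivative (\<lambda>h. frechet_derivative f (at (c *\<^sub>R x)) (c *\<^sub>R h))) (at x)"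
    by (rule has_derivative_compose[of "\<lambda>x. c *\<^sub>R x" "\<lambda>h. c *\<^sub>R h" x UNIV f]) (auto intro!: derivative_eq_intros d)
  then show "(\<lambda>x. f (c *\<^sub>R x)) differentiable (at x)" "partial j (\<lambda>x. f (c *\<^sub>R x)) x = c * partial j f (c *\<^sub>R x)"
    using partial_eqI[of "\<lambda>x. f (c *\<^sub>R x)"] by (auto simp: differentiable_def partial_def scale)
qed

lemma partial_chain_real:
  fixes f :: "real^'n \<Rightarrow> real"
  assumes "f differentiable (at x)" "(h has_real_derivative h') (at (f x))"
  shows "(\<lambda>x. h (f x)) differentiable (at x)" "partial j (\<lambda>x. h (f x)) x = h' * partial j f x"
proof -
  have "((\<lambda>x. h (f x)) has_derivative (\<lambda>v. h' * frechet_derivative f (at x) v)) (at x)"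
    using assms unfolding frechet_derivative_works has_field_derivative_def
    by (intro has_derivative_compose[of f _ x UNIV h "\<lambda>v. h' * v"]) auto
  then show "(\<lambda>x. h (f x)) differentiable (at x)" "partial j (\<lambda>x. h (f x)) x = h' * partial j f x"
    using partial_eqI[of "\<lambda>x. h (f x)"] by (auto simp: differentiable_def partial_def)
qed

text \<open>The class C^1 of the torus: periodicity is built in, so that integrals of derivatives
  vanish and integration by parts has no boundary terms.\<close>

definition C1 :: "(real^'n \<Rightarrow> real) \<Rightarrow> bool" where
  "C1 f \<longleftrightarrow> periodic f \<and> (\<forall>x. f differentiable (at x)) \<and> (\<forall>j. continuous_on UNIV (partial j f))"

lemma C1_continuous: "C1 f \<Longrightarrow> continuous_on UNIV f"
  unfolding C1_def by (intro continuous_at_imp_continuous_on ballI differentiable_imp_continuous_within) auto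

text \<open>No differentiability is assumed. Where a derivative exists, it is transported by the
  chain rule; where none exists, none exists at the translated point either, and the choice operator
  in \<open>frechet_derivative\<close> is applied to the same empty predicate at both
  points.\<close>

lemma periodic_partial:
  assumes "periodic f"
  shows "periodic (partial j f)"
proof -
  have eq: "(\<lambda>x. f (x + axis i 1)) = f" for i using assms by (auto simp: periodic_def)
  have "partial j f (x + axis i 1) = partial j f x" for x i
  proof (cases "f differentiable (at (x + axis i 1))")
    case True then show ?thesis using partial_shift(2)[of f x "axis i 1" j] eq by metis
  next
    case False
    have "\<not> f differentiable (at x)"
    proof
      assume "f differentiable (at x)"
      then have "(\<lambda>y. f (y + (- axis i 1))) differentiable (at (x + axis i 1))"
        using partial_shift(1)[of f "x + axis i 1" "- axis i 1"] by simp
      moreover have "(\<lambda>y. f (y + (- axis i 1))) = f"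
      proof
        fix y show "f (y + (- axis i 1)) = f y"
          using periodicD[OF assms, of "y - axis i 1" i] by simp
      qed
      ultimately show False using False by simp
    qed
    then have "\<forall>f'. \<not> (f has_derivative f') (at x)" "\<forall>f'. \<not> (f has_derivative f') (at (x + axis i 1))"
      using False by (auto simp: differentiable_def)
    then show ?thesis unfolding partial_def frechet_derivative_def by simp
  qed
  then show ?thesis by (simp add: periodic_def)
qed

lemma C1_simps: "C1 f \<Longrightarrow> f differentiable (at x)" "C1 f \<Longrightarrow> continuous_on UNIV (partial j f)"
  "C1 f \<Longrightarrow> periodic f" "C1 f \<Longrightarrow> periodic (partial j f)"
  by (auto simp: C1_def periodic_partial)

lemma C1_const [simp]: "C1 (\<lambda>x. c)"
  by (simp add: C1_def)

lemma C1_add: assumes "C1 f" "C1 g" shows "C1 (\<lambda>x. f x + g x)"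
proof -
  have "partial j (\<lambda>x. f x + g x) = (\<lambda>x. partial j f x + partial j g x)" for j
    using assms by (intro ext partial_add) (auto simp: C1_def)
  then show ?thesis using assms
    by (auto simp: C1_def intro!: continuous_intros periodic_add)
qed

lemma C1_mult: assumes "C1 f" "C1 g" shows "C1 (\<lambda>x. f x * g x)"
proof -
  have "partial j (\<lambda>x. f x * g x) = (\<lambda>x. f x * partial j g x + partial j f x * g x)" for j
    using assms by (intro ext partial_mult) (auto simp: C1_def)
  then show ?thesis using assms C1_continuous[OF assms(1)] C1_continuous[OF assms(2)]
    by (auto simp: C1_def intro!: continuous_intros periodic_mult)
qed

lemma C1_sum: "(\<And>i. i \<in> I \<Longrightarrow> C1 (f i)) \<Longrightarrow> C1 (\<lambda>x. \<Sum>i\<in>I. f i x)"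
  by (induction I rule: infinite_finite_induct) (auto intro: C1_add)

text \<open>The partial derivatives are bounded by periodicity, and the sum of their bounds
  dominates the operator norm of the differential. The constant later provides the majorant for
  difference quotients.\<close>

lemma C1_lipschitz:
  assumes f: "C1 f"
  obtains B where "B > 0" "\<And>x v. \<bar>f (x + v) - f x\<bar> \<le> B * norm v"
proof -
  have "\<exists>B>0. \<forall>x. \<bar>partial j f x\<bar> \<le> B" for j
    using periodic_bounded[of "partial j f"] C1_simps[OF f] by metis
  then obtain b where b: "\<And>j. b j > 0" "\<And>j x. \<bar>partial j f x\<bar> \<le> b j" by metis
  have "\<bar>f (x + v) - f x\<bar> \<le> sum b UNIV * norm v" for x v
  proof -
    have "norm (f (x + v) - f x) \<le> sum b UNIV * norm (x + v - x)"
    proof (rule differentiable_bound[of UNIV f "\<lambda>x v. \<Sum>j\<in>UNIV. v $ j * partial j f x"])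
      show "(f has_derivative (\<lambda>v. \<Sum>j\<in>UNIV. v $ j * partial j f y)) (at y within UNIV)" for y
        by (intro has_derivative_partial C1_simps f)
      show "onorm (\<lambda>v. \<Sum>j\<in>UNIV. v $ j * partial j f y) \<le> sum b UNIV" for y
      proof (rule onorm_le)
        fix v
        have "norm (\<Sum>j\<in>UNIV. v $ j * partial j f y) \<le> (\<Sum>j\<in>UNIV. norm v * b j)"
          by (rule order_trans[OF norm_sum], rule sum_mono)
             (simp add: abs_mult, intro mult_mono b component_le_norm_cart, auto)
        then show "norm (\<Sum>j\<in>UNIV. v $ j * partial j f y) \<le> sum b UNIV * norm v"
          by (simp add: sum_distrib_left mult.commute)
      qed
    qed auto
    then show ?thesis by simp
  qed
  moreover have "sum b UNIV > 0" using b by (intro sum_pos) auto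
  ultimately show thesis using that by blast
qed

section \<open>Difference quotients: means of derivatives and the L^1 modulus of continuity\<close>

lemma difference_quotient_tendsto:
  assumes "C1 f"
  shows "(\<lambda>n. real (Suc n) * (f (x + (1 / real (Suc n)) *\<^sub>R v) - f x))
            \<longlonglongrightarrow> (\<Sum>j\<in>UNIV. v $ j * partial j f x)"
proof -
  let ?D = "\<Sum>j\<in>UNIV. v $ j * partial j f x"
  have "((\<lambda>t. f (x + t *\<^sub>R v)) has_derivative (\<lambda>t. \<Sum>j\<in>UNIV. (t *\<^sub>R v) $ j * partial j f (x + 0 *\<^sub>R v))) (at 0)"
    by (rule has_derivative_compose[of "\<lambda>t. x + t *\<^sub>R v" "\<lambda>t. t *\<^sub>R v" 0 UNIV f])
       (auto intro!: derivative_eq_intros has_derivative_partial C1_simps assms)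
  moreover have "(\<lambda>t. \<Sum>j\<in>UNIV. (t *\<^sub>R v) $ j * partial j f (x + 0 *\<^sub>R v)) = (*) ?D"
    by (auto simp: fun_eq_iff sum_distrib_left algebra_simps)
  ultimately have "((\<lambda>t. f (x + t *\<^sub>R v)) has_real_derivative ?D) (at 0)"
    unfolding has_field_derivative_def by simp
  then have "((\<lambda>h. (f (x + h *\<^sub>R v) - f x) / h) \<longlongrightarrow> ?D) (at 0)"
    by (simp add: DERIV_def)
  moreover have "filterlim (\<lambda>n. 1 / real (Suc n)) (at 0) sequentially"
    unfolding filterlim_at using LIMSEQ_inverse_real_of_nat by (auto simp: inverse_eq_divide)
  ultimately have "(\<lambda>n. (f (x + (1 / real (Suc n)) *\<^sub>R v) - f x) / (1 / real (Suc n))) \<longlonglongrightarrow> ?D"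
    by (rule filterlim_compose)
  then show ?thesis by (simp add: mult.commute)
qed

text \<open>Every difference quotient has integral zero by translation invariance, and dominated
  convergence with the Lipschitz constant as majorant passes this to the derivative. Neither
  Fubini's theorem nor the fundamental theorem of calculus on the cube is invoked.\<close>

lemma integral_partial_zero:
  assumes F: "C1 F"
  shows "(\<integral>x. partial j F x \<partial>torus) = 0"
proof -
  obtain B where B: "B > 0" "\<And>x v. \<bar>F (x + v) - F x\<bar> \<le> B * norm v" using C1_lipschitz[OF F] by metis
  note cF = C1_continuous[OF F]
  let ?s = "\<lambda>n x. real (Suc n) * (F (x + (1 / real (Suc n)) *\<^sub>R axis j 1) - F x)"
  have lim: "(\<lambda>n. ?s n x) \<longlonglongrightarrow> partial j F x" for x
    using difference_quotient_tendsto[OF F, of x "axis j 1"] by (simp add: axis_def if_distrib[of "\<lambda>a. a * _"] cong: if_cong)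
  have "(\<lambda>n. \<integral>x. ?s n x \<partial>torus) \<longlonglongrightarrow> (\<integral>x. partial j F x \<partial>torus)"
  proof (rule integral_dominated_convergence[where w="\<lambda>_. B"])
    show "partial j F \<in> borel_measurable torus" by (intro continuous_measurable_torus C1_simps F)
    show "?s n \<in> borel_measurable torus" for n
      by (intro continuous_measurable_torus continuous_intros continuous_shift[OF cF] cF)
    show "AE x in torus. norm (?s n x) \<le> B" for n
    proof (rule AE_I2)
      fix x
      have "\<bar>F (x + (1 / real (Suc n)) *\<^sub>R axis j 1) - F x\<bar> \<le> B * (1 / real (Suc n))"
        using B(2)[of x "(1 / real (Suc n)) *\<^sub>R axis j 1"] by (simp add: norm_axis_1)
      then have "real (Suc n) * \<bar>F (x + (1 / real (Suc n)) *\<^sub>R axis j 1) - F x\<bar> \<le> real (Suc n) * (B * (1 / real (Suc n)))"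
        by (intro mult_left_mono) auto
      then show "norm (?s n x) \<le> B" by (simp add: abs_mult)
    qed
  qed (use lim in auto)
  moreover have "(\<integral>x. ?s n x \<partial>torus) = 0" for n
    using integral_torus_shift[OF cF C1_simps(3)[OF F]]
    by (simp add: Bochner_Integration.integral_diff integrable_torus_continuous cF continuous_shift[OF cF])
  ultimately have "(\<lambda>n. 0) \<longlonglongrightarrow> (\<integral>x. partial j F x \<partial>torus)" by simp
  then show ?thesis by (simp add: LIMSEQ_const_iff)
qed

text \<open>By translation invariance \<open>D\<close> is subadditive, hence \<open>D v\<close> is
  at most \<open>n * D (v / n)\<close>. The right-hand side is the L^1 norm of a difference quotient
  and converges to that of the directional derivative, so no integration along the segment is
  needed.\<close>

lemma L1_shift_le:
  assumes f: "C1 f"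
  shows "(\<integral>x. \<bar>f (x + v) - f x\<bar> \<partial>torus) \<le> (\<Sum>j\<in>UNIV. \<bar>v $ j\<bar> * (\<integral>x. \<bar>partial j f x\<bar> \<partial>torus))"
proof -
  note cf = C1_continuous[OF f]
  obtain B where B: "B > 0" "\<And>x v. \<bar>f (x + v) - f x\<bar> \<le> B * norm v" using C1_lipschitz[OF f] by metis
  define D where "D = (\<lambda>v. \<integral>x. \<bar>f (x + v) - f x\<bar> \<partial>torus)"
  have int: "integrable torus (\<lambda>x. \<bar>f (x + v) - f (x + w)\<bar>)" for v w
    by (intro integrable_torus_continuous continuous_intros continuous_shift[OF cf] cf)
  have sub: "D (v + w) \<le> D v + D w" for v w
  proof -
    have "D (v + w) \<le> (\<integral>x. \<bar>f ((x + w) + v) - f (x + w)\<bar> + \<bar>f (x + w) - f x\<bar> \<partial>torus)"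
      unfolding D_def
    proof (rule integral_mono)
      show "integrable torus (\<lambda>x. \<bar>f (x + (v + w)) - f x\<bar>)" using int[of "v+w" 0] by simp
      show "integrable torus (\<lambda>x. \<bar>f (x + w + v) - f (x + w)\<bar> + \<bar>f (x + w) - f x\<bar>)"
        using int[of "w+v" w] int[of w 0] by (intro Bochner_Integration.integrable_add) (simp_all add: add.assoc)
    qed (simp add: algebra_simps)
    also have "\<dots> = (\<integral>x. \<bar>f ((x + w) + v) - f (x + w)\<bar> \<partial>torus) + D w"
      unfolding D_def using int[of "w+v" w] int[of w 0]
      by (intro Bochner_Integration.integral_add) (simp_all add: add.assoc)
    also have "(\<integral>x. \<bar>f ((x + w) + v) - f (x + w)\<bar> \<partial>torus) = D v"
      unfolding D_def
      by (rule integral_torus_shift[of "\<lambda>x. \<bar>f (x + v) - f x\<bar>" w])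
         (intro continuous_intros continuous_shift[OF cf] cf periodic_compose[of _ abs] periodic_diff periodic_shift[OF C1_simps(3)[OF f]] C1_simps(3)[OF f])+
    finally show ?thesis .
  qed
  have mult: "D (real n *\<^sub>R w) \<le> real n * D w" for n w
  proof (induction n)
    case 0 then show ?case by (simp add: D_def)
  next
    case (Suc n)
    have "D (real (Suc n) *\<^sub>R w) \<le> D w + D (real n *\<^sub>R w)"
      using sub[of w "real n *\<^sub>R w"] by (simp add: algebra_simps)
    then show ?case using Suc by (simp add: algebra_simps)
  qed
  let ?s = "\<lambda>n x. \<bar>real (Suc n) * (f (x + (1 / real (Suc n)) *\<^sub>R v) - f x)\<bar>"
  let ?D = "\<lambda>x. \<bar>\<Sum>j\<in>UNIV. v $ j * partial j f x\<bar>"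
  have "(\<lambda>n. \<integral>x. ?s n x \<partial>torus) \<longlonglongrightarrow> (\<integral>x. ?D x \<partial>torus)"
  proof (rule integral_dominated_convergence[where w="\<lambda>_. B * norm v"])
    show "?D \<in> borel_measurable torus" by (intro continuous_measurable_torus continuous_intros C1_simps f)
    show "?s n \<in> borel_measurable torus" for n
      by (intro continuous_measurable_torus continuous_intros continuous_shift[OF cf] cf)
    show "AE x in torus. norm (?s n x) \<le> B * norm v" for n
    proof (rule AE_I2)
      fix x
      have "\<bar>f (x + (1 / real (Suc n)) *\<^sub>R v) - f x\<bar> \<le> B * (1 / real (Suc n) * norm v)"
        using B(2)[of x "(1 / real (Suc n)) *\<^sub>R v"] by simp
      then have "real (Suc n) * \<bar>f (x + (1 / real (Suc n)) *\<^sub>R v) - f x\<bar> \<le> real (Suc n) * (B * (1 / real (Suc n) * norm v))"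
        by (intro mult_left_mono) auto
      then show "norm (?s n x) \<le> B * norm v" by (simp add: abs_mult)
    qed
    show "AE x in torus. (\<lambda>n. ?s n x) \<longlonglongrightarrow> ?D x"
      by (intro AE_I2 tendsto_rabs difference_quotient_tendsto f)
  qed auto
  moreover have "D v \<le> (\<integral>x. ?s n x \<partial>torus)" for n
    using mult[of "Suc n" "(1 / real (Suc n)) *\<^sub>R v"]
    by (simp add: D_def abs_mult del: of_nat_Suc)
  ultimately have "D v \<le> (\<integral>x. ?D x \<partial>torus)"
    by (intro LIMSEQ_le_const) auto
  also have "\<dots> \<le> (\<integral>x. (\<Sum>j\<in>UNIV. \<bar>v $ j\<bar> * \<bar>partial j f x\<bar>) \<partial>torus)"
  proof (rule integral_mono)
    show "?D x \<le> (\<Sum>j\<in>UNIV. \<bar>v $ j\<bar> * \<bar>partial j f x\<bar>)" for x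
      by (rule order_trans[OF sum_abs]) (simp add: abs_mult)
  qed (intro integrable_torus_continuous continuous_intros C1_simps(2)[OF f])+
  also have "\<dots> = (\<Sum>j\<in>UNIV. \<bar>v $ j\<bar> * (\<integral>x. \<bar>partial j f x\<bar> \<partial>torus))"
    by (subst Bochner_Integration.integral_sum)
       (auto intro!: integrable_torus_continuous continuous_intros C1_simps(2)[OF f])
  finally show ?thesis by (simp add: D_def)
qed

subsection \<open>Trigonometric polynomials\<close>

text \<open>Encoded as the algebra generated by the coordinate sines and cosines rather than as
  Fourier sums: closure under products is a rule, and closure under differentiation is an
  induction.\<close>

inductive trig_poly :: "(real^'n \<Rightarrow> real) \<Rightarrow> bool" where
  const: "trig_poly (\<lambda>x. c)"
| cos: "trig_poly (\<lambda>x. cos (2 * pi * x $ j))"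
| sin: "trig_poly (\<lambda>x. sin (2 * pi * x $ j))"
| add: "trig_poly f \<Longrightarrow> trig_poly g \<Longrightarrow> trig_poly (\<lambda>x. f x + g x)"
| mult: "trig_poly f \<Longrightarrow> trig_poly g \<Longrightarrow> trig_poly (\<lambda>x. f x * g x)"

lemma trig_poly_cmult: "trig_poly f \<Longrightarrow> trig_poly (\<lambda>x. c * f x)"
  by (rule trig_poly.mult[OF trig_poly.const])

lemma trig_poly_diff: "trig_poly f \<Longrightarrow> trig_poly g \<Longrightarrow> trig_poly (\<lambda>x. f x - g x)"
  using trig_poly.add[OF _ trig_poly_cmult[of g "-1"]] by simp

lemma trig_poly_prod: "(\<And>i. i \<in> I \<Longrightarrow> trig_poly (f i)) \<Longrightarrow> trig_poly (\<lambda>x. \<Prod>i\<in>I. f i x)"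
  by (induction I rule: infinite_finite_induct) (auto intro: trig_poly.intros)

lemma trig_poly_power: "trig_poly f \<Longrightarrow> trig_poly (\<lambda>x. f x ^ n)"
  by (induction n) (auto intro: trig_poly.intros)

lemma has_derivative_cos_nth:
  "((\<lambda>x::real^'n. cos (2 * pi * x $ j)) has_derivative (\<lambda>v. - sin (2 * pi * x $ j) * (2 * pi * v $ j))) (at x)"
  "((\<lambda>x::real^'n. sin (2 * pi * x $ j)) has_derivative (\<lambda>v. cos (2 * pi * x $ j) * (2 * pi * v $ j))) (at x)"
  by (auto intro!: derivative_eq_intros bounded_linear.has_derivative[OF bounded_linear_vec_nth])

lemma partial_cos_nth:
  "partial i (\<lambda>x. cos (2 * pi * x $ j)) = (\<lambda>x. (if i = j then - 2 * pi else 0) * sin (2 * pi * x $ j))"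
  "partial i (\<lambda>x. sin (2 * pi * x $ j)) = (\<lambda>x. (if i = j then 2 * pi else 0) * cos (2 * pi * x $ j))"
  by (rule ext, subst partial_eqI[OF has_derivative_cos_nth(1)], simp add: axis_def)
     (rule ext, subst partial_eqI[OF has_derivative_cos_nth(2)], simp add: axis_def)

text \<open>The three properties are proved together because the sum and product rules for
  \<open>partial\<close> need the differentiability of both operands in the induction
  hypothesis.\<close>

lemma trig_poly_differentiable:
  assumes "trig_poly f"
  shows "periodic f \<and> (\<forall>x. f differentiable (at x)) \<and> (\<forall>j. trig_poly (partial j f))"
  using assms
proof induction
  case (const c)
  then show ?case by (auto intro: trig_poly.intros)
next
  case (cos j)
  have "periodic (\<lambda>x. cos (2 * pi * x $ j))"
    by (auto simp: periodic_def axis_def distrib_left)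
  then show ?case
    using has_derivative_cos_nth(1) trig_poly_cmult[OF trig_poly.sin]
    unfolding differentiable_def partial_cos_nth by blast
next
  case (sin j)
  have "periodic (\<lambda>x. sin (2 * pi * x $ j))"
    by (auto simp: periodic_def axis_def distrib_left)
  then show ?case
    using has_derivative_cos_nth(2) trig_poly_cmult[OF trig_poly.cos]
    unfolding differentiable_def partial_cos_nth by blast
next
  case (add f g)
  then have "partial j (\<lambda>x. f x + g x) = (\<lambda>x. partial j f x + partial j g x)" for j
    by (intro ext partial_add) auto
  then show ?case using add by (auto intro!: periodic_add trig_poly.add)
next
  case (mult f g)
  then have "partial j (\<lambda>x. f x * g x) = (\<lambda>x. f x * partial j g x + partial j f x * g x)" for j
    by (intro ext partial_mult) auto
  then show ?case using mult by (auto intro!: periodic_mult trig_poly.add trig_poly.mult)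
qed

lemma trig_poly_partial: "trig_poly f \<Longrightarrow> trig_poly (partial j f)"
  using trig_poly_differentiable by blast

lemma trig_poly_continuous: "trig_poly f \<Longrightarrow> continuous_on UNIV f"
  using trig_poly_differentiable
  by (intro continuous_at_imp_continuous_on ballI differentiable_imp_continuous_within) auto

lemma trig_poly_C1: "trig_poly f \<Longrightarrow> C1 f"
  unfolding C1_def using trig_poly_differentiable trig_poly_continuous by blast

lemma trig_poly_periodic: "trig_poly f \<Longrightarrow> periodic f"
  using trig_poly_differentiable by blast

text \<open>This makes trigonometric polynomials legitimate test functions in
  \<open>is_weak_gradient\<close>.\<close>

lemma trig_poly_Ck: "trig_poly f \<Longrightarrow> Ck k f"
  by (induction k arbitrary: f) (use trig_poly_differentiable trig_poly_continuous in auto)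

text \<open>
  Kernels of finite rank: for these, convolution is a finite sum, so differentiation under the
  integral and Fubini's theorem need no limit argument.
\<close>

inductive separable :: "(real^'n \<Rightarrow> real^'n \<Rightarrow> real) \<Rightarrow> bool" where
  base: "trig_poly a \<Longrightarrow> trig_poly b \<Longrightarrow> separable (\<lambda>x y. a x * b y)"
| add: "separable K \<Longrightarrow> separable L \<Longrightarrow> separable (\<lambda>x y. K x y + L x y)"

lemma separable_mult_base:
  assumes "separable K" "trig_poly a" "trig_poly b"
  shows "separable (\<lambda>x y. (a x * b y) * K x y)"
  using assms(1)
proof induction
  case (base a' b')
  have "separable (\<lambda>x y. (a x * a' x) * (b y * b' y))"
    using base assms by (intro separable.base trig_poly.mult)
  then show ?case by (simp add: algebra_simps)
next
  case (add K L)
  then show ?case using separable.add by (fastforce simp: distrib_left)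
qed

lemma separable_mult:
  assumes "separable K" "separable L"
  shows "separable (\<lambda>x y. K x y * L x y)"
  using assms(1)
proof induction
  case (base a b)
  then show ?case using separable_mult_base[OF assms(2)] by simp
next
  case (add K K')
  then show ?case using separable.add by (fastforce simp: distrib_right)
qed

text \<open>Only the generators require work: the addition formulas write the cosine and sine of a
  difference as kernels of rank two, and finite rank is stable under sums and products.\<close>

lemma separable_diff:
  assumes "trig_poly f"
  shows "separable (\<lambda>x y. f (x - y))"
  using assms
proof induction
  case (const c)
  show ?case using separable.base[OF trig_poly.const[of c] trig_poly.const[of 1]] by simp
next
  case (cos j)
  have "separable (\<lambda>x y. cos (2 * pi * x $ j) * cos (2 * pi * y $ j) + sin (2 * pi * x $ j) * sin (2 * pi * y $ j))"
    by (intro separable.intros trig_poly.intros)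
  then show ?case by (simp add: right_diff_distrib cos_diff)
next
  case (sin j)
  have "separable (\<lambda>x y. sin (2 * pi * x $ j) * cos (2 * pi * y $ j) + ((-1) * cos (2 * pi * x $ j)) * sin (2 * pi * y $ j))"
    by (intro separable.intros trig_poly.intros)
  then show ?case by (simp add: right_diff_distrib sin_diff)
qed (auto intro: separable.add separable_mult)

lemma separable_trig_poly:
  "separable K \<Longrightarrow> trig_poly (\<lambda>x. K x y) \<and> trig_poly (\<lambda>y. K x y)"
  by (induction rule: separable.induct) (auto intro: trig_poly.intros)

section \<open>Convolution with trigonometric polynomials\<close>

lemma integrable_mult_bounded:
  fixes u b :: "real^'n \<Rightarrow> real"
  assumes "integrable torus u" "b \<in> borel_measurable torus" "\<And>x. \<bar>b x\<bar> \<le> B"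
  shows "integrable torus (\<lambda>x. u x * b x)"
proof (rule Bochner_Integration.integrable_bound[where f="\<lambda>x. B * u x"])
  show "AE x in torus. norm (u x * b x) \<le> norm (B * u x)"
  proof (rule AE_I2)
    fix x
    have "\<bar>u x\<bar> * \<bar>b x\<bar> \<le> \<bar>u x\<bar> * \<bar>B\<bar>" using assms(3)[of x] by (intro mult_left_mono) auto
    then show "norm (u x * b x) \<le> norm (B * u x)" by (simp add: abs_mult mult.commute)
  qed
qed (use assms in auto)

lemma integrable_mult_continuous:
  fixes u b :: "real^'n \<Rightarrow> real"
  assumes "integrable torus u" "periodic b" "continuous_on UNIV b"
  shows "integrable torus (\<lambda>x. u x * b x)"
proof -
  obtain B where "\<And>x. \<bar>b x\<bar> \<le> B" using periodic_bounded[OF assms(2,3)] by metis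
  then show ?thesis using assms continuous_measurable_torus by (intro integrable_mult_bounded) auto
qed

lemma integrable_mult_trig: "integrable torus u \<Longrightarrow> trig_poly b \<Longrightarrow> integrable torus (\<lambda>x. u x * b x)"
  by (intro integrable_mult_continuous trig_poly_periodic trig_poly_continuous)

lemma trig_poly_partial_add:
  assumes "trig_poly f" "trig_poly g"
  shows "partial j (\<lambda>x. f x + g x) x = partial j f x + partial j g x"
  using C1_simps(1)[OF trig_poly_C1] assms by (intro partial_add)

lemma trig_poly_integral_add:
  assumes "trig_poly f" "trig_poly g"
  shows "(\<integral>x. f x + g x \<partial>torus) = (\<integral>x. f x \<partial>torus) + (\<integral>x. g x \<partial>torus)"
  using assms by (intro Bochner_Integration.integral_add integrable_torus_continuous trig_poly_continuous)

text \<open>For rank one, the factor depending on \<open>x\<close> leaves the integral and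
  everything is explicit. For sums, additivity of the Bochner integral needs each summand to be
  integrable; for this the slices of the kernel, its \<open>x\<close>-derivatives and its
  \<open>x\<close>-means are shown to be trigonometric polynomials in \<open>y\<close>.\<close>

lemma separable_convolution:
  assumes "separable K" "integrable torus u"
  shows "trig_poly (\<lambda>x. \<integral>y. u y * K x y \<partial>torus) \<and>
    (\<forall>j x. partial j (\<lambda>x. \<integral>y. u y * K x y \<partial>torus) x = (\<integral>y. u y * partial j (\<lambda>x. K x y) x \<partial>torus)) \<and>
    (\<integral>x. (\<integral>y. u y * K x y \<partial>torus) \<partial>torus) = (\<integral>y. u y * (\<integral>x. K x y \<partial>torus) \<partial>torus)"
  using assms(1)
proof induction
  case (base a b)
  have eq: "(\<lambda>x. \<integral>y. u y * (a x * b y) \<partial>torus) = (\<lambda>x. (\<integral>y. u y * b y \<partial>torus) * a x)"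
  proof
    fix x
    have "(\<integral>y. u y * (a x * b y) \<partial>torus) = (\<integral>y. a x * (u y * b y) \<partial>torus)"
      by (simp add: algebra_simps)
    then show "(\<integral>y. u y * (a x * b y) \<partial>torus) = (\<integral>y. u y * b y \<partial>torus) * a x" by simp
  qed
  have d: "a differentiable (at x)" for x using trig_poly_differentiable base by blast
  have "partial j (\<lambda>x. a x * b y) x = b y * partial j a x" for j x y
    using partial_cmult[OF d, where c = "b y"] by (simp add: mult.commute)
  then have "(\<integral>y. u y * partial j (\<lambda>x. a x * b y) x \<partial>torus) = (\<integral>y. partial j a x * (u y * b y) \<partial>torus)" for j x
    by (simp add: algebra_simps)
  moreover have "(\<integral>y. u y * (\<integral>x. a x * b y \<partial>torus) \<partial>torus) = (\<integral>y. (\<integral>x. a x \<partial>torus) * (u y * b y) \<partial>torus)"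
    by (simp add: algebra_simps)
  ultimately show ?case
    unfolding eq using base partial_cmult[OF d] by (simp add: trig_poly_cmult)
next
  case (add K L)
  have t: "trig_poly (\<lambda>y. K x y)" "trig_poly (\<lambda>y. L x y)" "trig_poly (\<lambda>x. K x y)" "trig_poly (\<lambda>x. L x y)" for x y
    using add separable_trig_poly by blast+
  have int: "integrable torus (\<lambda>y. u y * K x y)" "integrable torus (\<lambda>y. u y * L x y)" for x
    by (intro integrable_mult_trig assms(2) t)+
  have eq: "(\<lambda>x. \<integral>y. u y * (K x y + L x y) \<partial>torus) = (\<lambda>x. (\<integral>y. u y * K x y \<partial>torus) + (\<integral>y. u y * L x y \<partial>torus))"
    by (simp add: distrib_left Bochner_Integration.integral_add int)
  have sK: "separable K" and sL: "separable L" using add by auto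
  have partials: "integrable torus (\<lambda>y. u y * partial j (\<lambda>x. K x y) x)" if "separable K" for K j x
  proof -
    have "trig_poly (\<lambda>y. partial j (\<lambda>x. K x y) x)"
      using that
    proof induction
      case (base a b)
      have "partial j (\<lambda>x. a x * b y) x = b y * partial j a x" for y
        using partial_cmult[of a x j "b y"] trig_poly_differentiable[OF base(1)] by (simp add: mult.commute)
      then show ?case using trig_poly_cmult[OF base(2), of "partial j a x"] by (simp only: mult.commute)
    next
      case (add K L)
      then have "trig_poly (\<lambda>x. K x y)" "trig_poly (\<lambda>x. L x y)" for y
        using separable_trig_poly by blast+
      note trig_poly_partial_add[OF this]
      then show ?case using trig_poly.add[OF add.IH] by simp
    qed
    then show ?thesis using integrable_mult_trig[OF assms(2)] by blast
  qed
  have slices: "integrable torus (\<lambda>y. u y * (\<integral>x. K x y \<partial>torus))" if "separable K" for K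
  proof -
    have "trig_poly (\<lambda>y. \<integral>x. K x y \<partial>torus)"
      using that
    proof induction
      case (base a b)
      then show ?case by (auto intro: trig_poly_cmult)
    next
      case (add K L)
      then have "trig_poly (\<lambda>x. K x y)" "trig_poly (\<lambda>x. L x y)" for y
        using separable_trig_poly by blast+
      note trig_poly_integral_add[OF this]
      then show ?case using trig_poly.add[OF add.IH] by simp
    qed
    then show ?thesis using integrable_mult_trig[OF assms(2)] by blast
  qed
  have trig: "trig_poly (\<lambda>x. \<integral>y. u y * K x y \<partial>torus)" "trig_poly (\<lambda>x. \<integral>y. u y * L x y \<partial>torus)"
    using add by blast+
  have "partial j (\<lambda>x. (\<integral>y. u y * K x y \<partial>torus) + (\<integral>y. u y * L x y \<partial>torus)) x
      = (\<integral>y. u y * partial j (\<lambda>x. K x y + L x y) x \<partial>torus)" for j x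
  proof -
    have "(\<integral>y. u y * partial j (\<lambda>x. K x y + L x y) x \<partial>torus) =
        (\<integral>y. u y * partial j (\<lambda>x. K x y) x + u y * partial j (\<lambda>x. L x y) x \<partial>torus)"
      using trig_poly_partial_add[OF t(3,4)] by (simp only: distrib_left)
    also have "\<dots> = (\<integral>y. u y * partial j (\<lambda>x. K x y) x \<partial>torus) + (\<integral>y. u y * partial j (\<lambda>x. L x y) x \<partial>torus)"
      by (intro Bochner_Integration.integral_add partials sK sL)
    finally show ?thesis using trig_poly_partial_add[OF trig] add by simp
  qed
  moreover have "(\<integral>x. (\<integral>y. u y * K x y \<partial>torus) + (\<integral>y. u y * L x y \<partial>torus) \<partial>torus)
     = (\<integral>y. u y * (\<integral>x. K x y + L x y \<partial>torus) \<partial>torus)"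
  proof -
    have "(\<integral>y. u y * (\<integral>x. K x y + L x y \<partial>torus) \<partial>torus) =
        (\<integral>y. u y * (\<integral>x. K x y \<partial>torus) + u y * (\<integral>x. L x y \<partial>torus) \<partial>torus)"
      using trig_poly_integral_add[OF t(3,4)] by (simp only: distrib_left)
    also have "\<dots> = (\<integral>y. u y * (\<integral>x. K x y \<partial>torus) \<partial>torus) + (\<integral>y. u y * (\<integral>x. L x y \<partial>torus) \<partial>torus)"
      by (intro Bochner_Integration.integral_add slices sK sL)
    finally show ?thesis using trig_poly_integral_add[OF trig] add by simp
  qed
  ultimately show ?case
    unfolding eq using trig_poly.add[OF trig] by blast
qed

definition conv :: "(real^'n \<Rightarrow> real) \<Rightarrow> (real^'n \<Rightarrow> real) \<Rightarrow> real^'n \<Rightarrow> real" where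
  "conv f u x = (\<integral>y. u y * f (x - y) \<partial>torus)"

lemma
  assumes "trig_poly f" "integrable torus u"
  shows trig_poly_conv: "trig_poly (conv f u)"
    and partial_conv: "partial j (conv f u) x = conv (partial j f) u x"
    and integral_conv: "(\<integral>x. conv f u x \<partial>torus) = (\<integral>y. u y * (\<integral>x. f (x - y) \<partial>torus) \<partial>torus)"
proof -
  have eq: "conv f u = (\<lambda>x. \<integral>y. u y * f (x - y) \<partial>torus)" by (simp add: conv_def fun_eq_iff)
  note sep = separable_convolution[OF separable_diff[OF assms(1)] assms(2)]
  show "trig_poly (conv f u)" "(\<integral>x. conv f u x \<partial>torus) = (\<integral>y. u y * (\<integral>x. f (x - y) \<partial>torus) \<partial>torus)"
    unfolding eq using sep by blast+
  have "partial j (\<lambda>x. f (x - y)) x = partial j f (x - y)" for y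
    using partial_shift(2)[of f x "- y" j] trig_poly_differentiable[OF assms(1)] by simp
  then show "partial j (conv f u) x = conv (partial j f) u x"
    using sep unfolding eq conv_def by simp
qed

lemma
  assumes "trig_poly f"
  shows trig_poly_reflect: "trig_poly (\<lambda>y. f (x - y))"
    and partial_reflect: "partial j (\<lambda>y. f (x - y)) y = - partial j f (x - y)"
proof -
  show "trig_poly (\<lambda>y. f (x - y))"
    using separable_trig_poly[OF separable_diff[OF assms]] by blast
  have d: "f differentiable (at z)" for z using trig_poly_differentiable[OF assms] by blast
  have "partial j (\<lambda>y. (\<lambda>z. f (z + x)) ((-1) *\<^sub>R y)) y = (-1) * partial j (\<lambda>z. f (z + x)) ((-1) *\<^sub>R y)"
    using partial_shift[OF d] by (intro partial_scale(2)) auto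
  then show "partial j (\<lambda>y. f (x - y)) y = - partial j f (x - y)"
    using partial_shift(2)[OF d] by simp
qed

lemma conv_diff:
  assumes "trig_poly f" "integrable torus u" "integrable torus v"
  shows "conv f (\<lambda>x. u x - v x) x = conv f u x - conv f v x"
  unfolding conv_def left_diff_distrib
  using assms by (intro Bochner_Integration.integral_diff integrable_mult_trig trig_poly_reflect)

subsection \<open>An approximate identity\<close>

text \<open>A product of de la Vallee-Poussin kernels: each factor is cos(pi x_j)^(2N), written
  through the double angle so that it is visibly a trigonometric polynomial. It is nonnegative and
  concentrates at the lattice points as \<open>N\<close> grows.\<close>

definition bump :: "nat \<Rightarrow> real^'n \<Rightarrow> real" where
  "bump N x = (\<Prod>j\<in>UNIV. ((1 + cos (2 * pi * x $ j)) / 2) ^ N)"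

definition kern :: "nat \<Rightarrow> real^'n \<Rightarrow> real" where
  "kern N x = bump N x / (\<integral>y. bump N y \<partial>(torus :: (real^'n) measure))"

lemma trig_poly_half_angle: "trig_poly (\<lambda>x. (1 + cos (2 * pi * x $ j)) / 2)"
  "trig_poly (\<lambda>x. (1 - cos (2 * pi * x $ j)) / 2)"
  using trig_poly_cmult[OF trig_poly.add[OF trig_poly.const[of 1] trig_poly.cos[of j]], of "1/2"]
    trig_poly_cmult[OF trig_poly_diff[OF trig_poly.const[of 1] trig_poly.cos[of j]], of "1/2"] by simp_all

lemma trig_poly_bump: "trig_poly (bump N)"
  unfolding bump_def[abs_def] by (intro trig_poly_prod trig_poly_power trig_poly_half_angle)

lemma half_angle_nonneg:
  fixes t :: real
  shows "0 \<le> (1 + cos t) / 2" "0 \<le> (1 - cos t) / 2"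
proof -
  show "0 \<le> (1 + cos t) / 2" using cos_ge_minus_one[of t] by (intro divide_nonneg_pos) linarith+
  show "0 \<le> (1 - cos t) / 2" using cos_le_one[of t] by (intro divide_nonneg_pos) linarith+
qed

lemma bump_nonneg: "bump N x \<ge> 0"
  unfolding bump_def by (intro prod_nonneg ballI zero_le_power half_angle_nonneg)

lemma integral_bump_pos: "(\<integral>y. bump N y \<partial>(torus :: (real^'n) measure)) > 0"
proof -
  have "(\<integral>y. bump N y \<partial>(torus :: (real^'n) measure)) \<noteq> 0"
  proof
    assume "(\<integral>y. bump N y \<partial>(torus :: (real^'n) measure)) = 0"
    then have "bump N (0::real^'n) = 0"
      by (rule integral_zero_imp_zero[OF trig_poly_periodic[OF trig_poly_bump] trig_poly_continuous[OF trig_poly_bump] bump_nonneg])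
    then show False by (simp add: bump_def)
  qed
  moreover have "(\<integral>y. bump N y \<partial>(torus :: (real^'n) measure)) \<ge> 0"
    by (intro integral_nonneg_AE AE_I2 bump_nonneg)
  ultimately show ?thesis by linarith
qed

lemma integral_bump_neq_0 [simp]: "(\<integral>y. bump N y \<partial>torus) \<noteq> 0"
  using integral_bump_pos[of N] by (rule less_imp_neq[symmetric])

lemma trig_poly_kern: "trig_poly (kern N)"
  using trig_poly_cmult[OF trig_poly_bump[of N], of "1 / (\<integral>y. bump N y \<partial>(torus :: (real^'n) measure))"]
  by (simp add: kern_def[abs_def])

lemma kern_nonneg: "kern N x \<ge> 0"
  unfolding kern_def using integral_bump_pos[of N] bump_nonneg by (intro divide_nonneg_pos)

lemma integral_kern: "(\<integral>x. kern N x \<partial>torus) = 1"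
  unfolding kern_def by simp

lemma kern_even: "kern N (x - y) = kern N (y - x)"
proof -
  have "cos (2 * pi * (x $ j - y $ j)) = cos (2 * pi * (y $ j - x $ j))" for j
    using cos_minus[of "2 * pi * (x $ j - y $ j)"] by (simp add: algebra_simps)
  then show ?thesis by (simp add: kern_def bump_def)
qed

lemma integral_kern_shift: "(\<integral>x. kern N (x - y) \<partial>torus) = 1" "(\<integral>y. kern N (x - y) \<partial>torus) = 1"
proof -
  show *: "(\<integral>x. kern N (x - y) \<partial>torus) = 1" for y
    using integral_torus_shift[OF trig_poly_continuous trig_poly_periodic, OF trig_poly_kern trig_poly_kern, of N "- y"]
    by (simp add: integral_kern)
  show "(\<integral>y. kern N (x - y) \<partial>torus) = 1"
    using *[of x] by (subst kern_even) simp
qed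

lemma partial_zero_of_invariant:
  assumes "C1 f" "\<And>t. f (x + t *\<^sub>R axis j 1) = f x"
  shows "partial j f x = 0"
proof -
  have "(\<lambda>n. 0) \<longlonglongrightarrow> (\<Sum>i\<in>UNIV. axis j 1 $ i * partial i f x)"
    using difference_quotient_tendsto[OF assms(1), of x "axis j 1"] assms(2) by simp
  then have "(\<Sum>i\<in>UNIV. axis j 1 $ i * partial i f x) = 0" by (simp add: LIMSEQ_const_iff)
  then show ?thesis by (simp add: axis_def if_distrib[of "\<lambda>a. a * _"] cong: if_cong)
qed

text \<open>The ratio of the second-order moment to the total mass is exact and comes from one
  integration by parts in \<open>x $ j\<close>, so that neither closed forms nor asymptotics of the
  normalizing integral enter. Here \<open>c\<close> and \<open>s\<close> are the squared cosine and
  sine of pi x_j, and the weight (1 - cos)/2 measures the squared distance to the lattice in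
  direction \<open>j\<close>.\<close>

lemma bump_moment:
  fixes j :: "'n::finite"
  shows "(\<integral>x. (1 - cos (2 * pi * x $ j)) / 2 * bump N x \<partial>torus) =
    (\<integral>x. bump N x \<partial>(torus :: (real^'n) measure)) / (2 * real N + 2)"
proof -
  define c s where "c = (\<lambda>x::real^'n. (1 + cos (2 * pi * x $ j)) / 2)"
    and "s = (\<lambda>x::real^'n. (1 - cos (2 * pi * x $ j)) / 2)"
  define R where "R = (\<lambda>x::real^'n. \<Prod>i\<in>UNIV - {j}. ((1 + cos (2 * pi * x $ i)) / 2) ^ N)"
  have bump: "bump N = (\<lambda>x. c x ^ N * R x)"
    unfolding bump_def[abs_def] c_def R_def by (intro ext prod.remove) auto
  have tR: "trig_poly R" unfolding R_def by (intro trig_poly_prod trig_poly_power trig_poly_half_angle)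
  have tc: "trig_poly c" "trig_poly s" unfolding c_def s_def by (intro trig_poly_half_angle)+
  have pR: "partial j R x = 0" for x
    by (rule partial_zero_of_invariant[OF trig_poly_C1[OF tR]]) (auto simp: R_def axis_def intro!: prod.cong)
  have d: "R differentiable (at x)" "(\<lambda>x. cos (2 * pi * x $ j)) differentiable (at x)"
     "(\<lambda>x. sin (2 * pi * x $ j)) differentiable (at x)" "bump N differentiable (at x)" for x
    using trig_poly_differentiable tR trig_poly.cos trig_poly.sin trig_poly_bump by blast+
  have dh: "((\<lambda>t. ((1 + t) / 2) ^ N) has_real_derivative real N * c x ^ (N - 1) / 2) (at (cos (2 * pi * x $ j)))" for x
    unfolding c_def by (auto intro!: derivative_eq_intros)
  have pc: "(\<lambda>x. c x ^ N) differentiable (at x)"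
    "partial j (\<lambda>x. c x ^ N) x = real N * c x ^ (N - 1) / 2 * (- 2 * pi * sin (2 * pi * x $ j))" for x
    using partial_chain_real(1)[OF d(2)[of x] dh[of x]] partial_chain_real(2)[OF d(2)[of x] dh[of x], where j=j]
    by (simp_all add: c_def partial_cos_nth)
  have pb: "partial j (bump N) x = real N * c x ^ (N - 1) / 2 * (- 2 * pi * sin (2 * pi * x $ j)) * R x" for x
    unfolding bump using partial_mult[OF pc(1) d(1), of j x] pc(2) pR by simp
  \<comment> \<open>Differentiating this function gives 2 pi times
    \<open>bump N - (2N + 2) * s * bump N\<close>, and the integral of a derivative
    vanishes.\<close>
  define F where "F = (\<lambda>x. sin (2 * pi * x $ j) * bump N x)"
  have tF: "trig_poly F" unfolding F_def by (intro trig_poly.intros trig_poly_bump)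
  have sq: "sin (2 * pi * x $ j) * sin (2 * pi * x $ j) = 4 * c x * s x" for x :: "real^'n"
  proof -
    have "4 * c x * s x = 1 - cos (2 * pi * x $ j) * cos (2 * pi * x $ j)"
      unfolding c_def s_def by (simp add: field_simps)
    then show ?thesis
      using sin_squared_eq[of "2 * pi * x $ j"] by (simp only: power2_eq_square)
  qed
  have pF: "partial j F x = 2 * pi * (bump N x - (2 * real N + 2) * (s x * bump N x))" for x
  proof -
    have "partial j F x = sin (2 * pi * x $ j) * partial j (bump N) x + 2 * pi * cos (2 * pi * x $ j) * bump N x"
      unfolding F_def using partial_mult[OF d(3) d(4), of j x] by (simp add: partial_cos_nth)
    also have "sin (2 * pi * x $ j) * partial j (bump N) x
        = - (pi * real N * c x ^ (N - 1) * R x) * (sin (2 * pi * x $ j) * sin (2 * pi * x $ j))"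
      unfolding pb by (simp add: algebra_simps)
    also have "\<dots> = - (4 * pi) * (real N * c x ^ (N - 1) * c x) * (s x * R x)"
      unfolding sq by (simp add: algebra_simps)
    \<comment> \<open>The case \<open>N = 0\<close>, where \<open>N - 1\<close> is truncated, is
      harmless because of the factor \<open>real N\<close>.\<close>
    also have "real N * c x ^ (N - 1) * c x = real N * c x ^ N" by (cases N) auto
    also have "cos (2 * pi * x $ j) = 1 - 2 * s x" by (simp add: s_def field_simps)
    finally show ?thesis unfolding bump by (simp add: algebra_simps)
  qed
  have ib: "integrable torus (bump N :: real^'n \<Rightarrow> real)" "integrable torus (\<lambda>x. s x * bump N x)"
    by (intro integrable_torus_continuous trig_poly_continuous trig_poly.mult trig_poly_bump tc)+
  have "0 = (\<integral>x. partial j F x \<partial>torus)" using integral_partial_zero[OF trig_poly_C1[OF tF]] by simp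
  also have "\<dots> = 2 * pi * ((\<integral>x. bump N x \<partial>(torus :: (real^'n) measure)) - (2 * real N + 2) * (\<integral>x. s x * bump N x \<partial>torus))"
    unfolding pF using ib by simp
  finally have "(\<integral>x. bump N x \<partial>(torus :: (real^'n) measure)) = (2 * real N + 2) * (\<integral>x. s x * bump N x \<partial>torus)"
    by simp
  then show ?thesis unfolding s_def by (simp add: field_simps)
qed

lemma kern_moment:
  fixes j :: "'n::finite"
  shows "(\<integral>y. (1 - cos (2 * pi * (x $ j - y $ j))) / 2 * kern N (x - y) \<partial>torus) = 1 / (2 * real N + 2)"
proof -
  let ?F = "\<lambda>y::real^'n. (1 - cos (2 * pi * y $ j)) / 2 * kern N y"
  have t: "trig_poly ?F" by (intro trig_poly.mult trig_poly_half_angle trig_poly_kern)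
  have "(\<integral>y. (1 - cos (2 * pi * (x $ j - y $ j))) / 2 * kern N (x - y) \<partial>torus) = (\<integral>y. ?F (y + (- x)) \<partial>torus)"
  proof (rule Bochner_Integration.integral_cong[OF refl])
    fix y :: "real^'n"
    have "cos (2 * pi * (x $ j - y $ j)) = cos (2 * pi * (y $ j - x $ j))"
      using cos_minus[of "2 * pi * (x $ j - y $ j)"] by (simp add: algebra_simps)
    then show "(1 - cos (2 * pi * (x $ j - y $ j))) / 2 * kern N (x - y) = ?F (y + (- x))"
      using kern_even[of N x y] by simp
  qed
  also have "\<dots> = (\<integral>y. ?F y \<partial>torus)"
    by (intro integral_torus_shift trig_poly_continuous trig_poly_periodic t)
  also have "\<dots> = (\<integral>y. (1 - cos (2 * pi * y $ j)) / 2 * bump N y / (\<integral>y. bump N y \<partial>(torus :: (real^'n) measure)) \<partial>torus)"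
    by (simp add: kern_def)
  also have "\<dots> = (\<integral>y. (1 - cos (2 * pi * y $ j)) / 2 * bump N y \<partial>torus) / (\<integral>y. bump N y \<partial>(torus :: (real^'n) measure))"
    by (rule integral_divide_zero)
  also have "\<dots> = 1 / (2 * real N + 2)"
    unfolding bump_moment[of j N] by simp
  finally show ?thesis .
qed

text \<open>Korovkin's device: the sum \<open>S\<close> is a trigonometric polynomial in
  \<open>x - y\<close> that vanishes exactly on the lattice. Close to the lattice uniform continuity
  bounds the difference by \<open>e\<close>; elsewhere \<open>S\<close> has a positive minimum
  \<open>k\<close>, and the crude bound \<open>2 * B\<close> is at most
  \<open>2 * B / k * S (x - y)\<close>. The integral of \<open>S\<close> against the kernel is known
  from its moments.\<close>

lemma periodic_modulus:
  fixes f :: "real^'n \<Rightarrow> real"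
  assumes f: "periodic f" "continuous_on UNIV f" and e: "e > 0"
  obtains C where "C \<ge> 0" "\<And>x y. \<bar>f y - f x\<bar> \<le> e + C * (\<Sum>j\<in>UNIV. (1 - cos (2 * pi * (x $ j - y $ j))) / 2)"
proof -
  obtain B where B: "B > 0" "\<And>x. \<bar>f x\<bar> \<le> B" using periodic_bounded[OF f] by metis
  \<comment> \<open>The unit cube enlarged by one on every side, so that it contains a point of the
    cube together with its displacement by a vector with coordinates at most 1/2.\<close>
  define K where "K = cbox (- One) (2 *\<^sub>R One :: real^'n)"
  have "uniformly_continuous_on K f"
    unfolding K_def by (intro compact_uniformly_continuous continuous_on_subset[OF f(2)]) auto
  then obtain d where d: "d > 0" "\<And>x y. x \<in> K \<Longrightarrow> y \<in> K \<Longrightarrow> dist y x < d \<Longrightarrow> dist (f y) (f x) < e"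
    unfolding uniformly_continuous_on_def using e by metis
  define S where "S = (\<lambda>v::real^'n. \<Sum>j\<in>UNIV. (1 - cos (2 * pi * v $ j)) / 2)"
  have S0: "S v \<ge> 0" for v unfolding S_def by (intro sum_nonneg half_angle_nonneg)
  \<comment> \<open>In the centred cube the only zero of \<open>S\<close> is the origin, which is
    removed together with a ball of radius \<open>d\<close>; compactness then gives the lower bound
    \<open>k\<close>.\<close>
  define Q where "Q = cbox (- (1/2) *\<^sub>R One) ((1/2) *\<^sub>R One) - ball (0::real^'n) d"
  have "compact Q" unfolding Q_def by (intro compact_diff) auto
  have pos: "S v > 0" if "v \<in> Q" for v
  proof (rule ccontr)
    assume "\<not> S v > 0"
    then have "S v = 0" using S0[of v] by simp
    then have "(1 - cos (2 * pi * v $ j)) / 2 = 0" for j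
      unfolding S_def using half_angle_nonneg(2) by (subst (asm) sum_nonneg_eq_0_iff) auto
    then have "cos (2 * pi * v $ j) = 1" for j by simp
    then have cos1: "cos (2 * pi * v $ j) = 1" for j by simp
    have "v $ j = 0" for j
    proof -
      obtain n :: int where "2 * pi * v $ j = of_int n * 2 * pi"
        using cos1[of j] cos_one_2pi_int by blast
      then have "2 * pi * v $ j = 2 * pi * of_int n" by (simp only: mult.commute mult.left_commute)
      then have n: "v $ j = of_int n" by simp
      have "\<forall>i. - (1/2) \<le> v $ i \<and> v $ i \<le> 1/2"
        using that unfolding Q_def by (simp add: mem_box_cart)
      then have "- (1/2) \<le> real_of_int n \<and> real_of_int n \<le> 1/2" using n by metis
      then have "n = 0" by linarith
      then show ?thesis using n by simp
    qed
    then have "v = 0" by (simp add: vec_eq_iff)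
    then show False using that d(1) unfolding Q_def by simp
  qed
  obtain k where k: "k > 0" "\<And>v. v \<in> Q \<Longrightarrow> S v \<ge> k"
  proof (cases "Q = {}")
    case True then show thesis using that[of 1] by simp
  next
    case False
    have "continuous_on Q S" unfolding S_def by (intro continuous_intros) auto
    then obtain v0 where "v0 \<in> Q" "\<forall>v\<in>Q. S v0 \<le> S v"
      using continuous_attains_inf[OF \<open>compact Q\<close> False] by blast
    then show thesis using that[of "S v0"] pos by blast
  qed
  have "\<bar>f y - f x\<bar> \<le> e + 2 * B / k * S (x - y)" for x y
  proof -
    \<comment> \<open>\<open>x\<close> is moved to the unit cube, and then \<open>y\<close> by an
      integer vector so that the difference \<open>v\<close> has all coordinates in
      \<open>[-1/2, 1/2]\<close>. Neither \<open>f\<close> nor \<open>S\<close> notices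
      this.\<close>
    define x' where "x' = frac_vec x"
    define z where "z = (\<lambda>j. round ((x' - y) $ j))"
    define v where "v = x' - y - (\<chi> j. of_int (z j))"
    have fx: "f x = f x'" using periodic_frac_vec[OF f(1)] x'_def by metis
    have fy: "f y = f (x' - v)"
    proof -
      have "x' - v = y + (\<chi> j. of_int (z j))" by (simp add: v_def)
      then show ?thesis using periodic_int_vec[OF f(1)] by metis
    qed
    have vQ: "\<bar>v $ j\<bar> \<le> 1/2" for j
      using of_int_round_abs_le[of "(x' - y) $ j"] by (simp add: v_def z_def abs_minus_commute)
    have Sv: "S (x - y) = S v"
    proof -
      have "cos (2 * pi * (x - y) $ j) = cos (2 * pi * v $ j)" for j
      proof -
        have "(x - y) $ j = v $ j + of_int (z j + \<lfloor>x $ j\<rfloor>)"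
          by (simp add: v_def x'_def frac_vec_def frac_def)
        then have "2 * pi * (x - y) $ j = 2 * pi * v $ j + 2 * pi * of_int (z j + \<lfloor>x $ j\<rfloor>)"
          by (simp only: distrib_left)
        then show ?thesis by (simp only: cos_add cos_int_2pin sin_int_2pin)
      qed
      then show ?thesis by (simp add: S_def)
    qed
    have xK: "x' \<in> K" unfolding K_def x'_def frac_vec_def mem_box_cart
    proof
      fix i show "(- One) $ i \<le> (\<chi> i. frac (x $ i)) $ i \<and> (\<chi> i. frac (x $ i)) $ i \<le> (2 *\<^sub>R (One::real^'n)) $ i"
        by (simp, insert frac_ge_0[of "x $ i"] frac_lt_1[of "x $ i"], linarith)
    qed
    have x'01: "0 \<le> x' $ j" "x' $ j \<le> 1" for j
      by (auto simp: x'_def frac_vec_def intro: less_imp_le frac_lt_1)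
    have vK: "x' - v \<in> K"
      unfolding K_def mem_box_cart
    proof
      fix i show "(- One) $ i \<le> (x' - v) $ i \<and> (x' - v) $ i \<le> (2 *\<^sub>R (One::real^'n)) $ i"
        using abs_le_D1[OF vQ[of i]] abs_le_D2[OF vQ[of i]] x'01[of i] by simp
    qed
    show ?thesis
    proof (cases "norm v < d")
      case True
      then have "\<bar>f y - f x\<bar> < e"
        unfolding fx fy using d(2)[OF xK vK] by (simp add: dist_norm)
      moreover have "2 * B / k * S (x - y) \<ge> 0" using B k S0 by auto
      ultimately show ?thesis by linarith
    next
      case False
      have "- (1/2) \<le> v $ i \<and> v $ i \<le> 1/2" for i
        using vQ[of i] by linarith
      then have "v \<in> Q" unfolding Q_def using False
        by (simp add: mem_box_cart)
      then have "S (x - y) \<ge> k" using k(2) Sv by simp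
      then have "2 * B / k * S (x - y) \<ge> 2 * B / k * k" using B k by (intro mult_left_mono) auto
      then have "2 * B / k * S (x - y) \<ge> 2 * B" using k by simp
      moreover have "\<bar>f y - f x\<bar> \<le> 2 * B" using B(2)[of x] B(2)[of y] by linarith
      ultimately show ?thesis using e by linarith
    qed
  qed
  moreover have "2 * B / k \<ge> 0" using B k by simp
  ultimately show thesis using that[of "2 * B / k"] by (simp add: S_def)
qed

text \<open>Since the kernel is a probability density, the error is the mean of
  \<open>f y - f x\<close> under it. Inserting the modulus leaves \<open>e/2\<close> plus a multiple
  of the moments 1/(2N + 2), one for each coordinate.\<close>

lemma conv_kern_uniform:
  fixes f :: "real^'n \<Rightarrow> real"
  assumes f: "periodic f" "continuous_on UNIV f" and e: "e > 0"
  shows "\<forall>\<^sub>F N in sequentially. \<forall>x. \<bar>conv (kern N) f x - f x\<bar> \<le> e"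
proof -
  obtain C where C: "C \<ge> 0" "\<And>x y. \<bar>f y - f x\<bar> \<le> e/2 + C * (\<Sum>j\<in>UNIV. (1 - cos (2 * pi * (x $ j - y $ j))) / 2)"
    using periodic_modulus[OF f, of "e/2"] e by auto
  let ?n = "real CARD('n)"
  have bound: "\<bar>conv (kern N) f x - f x\<bar> \<le> e/2 + C * (?n / (2 * real N + 2))" for N x
  proof -
    let ?s = "\<lambda>j y. (1 - cos (2 * pi * (x $ j - y $ j))) / 2 * kern N (x - y)"
    have tk: "trig_poly (\<lambda>y. kern N (x - y))" by (intro trig_poly_reflect trig_poly_kern)
    have ts: "trig_poly (?s j)" for j
      using trig_poly_reflect[OF trig_poly.mult[OF trig_poly_half_angle(2)[of j] trig_poly_kern[of N]], of x] by simp
    have ik: "integrable torus (\<lambda>y. kern N (x - y))"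
      by (intro integrable_torus_continuous trig_poly_continuous tk)
    have int_s: "integrable torus (?s j)" for j
      by (intro integrable_torus_continuous trig_poly_continuous ts)
    have int_f: "integrable torus (\<lambda>y. f y * kern N (x - y))"
      by (intro integrable_torus_continuous continuous_intros f trig_poly_continuous tk)
    have "conv (kern N) f x - f x = (\<integral>y. f y * kern N (x - y) - f x * kern N (x - y) \<partial>torus)"
      unfolding conv_def using int_f ik integral_kern_shift(2)[of N x] by (simp add: Bochner_Integration.integral_diff)
    also have "\<bar>\<dots>\<bar> \<le> (\<integral>y. \<bar>f y * kern N (x - y) - f x * kern N (x - y)\<bar> \<partial>torus)"
      by (rule integral_abs_bound)
    also have "\<dots> \<le> (\<integral>y. e/2 * kern N (x - y) + C * (\<Sum>j\<in>UNIV. ?s j y) \<partial>torus)"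
    proof (rule integral_mono)
      show "integrable torus (\<lambda>y. \<bar>f y * kern N (x - y) - f x * kern N (x - y)\<bar>)"
        using int_f ik by (intro integrable_abs Bochner_Integration.integrable_diff) auto
      show "integrable torus (\<lambda>y. e/2 * kern N (x - y) + C * (\<Sum>j\<in>UNIV. ?s j y))"
        using int_s ik by (intro Bochner_Integration.integrable_add integrable_mult_right Bochner_Integration.integrable_sum) auto
      fix y
      have "\<bar>f y * kern N (x - y) - f x * kern N (x - y)\<bar> = \<bar>f y - f x\<bar> * kern N (x - y)"
        using kern_nonneg[of N "x - y"] by (simp flip: left_diff_distrib add: abs_mult)
      also have "\<dots> \<le> (e/2 + C * (\<Sum>j\<in>UNIV. (1 - cos (2 * pi * (x $ j - y $ j))) / 2)) * kern N (x - y)"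
        by (intro mult_right_mono C kern_nonneg)
      also have "\<dots> = e/2 * kern N (x - y) + C * (\<Sum>j\<in>UNIV. ?s j y)"
        by (simp add: distrib_right sum_distrib_right mult.assoc)
      finally show "\<bar>f y * kern N (x - y) - f x * kern N (x - y)\<bar> \<le> e/2 * kern N (x - y) + C * (\<Sum>j\<in>UNIV. ?s j y)" .
    qed
    also have "\<dots> = e/2 + C * (\<Sum>j\<in>UNIV. (\<integral>y. ?s j y \<partial>torus))"
      using int_s ik integral_kern_shift(2)[of N x]
      by (simp add: Bochner_Integration.integral_add Bochner_Integration.integral_sum)
    also have "(\<Sum>j\<in>UNIV. (\<integral>y. ?s j y \<partial>torus)) = ?n / (2 * real N + 2)"
      proof -
      have "(\<Sum>j\<in>UNIV. (\<integral>y. ?s j y \<partial>torus)) = (\<Sum>j\<in>(UNIV::'n set). 1 / (2 * real N + 2))"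
        by (intro sum.cong refl kern_moment)
      then show ?thesis by simp
    qed
    finally show ?thesis .
  qed
  have "(\<lambda>N. C * (?n / (2 * real N + 2))) \<longlonglongrightarrow> 0"
  proof -
    have "C * (?n / (2 * real N + 2)) = C * ?n / 2 * inverse (real (Suc N))" for N
      by (simp add: field_simps)
    then have "(\<lambda>N. C * (?n / (2 * real N + 2))) = (\<lambda>N. C * ?n / 2 * inverse (real (Suc N)))"
      by blast
    then show ?thesis
      using tendsto_mult_right_zero[OF LIMSEQ_inverse_real_of_nat, of "C * ?n / 2"] by (simp only:)
  qed
  then have "\<forall>\<^sub>F N in sequentially. C * (?n / (2 * real N + 2)) < e/2"
    by (rule order_tendstoD) (use e in auto)
  then show ?thesis
  proof eventually_elim
    case (elim N)
    show ?case
    proof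
      fix x show "\<bar>conv (kern N) f x - f x\<bar> \<le> e" using bound[of N x] elim by linarith
    qed
  qed
qed

subsection \<open>Square-integrable functions\<close>

lemma L2D:
  assumes "f \<in> L2"
  shows "periodic f" "f \<in> borel_measurable torus" "integrable torus (\<lambda>x. (f x)\<^sup>2)"
  using assms by (auto simp: L2_def)

lemma L2_integrable_mult:
  assumes "f \<in> L2" "g \<in> L2"
  shows "integrable torus (\<lambda>x. f x * g x)"
proof (rule Bochner_Integration.integrable_bound)
  show "integrable torus (\<lambda>x. (f x)\<^sup>2 + (g x)\<^sup>2)" using assms by (auto dest: L2D)
  show "(\<lambda>x. f x * g x) \<in> borel_measurable torus" using L2D(2)[OF assms(1)] L2D(2)[OF assms(2)] by simp
  show "AE x in torus. norm (f x * g x) \<le> norm ((f x)\<^sup>2 + (g x)\<^sup>2)"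
  proof (rule AE_I2)
    fix x
    have "2 * (\<bar>f x\<bar> * \<bar>g x\<bar>) \<le> (f x)\<^sup>2 + (g x)\<^sup>2"
      using sum_squares_bound[of "\<bar>f x\<bar>" "\<bar>g x\<bar>"] by simp
    moreover have "0 \<le> \<bar>f x\<bar> * \<bar>g x\<bar>" by simp
    ultimately have "\<bar>f x\<bar> * \<bar>g x\<bar> \<le> (f x)\<^sup>2 + (g x)\<^sup>2" by linarith
    then show "norm (f x * g x) \<le> norm ((f x)\<^sup>2 + (g x)\<^sup>2)" by (simp add: abs_mult)
  qed
qed

lemma L2_mult_bounded:
  fixes b :: "real^'n \<Rightarrow> real"
  assumes "f \<in> L2" "periodic b" "b \<in> borel_measurable torus" "\<And>x. \<bar>b x\<bar> \<le> B"
  shows "(\<lambda>x. b x * f x) \<in> L2"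
proof -
  have "\<bar>(b x)\<^sup>2\<bar> \<le> B\<^sup>2" for x
    using assms(4)[of x] power_mono[of "\<bar>b x\<bar>" B 2] by simp
  then have "integrable torus (\<lambda>x. (f x)\<^sup>2 * (b x)\<^sup>2)"
    using assms L2D(3)[OF assms(1)] by (intro integrable_mult_bounded) auto
  moreover have "(\<lambda>x. b x * f x) \<in> borel_measurable torus"
    using L2D(2)[OF assms(1)] assms(3) by simp
  ultimately show ?thesis
    using periodic_mult[OF assms(2) L2D(1)[OF assms(1)]]
    by (simp add: L2_def power_mult_distrib mult.commute)
qed

lemma L2_cmult: "f \<in> L2 \<Longrightarrow> (\<lambda>x. c * f x) \<in> L2"
  by (rule L2_mult_bounded[where B="\<bar>c\<bar>"]) auto

lemma L2_add:
  assumes "f \<in> L2" "g \<in> L2"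
  shows "(\<lambda>x. f x + g x) \<in> L2"
proof -
  have "integrable torus (\<lambda>x. (f x)\<^sup>2 + 2 * (f x * g x) + (g x)\<^sup>2)"
    using assms by (intro Bochner_Integration.integrable_add integrable_mult_right L2_integrable_mult L2D(3))
  moreover have "(\<lambda>x. f x + g x) \<in> borel_measurable torus"
    using L2D(2)[OF assms(1)] L2D(2)[OF assms(2)] by simp
  ultimately show ?thesis
    using periodic_add[OF L2D(1)[OF assms(1)] L2D(1)[OF assms(2)]]
    by (simp add: L2_def power2_sum mult.assoc add.assoc add.commute add.left_commute)
qed

lemma L2_diff:
  assumes "f \<in> L2" "g \<in> L2"
  shows "(\<lambda>x. f x - g x) \<in> L2"
  using L2_add[OF assms(1) L2_cmult[OF assms(2), of "-1"]] by simp

lemma L2_const [simp]: "(\<lambda>x. c) \<in> L2"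
  by (simp add: L2_def)

lemma L2_bounded:
  fixes b :: "real^'n \<Rightarrow> real"
  assumes "periodic b" "b \<in> borel_measurable torus" "\<And>x. \<bar>b x\<bar> \<le> B"
  shows "b \<in> L2"
  using L2_mult_bounded[OF _ assms, of "\<lambda>_. 1"] by (simp add: L2_def)

lemma L2_continuous:
  fixes b :: "real^'n \<Rightarrow> real"
  assumes "periodic b" "continuous_on UNIV b"
  shows "b \<in> L2"
proof -
  obtain B where "\<And>x. \<bar>b x\<bar> \<le> B" using periodic_bounded[OF assms] by metis
  then show ?thesis using assms continuous_measurable_torus by (intro L2_bounded) auto
qed

lemma L2_mult_continuous:
  fixes b :: "real^'n \<Rightarrow> real"
  assumes "f \<in> L2" "periodic b" "continuous_on UNIV b"
  shows "(\<lambda>x. b x * f x) \<in> L2"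
proof -
  obtain B where "\<And>x. \<bar>b x\<bar> \<le> B" using periodic_bounded[OF assms(2,3)] by metis
  then show ?thesis using assms continuous_measurable_torus by (intro L2_mult_bounded) auto
qed

lemma L2_trig: "trig_poly f \<Longrightarrow> f \<in> L2"
  by (intro L2_continuous trig_poly_periodic trig_poly_continuous)

lemma L2_C1: "C1 f \<Longrightarrow> f \<in> L2" "C1 f \<Longrightarrow> partial j f \<in> L2"
  by (intro L2_continuous C1_simps C1_continuous; assumption)+

lemma L2_integrable: "f \<in> L2 \<Longrightarrow> integrable torus f"
  using L2_integrable_mult[of f "\<lambda>_. 1"] L2_continuous[of "\<lambda>_. 1"] by simp

lemma L2_norm_nonneg [simp]: "L2_norm f \<ge> 0"
  by (simp add: L2_norm_def)

lemma L2_norm_power2: "(L2_norm f)\<^sup>2 = (\<integral>x. (f x)\<^sup>2 \<partial>torus)"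
  by (simp add: L2_norm_def)

lemma L2_norm_uminus: "L2_norm (\<lambda>x. f x - g x) = L2_norm (\<lambda>x. g x - f x)"
  by (simp add: L2_norm_def power2_commute)

lemma L2_Cauchy_Schwarz:
  assumes "f \<in> L2" "g \<in> L2"
  shows "\<bar>\<integral>x. f x * g x \<partial>torus\<bar> \<le> L2_norm f * L2_norm g"
proof -
  define a b c where "a = (\<integral>x. (f x)\<^sup>2 \<partial>torus)" and "b = (\<integral>x. f x * g x \<partial>torus)" and "c = (\<integral>x. (g x)\<^sup>2 \<partial>torus)"
  note int = L2D(3)[OF assms(1)] L2D(3)[OF assms(2)] L2_integrable_mult[OF assms]
  have quad: "0 \<le> a - 2 * t * b + t\<^sup>2 * c" for t
  proof -
    have "0 \<le> (\<integral>x. (f x - t * g x)\<^sup>2 \<partial>torus)" by (intro integral_nonneg_AE) auto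
    also have "\<dots> = (\<integral>x. (f x)\<^sup>2 - (2 * t) * (f x * g x) + t\<^sup>2 * (g x)\<^sup>2 \<partial>torus)"
      by (intro Bochner_Integration.integral_cong refl) (simp add: power2_diff power_mult_distrib algebra_simps)
    also have "\<dots> = a - 2 * t * b + t\<^sup>2 * c"
      using int by (simp add: a_def b_def c_def)
    finally show ?thesis .
  qed
  have ac: "a \<ge> 0" "c \<ge> 0" unfolding a_def c_def by (intro integral_nonneg_AE; simp)+
  have "b\<^sup>2 \<le> a * c"
  proof (cases "c = 0")
    case True
    have "b = 0"
    proof (rule ccontr)
      assume "b \<noteq> 0"
      \<comment> \<open>With \<open>c = 0\<close> the quadratic is affine in \<open>t\<close>, and
        this value of \<open>t\<close> makes it equal to -1.\<close>
      then show False using quad[of "(a + 1) / (2 * b)"] True by (simp add: field_simps)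
    qed
    then show ?thesis using True by simp
  next
    case False
    then show ?thesis using quad[of "b / c"] ac by (simp add: field_simps power2_eq_square)
  qed
  then have "sqrt (b\<^sup>2) \<le> sqrt (a * c)" by (rule real_sqrt_le_mono)
  then show ?thesis by (simp add: L2_norm_def a_def b_def c_def real_sqrt_mult)
qed

lemma L2_norm_triangle:
  assumes "f \<in> L2" "g \<in> L2"
  shows "L2_norm (\<lambda>x. f x + g x) \<le> L2_norm f + L2_norm g"
proof (rule power2_le_imp_le)
  have "(L2_norm (\<lambda>x. f x + g x))\<^sup>2 = (\<integral>x. (f x)\<^sup>2 + (g x)\<^sup>2 + 2 * (f x * g x) \<partial>torus)"
    unfolding L2_norm_power2 by (simp add: power2_sum mult.assoc)
  also have "\<dots> = (L2_norm f)\<^sup>2 + (L2_norm g)\<^sup>2 + 2 * (\<integral>x. f x * g x \<partial>torus)"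
    unfolding L2_norm_power2 using L2D(3)[OF assms(1)] L2D(3)[OF assms(2)] L2_integrable_mult[OF assms] by simp
  also have "\<dots> \<le> (L2_norm f + L2_norm g)\<^sup>2"
    using L2_Cauchy_Schwarz[OF assms] by (simp add: power2_sum)
  finally show "(L2_norm (\<lambda>x. f x + g x))\<^sup>2 \<le> (L2_norm f + L2_norm g)\<^sup>2" .
qed simp

lemma L2_norm_cmult: "L2_norm (\<lambda>x. c * f x) = \<bar>c\<bar> * L2_norm f"
  by (simp add: L2_norm_def power_mult_distrib real_sqrt_mult)

lemma L2_norm_triangle_diff:
  assumes "f \<in> L2" "g \<in> L2" "h \<in> L2"
  shows "L2_norm (\<lambda>x. f x - h x) \<le> L2_norm (\<lambda>x. f x - g x) + L2_norm (\<lambda>x. g x - h x)"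
  using L2_norm_triangle[OF L2_diff[OF assms(1,2)] L2_diff[OF assms(2,3)]] by simp

lemma L2_norm_le_add_diff:
  assumes "f \<in> L2" "g \<in> L2"
  shows "L2_norm f \<le> L2_norm (\<lambda>x. f x - g x) + L2_norm g"
  using L2_norm_triangle[OF L2_diff[OF assms] assms(2)] by simp

lemma L2_norm_mono:
  assumes "f \<in> borel_measurable torus" "g \<in> L2" "\<And>x. \<bar>f x\<bar> \<le> \<bar>g x\<bar>"
  shows "L2_norm f \<le> L2_norm g"
  unfolding L2_norm_def
proof (intro real_sqrt_le_mono integral_mono_AE)
  have le: "(f x)\<^sup>2 \<le> (g x)\<^sup>2" for x using assms(3)[of x] by (simp add: abs_le_square_iff)
  then show "AE x in torus. (f x)\<^sup>2 \<le> (g x)\<^sup>2" by simp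
  show "integrable torus (\<lambda>x. (g x)\<^sup>2)" using assms(2) by (rule L2D)
  then show "integrable torus (\<lambda>x. (f x)\<^sup>2)"
    by (rule Bochner_Integration.integrable_bound) (use assms le in auto)
qed

lemma L2_norm_mult_bounded:
  fixes b :: "real^'n \<Rightarrow> real"
  assumes "f \<in> L2" "b \<in> borel_measurable torus" "\<And>x. \<bar>b x\<bar> \<le> B"
  shows "L2_norm (\<lambda>x. b x * f x) \<le> B * L2_norm f"
proof -
  have B: "B \<ge> 0" using assms(3)[of 0] by linarith
  have "L2_norm (\<lambda>x. b x * f x) \<le> L2_norm (\<lambda>x. B * f x)"
  proof (rule L2_norm_mono)
    show "\<bar>b x * f x\<bar> \<le> \<bar>B * f x\<bar>" for x using assms(3)[of x] B by (simp add: abs_mult mult_right_mono)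
  qed (use assms L2D(2)[OF assms(1)] L2_cmult in auto)
  then show ?thesis using B by (simp add: L2_norm_cmult)
qed

lemma L2_norm_bounded:
  fixes b :: "real^'n \<Rightarrow> real"
  assumes "b \<in> borel_measurable torus" "\<And>x. \<bar>b x\<bar> \<le> B"
  shows "L2_norm b \<le> B"
proof -
  have "L2_norm (\<lambda>_::real^'n. 1 :: real) = 1" by (simp add: L2_norm_def)
  then show ?thesis using L2_norm_mult_bounded[OF _ assms, of "\<lambda>_. 1"] L2_continuous[of "\<lambda>_::real^'n. 1"] by simp
qed

lemma L2_dominated:
  fixes h :: "nat \<Rightarrow> real^'n \<Rightarrow> real"
  assumes "\<And>n. h n \<in> borel_measurable torus" "AE x in torus. (\<lambda>n. h n x) \<longlonglongrightarrow> (0::real)"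
    and "\<And>n. AE x in torus. \<bar>h n x\<bar> \<le> w x" "w \<in> L2"
  shows "(\<lambda>n. L2_norm (h n)) \<longlonglongrightarrow> 0"
proof -
  have "(\<lambda>n. \<integral>x. (h n x)\<^sup>2 \<partial>torus) \<longlonglongrightarrow> (\<integral>x. 0 \<partial>(torus :: (real^'n) measure))"
  proof (rule integral_dominated_convergence)
    show "integrable torus (\<lambda>x. (w x)\<^sup>2)" using assms(4) by (rule L2D)
    show "AE x in torus. norm ((h n x)\<^sup>2) \<le> (w x)\<^sup>2" for n
      using assms(3)[of n] 
    proof eventually_elim
      case (elim x)
      then show ?case using power_mono[of "\<bar>h n x\<bar>" "w x" 2] by simp
    qed
    show "AE x in torus. (\<lambda>n. (h n x)\<^sup>2) \<longlonglongrightarrow> 0"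
      using assms(2)
    proof eventually_elim
      case (elim x)
      then show ?case using tendsto_power[of "\<lambda>n. h n x" 0 sequentially 2] by simp
    qed
  qed (use assms(1) in simp_all)
  then have "(\<lambda>n. sqrt (\<integral>x. (h n x)\<^sup>2 \<partial>torus)) \<longlonglongrightarrow> sqrt 0"
    by (intro tendsto_real_sqrt) simp
  then show ?thesis by (simp add: L2_norm_def)
qed

lemma L2_norm_zero_AE:
  assumes "f \<in> L2" "L2_norm f = 0"
  shows "AE x in torus. f x = 0"
proof -
  have "(\<integral>x. (f x)\<^sup>2 \<partial>torus) = 0" using assms(2) by (simp add: L2_norm_def)
  then have "AE x in torus. (f x)\<^sup>2 = 0"
    using integral_nonneg_eq_0_iff_AE[OF L2D(3)[OF assms(1)]] by simp
  then show ?thesis by simp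
qed

subsection \<open>Density of continuous functions\<close>

lemma AE_torus_lebesgue: "(AE x in lebesgue. P x) \<Longrightarrow> AE x in torus. P x"
proof -
  assume "AE x in lebesgue. P x"
  then have "AE x in lborel. P x" by (simp add: AE_completion_iff)
  then show ?thesis unfolding torus_def by (subst AE_restrict_space_iff) auto
qed

lemma AE_torus_negligible: "negligible N \<Longrightarrow> AE x in torus. x \<notin> N"
  by (intro AE_torus_lebesgue AE_not_in) (simp add: negligible_iff_null_sets)

lemma AE_torus_box: "AE x in torus. x \<in> box 0 One"
proof -
  have "negligible (cbox 0 One - box 0 (One::real^'n))" by (rule negligible_frontier_interval)
  from AE_torus_negligible[OF this] have "AE x in torus. x \<in> space torus \<longrightarrow> x \<in> box 0 One"
    by eventually_elim auto
  with AE_space[of torus] show ?thesis by eventually_elim blast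
qed

text \<open>\<open>g (frac_vec x)\<close> can jump only where some coordinate is an integer. There
  the cutoff \<open>z\<close> vanishes, and boundedness of \<open>g\<close> makes the product tend
  to 0.\<close>

lemma continuous_periodization:
  fixes g :: "real^'n \<Rightarrow> real"
  assumes g: "continuous_on UNIV g" "\<And>x. \<bar>g x\<bar> \<le> B"
    and z: "continuous_on UNIV z" "\<And>x j. x $ j \<in> \<int> \<Longrightarrow> z x = 0"
  shows "continuous_on UNIV (\<lambda>x. z x * g (frac_vec x))"
proof (intro continuous_at_imp_continuous_on ballI)
  fix x :: "real^'n"
  have zc: "isCont z x" using z(1) by (simp add: continuous_on_eq_continuous_at)
  show "isCont (\<lambda>x. z x * g (frac_vec x)) x"
  proof (cases "\<exists>j. x $ j \<in> \<int>")
    case True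
    then have z0: "z x = 0" using z(2) by blast
    have "((\<lambda>y. \<bar>z y\<bar> * B) \<longlongrightarrow> 0) (at x)"
      using zc z0 unfolding isCont_def by (intro tendsto_mult_left_zero tendsto_rabs_zero) simp
    then have "((\<lambda>y. z y * g (frac_vec y)) \<longlongrightarrow> 0) (at x)"
    proof (rule Lim_null_comparison[rotated])
      show "\<forall>\<^sub>F y in at x. norm (z y * g (frac_vec y)) \<le> \<bar>z y\<bar> * B"
        using g(2) by (intro always_eventually allI) (auto simp: abs_mult intro: mult_left_mono)
    qed
    then show ?thesis using z0 by (simp add: isCont_def)
  next
    case False
    have "isCont frac_vec x"
      unfolding isCont_def
    proof (rule vec_tendstoI)
      fix i
      have "isCont frac (x $ i)" using False continuous_frac by blast
      then have "isCont (\<lambda>y. frac (y $ i)) x"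
        using isCont_o2[of x "\<lambda>y. y $ i" frac] by (simp add: continuous_intros)
      then show "((\<lambda>y. frac_vec y $ i) \<longlongrightarrow> frac_vec x $ i) (at x)"
        by (simp add: isCont_def frac_vec_def)
    qed
    then have "isCont (\<lambda>y. g (frac_vec y)) x"
      using g(1) isCont_o2[of x frac_vec g] by (simp add: continuous_on_eq_continuous_at)
    then show ?thesis using zc by (intro continuous_intros)
  qed
qed

text \<open>A Lebesgue measurable function is an almost everywhere limit of continuous functions.
  These are clipped to \<open>[-B, B]\<close>, periodized through \<open>frac_vec\<close> and
  multiplied by a cutoff that restores continuity; dominated convergence with majorant
  \<open>2 * B\<close> concludes.\<close>

lemma L2_bounded_dense_continuous:
  fixes f :: "real^'n \<Rightarrow> real"
  assumes f: "f \<in> L2" and B: "\<And>x. \<bar>f x\<bar> \<le> B" and e: "e > 0"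
  shows "\<exists>g. periodic g \<and> continuous_on UNIV g \<and> L2_norm (\<lambda>x. f x - g x) < e"
proof -
  define u where "u = (\<lambda>x. indicator (cbox 0 One) x *\<^sub>R f x)"
  have "u \<in> borel_measurable borel"
    using L2D(2)[OF f] unfolding torus_def u_def
    by (subst (asm) borel_measurable_restrict_space_iff) (auto simp: measurable_lborel1)
  then have "u \<in> borel_measurable lebesgue" by (intro measurable_completion) simp
  then have "u measurable_on UNIV" by (rule lebesgue_measurable_imp_measurable_on_real) simp
  then obtain N g where N: "negligible N" and g: "\<And>n. continuous_on UNIV (g n)"
    "\<And>x. x \<notin> N \<Longrightarrow> (\<lambda>n. g n x) \<longlonglongrightarrow> u x"
    unfolding measurable_on_def by auto
  \<comment> \<open>The cutoff vanishes on all integer hyperplanes, has period 1 because of the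
    absolute values, and equals 1 for all large \<open>n\<close> at every fixed point of the open
    cube.\<close>
  define z where "z = (\<lambda>n (x::real^'n). min 1 (real n * (\<Prod>j\<in>UNIV. \<bar>sin (pi * x $ j)\<bar>)))"
  define t where "t = (\<lambda>n x. max (- B) (min B (g n x)))"
  define h where "h = (\<lambda>n x. z n x * t n (frac_vec x))"
  have B0: "B \<ge> 0" using B[of 0] by linarith
  have tB: "\<bar>t n x\<bar> \<le> B" for n x using B0 by (auto simp: t_def)
  have z01: "0 \<le> z n x" "z n x \<le> 1" for n x
    unfolding z_def by (auto intro!: mult_nonneg_nonneg prod_nonneg)
  have zper: "periodic (z n)" for n
  proof -
    have "\<bar>sin (pi * (x + axis i 1) $ j)\<bar> = \<bar>sin (pi * x $ j)\<bar>" for x :: "real^'n" and i j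
      by (simp add: axis_def distrib_left)
    then show ?thesis unfolding periodic_def z_def by (simp only: simp_thms)
  qed
  have hper: "periodic (h n)" for n
    unfolding h_def by (rule periodic_mult[OF zper periodic_compose[OF frac_vec_periodic]])
  have hcont: "continuous_on UNIV (h n)" for n
    unfolding h_def
  proof (rule continuous_periodization)
    show "continuous_on UNIV (t n)" unfolding t_def by (intro continuous_intros g)
    show "\<bar>t n x\<bar> \<le> B" for x by (rule tB)
    show "continuous_on UNIV (z n)" unfolding z_def by (intro continuous_intros)
    fix x :: "real^'n" and j assume "x $ j \<in> \<int>"
    then obtain m where m: "x $ j = of_int m" by (auto elim: Ints_cases)
    have "sin (pi * of_int m) = 0" unfolding sin_zero_iff_int2 by (intro exI[of _ m]) simp
    then have "(\<Prod>j\<in>UNIV. \<bar>sin (pi * x $ j)\<bar>) = 0"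
      using m by (intro prod_zero bexI[of _ j]) simp_all
    then show "z n x = 0" unfolding z_def by (simp only: mult_zero_right min.absorb2 zero_le_one)
  qed
  have "(\<lambda>n. L2_norm (\<lambda>x. f x - h n x)) \<longlonglongrightarrow> 0"
  proof (rule L2_dominated[where w="\<lambda>_. 2 * B"])
    show "(\<lambda>x. f x - h n x) \<in> borel_measurable torus" for n
      using L2D(2)[OF f] continuous_measurable_torus[OF hcont] by (intro borel_measurable_diff)
    show "(\<lambda>_. 2 * B) \<in> L2" by (intro L2_continuous) auto
    show "AE x in torus. \<bar>f x - h n x\<bar> \<le> 2 * B" for n
    proof (rule AE_I2)
      fix x
      have "\<bar>h n x\<bar> \<le> 1 * B"
        unfolding h_def abs_mult using z01 tB by (intro mult_mono) auto
      then show "\<bar>f x - h n x\<bar> \<le> 2 * B" using B[of x] by linarith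
    qed
    show "AE x in torus. (\<lambda>n. f x - h n x) \<longlonglongrightarrow> 0"
      using AE_torus_box AE_torus_negligible[OF N]
    proof eventually_elim
      case (elim x)
      have x01: "0 < x $ j" "x $ j < 1" for j using elim(1) by (auto simp: mem_box_cart)
      then have "frac (x $ j) = x $ j" for j by (simp add: frac_eq less_imp_le)
      then have fr: "frac_vec x = x" by (simp add: frac_vec_def vec_eq_iff)
      have "sin (pi * x $ j) > 0" for j using x01[of j] by (intro sin_gt_zero) auto
      then have P: "(\<Prod>j\<in>UNIV. \<bar>sin (pi * x $ j)\<bar>) > 0" by (intro prod_pos) (auto simp: less_imp_neq[symmetric])
      have "\<forall>\<^sub>F n in sequentially. real n * (\<Prod>j\<in>UNIV. \<bar>sin (pi * x $ j)\<bar>) \<ge> 1"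
      proof -
        obtain m :: nat where m: "1 / (\<Prod>j\<in>UNIV. \<bar>sin (pi * x $ j)\<bar>) \<le> real m"
          using real_arch_simple by blast
        show ?thesis
          unfolding eventually_sequentially
        proof (intro exI allI impI)
          fix n assume "n \<ge> m"
          then have "1 / (\<Prod>j\<in>UNIV. \<bar>sin (pi * x $ j)\<bar>) \<le> real n" using m by linarith
          then show "real n * (\<Prod>j\<in>UNIV. \<bar>sin (pi * x $ j)\<bar>) \<ge> 1" using P by (simp add: field_simps)
        qed
      qed
      then have "\<forall>\<^sub>F n in sequentially. z n x = 1"
        by eventually_elim (simp add: z_def)
      then have z1: "(\<lambda>n. z n x) \<longlonglongrightarrow> 1" by (rule tendsto_eventually)
      have ux: "u x = f x" using elim(1) box_subset_cbox[of 0 "One::real^'n"] by (auto simp: u_def)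
      have "(\<lambda>n. t n x) \<longlonglongrightarrow> max (- B) (min B (f x))"
        unfolding t_def using g(2)[OF elim(2)] ux by (intro tendsto_intros) auto
      also have "max (- B) (min B (f x)) = f x" using B[of x] by auto
      finally have "(\<lambda>n. h n x) \<longlonglongrightarrow> 1 * f x"
        unfolding h_def fr by (intro tendsto_mult z1)
      then show ?case using tendsto_diff[OF tendsto_const[of "f x"], of "\<lambda>n. h n x" "f x"] by simp
    qed
  qed
  then have "\<forall>\<^sub>F n in sequentially. L2_norm (\<lambda>x. f x - h n x) < e"
    by (rule order_tendstoD) (rule e)
  then obtain n where "L2_norm (\<lambda>x. f x - h n x) < e" by (auto simp: eventually_sequentially)
  then show ?thesis using hper hcont by blast
qed

text \<open>Truncation at level \<open>n\<close> reduces the claim to bounded functions; the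
  truncations converge in L^2 with majorant \<open>\<bar>f\<bar>\<close>.\<close>

lemma L2_dense_continuous:
  fixes f :: "real^'n \<Rightarrow> real"
  assumes f: "f \<in> L2" and e: "e > 0"
  obtains g where "periodic g" "continuous_on UNIV g" "L2_norm (\<lambda>x. f x - g x) < e"
proof -
  define F where "F = (\<lambda>n x. max (- real n) (min (real n) (f x)))"
  have FL: "F n \<in> L2" for n
  proof (rule L2_bounded)
    show "periodic (F n)" unfolding F_def using L2D(1)[OF f] by (auto simp: periodic_def)
    show "F n \<in> borel_measurable torus" unfolding F_def by (intro borel_measurable_max borel_measurable_min borel_measurable_const L2D(2)[OF f])
    show "\<bar>F n x\<bar> \<le> real n" for x by (auto simp: F_def)
  qed
  have "(\<lambda>n. L2_norm (\<lambda>x. f x - F n x)) \<longlonglongrightarrow> 0"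
  proof (rule L2_dominated[where w="\<lambda>x. \<bar>f x\<bar>"])
    show "(\<lambda>x. f x - F n x) \<in> borel_measurable torus" for n
      using L2_diff[OF f FL] by (rule L2D(2))
    show "(\<lambda>x. \<bar>f x\<bar>) \<in> L2" using f by (auto simp: L2_def periodic_def)
    show "AE x in torus. \<bar>f x - F n x\<bar> \<le> \<bar>f x\<bar>" for n by (rule AE_I2) (auto simp: F_def)
    show "AE x in torus. (\<lambda>n. f x - F n x) \<longlonglongrightarrow> 0"
    proof (rule AE_I2)
      fix x
      obtain m :: nat where m: "\<bar>f x\<bar> \<le> real m" using real_arch_simple by blast
      have "\<forall>\<^sub>F n in sequentially. f x - F n x = 0"
        unfolding eventually_sequentially
      proof (intro exI allI impI)
        fix n assume "n \<ge> m"
        then have "\<bar>f x\<bar> \<le> real n" using m by linarith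
        then show "f x - F n x = 0" by (auto simp: F_def)
      qed
      then show "(\<lambda>n. f x - F n x) \<longlonglongrightarrow> 0" by (rule tendsto_eventually)
    qed
  qed
  then have "\<forall>\<^sub>F n in sequentially. L2_norm (\<lambda>x. f x - F n x) < e / 2"
    by (rule order_tendstoD) (use e in simp)
  then obtain n where n: "L2_norm (\<lambda>x. f x - F n x) < e / 2" by (auto simp: eventually_sequentially)
  obtain g where g: "periodic g" "continuous_on UNIV g" "L2_norm (\<lambda>x. F n x - g x) < e / 2"
  proof -
    have "\<bar>F n x\<bar> \<le> real n" for x by (auto simp: F_def)
    moreover have "e / 2 > 0" using e by simp
    ultimately show thesis using L2_bounded_dense_continuous[OF FL[of n]] that by blast
  qed
  have "L2_norm (\<lambda>x. f x - g x) < e"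
    using L2_norm_triangle_diff[OF f FL[of n] L2_continuous[OF g(1,2)]] n g(3) by linarith
  then show thesis using that g by blast
qed

subsection \<open>Convolution in the square mean\<close>

text \<open>Jensen's inequality for the probability density \<open>kern N\<close>: the variance of
  \<open>u\<close> under it is nonnegative, so the square of the convolution is at most the
  convolution of the square. Integrating in \<open>x\<close> and exchanging the integrals leaves the
  integral of the square of \<open>u\<close>.\<close>

lemma conv_kern_contraction:
  assumes u: "u \<in> L2"
  shows "L2_norm (conv (kern N) u) \<le> L2_norm u"
  unfolding L2_norm_def
proof (rule real_sqrt_le_mono)
  have iu: "integrable torus u" "integrable torus (\<lambda>x. (u x)\<^sup>2)" using L2_integrable[OF u] L2D(3)[OF u] by auto
  have tk: "trig_poly (\<lambda>y. kern N (x - y))" for x by (intro trig_poly_reflect trig_poly_kern)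
  have "(conv (kern N) u x)\<^sup>2 \<le> conv (kern N) (\<lambda>y. (u y)\<^sup>2) x" for x
  proof -
    let ?m = "conv (kern N) u x" and ?k = "\<lambda>y. kern N (x - y)"
    have "0 \<le> (\<integral>y. (u y - ?m)\<^sup>2 * ?k y \<partial>torus)"
      by (intro integral_nonneg_AE AE_I2 mult_nonneg_nonneg kern_nonneg) auto
    also have "\<dots> = (\<integral>y. (u y)\<^sup>2 * ?k y - (2 * ?m) * (u y * ?k y) + ?m\<^sup>2 * ?k y \<partial>torus)"
      by (intro Bochner_Integration.integral_cong refl) (simp add: power2_diff algebra_simps)
    also have "\<dots> = (\<integral>y. (u y)\<^sup>2 * ?k y \<partial>torus) - (2 * ?m) * (\<integral>y. u y * ?k y \<partial>torus) + ?m\<^sup>2 * (\<integral>y. ?k y \<partial>torus)"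
      using integrable_mult_trig[OF iu(1) tk[of x]] integrable_mult_trig[OF iu(2) tk[of x]] integrable_torus_continuous[OF trig_poly_continuous[OF tk[of x]]]
      by simp
    also have "\<dots> = conv (kern N) (\<lambda>y. (u y)\<^sup>2) x - ?m\<^sup>2"
      by (simp add: conv_def integral_kern_shift power2_eq_square)
    finally show ?thesis by simp
  qed
  then have "(\<integral>x. (conv (kern N) u x)\<^sup>2 \<partial>torus) \<le> (\<integral>x. conv (kern N) (\<lambda>y. (u y)\<^sup>2) x \<partial>torus)"
    by (intro integral_mono L2D(3)[OF L2_trig[OF trig_poly_conv[OF trig_poly_kern iu(1)]]]
        integrable_torus_continuous[OF trig_poly_continuous[OF trig_poly_conv[OF trig_poly_kern iu(2)]]])
  also have "\<dots> = (\<integral>y. (u y)\<^sup>2 \<partial>torus)"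
    by (simp add: integral_conv[OF trig_poly_kern iu(2)] integral_kern_shift)
  finally show "(\<integral>x. (conv (kern N) u x)\<^sup>2 \<partial>torus) \<le> (\<integral>y. (u y)\<^sup>2 \<partial>torus)" .
qed

lemma conv_kern_L2: "u \<in> L2 \<Longrightarrow> conv (kern N) u \<in> L2"
  by (rule L2_trig[OF trig_poly_conv[OF trig_poly_kern L2_integrable]])

text \<open>Uniform convergence for a continuous \<open>g\<close> close to \<open>u\<close>,
  together with the contraction property applied to \<open>u - g\<close>; each of the three errors
  is at most \<open>e / 4\<close>.\<close>

lemma conv_kern_tendsto:
  fixes u :: "real^'n \<Rightarrow> real"
  assumes u: "u \<in> L2"
  shows "(\<lambda>N. L2_norm (\<lambda>x. conv (kern N) u x - u x)) \<longlonglongrightarrow> 0"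
proof (rule order_tendstoI)
  fix e :: real assume "e > 0"
  then have e3: "e / 4 > 0" by simp
  obtain g where g: "periodic g" "continuous_on UNIV g" "L2_norm (\<lambda>x. u x - g x) < e / 4"
    using L2_dense_continuous[OF u e3] by metis
  have gL: "g \<in> L2" by (rule L2_continuous[OF g(1,2)])
  show "\<forall>\<^sub>F N in sequentially. L2_norm (\<lambda>x. conv (kern N) u x - u x) < e"
    using conv_kern_uniform[OF g(1,2) e3]
  proof eventually_elim
    case (elim N)
    have "L2_norm (\<lambda>x. conv (kern N) u x - conv (kern N) g x) = L2_norm (conv (kern N) (\<lambda>x. u x - g x))"
      using conv_diff[OF trig_poly_kern L2_integrable[OF u] L2_integrable[OF gL]] by (intro arg_cong[of _ _ L2_norm]) auto
    also have "\<dots> \<le> L2_norm (\<lambda>x. u x - g x)" by (intro conv_kern_contraction L2_diff u gL)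
    finally have 1: "L2_norm (\<lambda>x. conv (kern N) u x - conv (kern N) g x) < e / 4" using g(3) by linarith
    have 2: "L2_norm (\<lambda>x. conv (kern N) g x - g x) \<le> e / 4"
      using elim by (intro L2_norm_bounded L2D(2) L2_diff conv_kern_L2 gL) auto
    have 3: "L2_norm (\<lambda>x. g x - u x) < e / 4" using g(3) L2_norm_uminus[of u g] by simp
    have "L2_norm (\<lambda>x. conv (kern N) u x - u x) \<le> L2_norm (\<lambda>x. conv (kern N) u x - conv (kern N) g x) + L2_norm (\<lambda>x. conv (kern N) g x - u x)"
      by (intro L2_norm_triangle_diff conv_kern_L2 u gL)
    also have "L2_norm (\<lambda>x. conv (kern N) g x - u x) \<le> L2_norm (\<lambda>x. conv (kern N) g x - g x) + L2_norm (\<lambda>x. g x - u x)"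
      by (intro L2_norm_triangle_diff conv_kern_L2 u gL)
    finally show ?case using 1 2 3 \<open>e > 0\<close> by linarith
  qed
next
  fix a :: real assume "a < 0"
  then show "\<forall>\<^sub>F N in sequentially. a < L2_norm (\<lambda>x. conv (kern N) u x - u x)"
    by (intro always_eventually allI) (meson L2_norm_nonneg less_le_trans)
qed

subsection \<open>Weak gradients\<close>

lemma weak_gradient_trig:
  assumes "is_weak_gradient u g" "trig_poly \<phi>"
  shows "(\<integral>x. u x * partial j \<phi> x \<partial>torus) = - (\<integral>x. g x $ j * \<phi> x \<partial>torus)"
proof -
  have "periodic \<phi> \<and> (\<forall>k. Ck k \<phi>)"
    using trig_poly_periodic[OF assms(2)] trig_poly_Ck[OF assms(2)] by simp
  then show ?thesis using assms(1) unfolding is_weak_gradient_def by simp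
qed

lemma weak_gradient_L2: "is_weak_gradient u g \<Longrightarrow> (\<lambda>x. g x $ j) \<in> L2"
  by (simp add: is_weak_gradient_def)

lemma Ck_1_iff: "Ck 1 f \<longleftrightarrow> (\<forall>x. f differentiable (at x)) \<and> (\<forall>j. continuous_on UNIV (partial j f))"
  by simp

lemma C1_iff_Ck: "C1 f \<longleftrightarrow> periodic f \<and> Ck 1 f"
  unfolding C1_def Ck_1_iff ..

lemma smooth_C1:
  assumes "periodic \<phi> \<and> (\<forall>k. Ck k \<phi>)"
  shows "C1 \<phi>"
  unfolding C1_iff_Ck using conjunct1[OF assms] spec[OF conjunct2[OF assms], of 1] by (rule conjI)

text \<open>For fixed \<open>x\<close> the reflected kernel is itself an admissible test function in
  \<open>y\<close>. The sign from the reflection and the sign in the definition of the weak gradient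
  cancel. Hence mollification approximates a function and its weak gradient simultaneously.\<close>

lemma partial_conv_weak_gradient:
  assumes "u \<in> L2" "is_weak_gradient u g"
  shows "partial j (conv (kern N) u) x = conv (kern N) (\<lambda>y. g y $ j) x"
proof -
  have t: "trig_poly (\<lambda>y. kern N (x - y))" by (intro trig_poly_reflect trig_poly_kern)
  have "partial j (conv (kern N) u) x = (\<integral>y. u y * partial j (kern N) (x - y) \<partial>torus)"
    by (simp add: partial_conv[OF trig_poly_kern L2_integrable[OF assms(1)]] conv_def)
  also have "\<dots> = - (\<integral>y. u y * partial j (\<lambda>y. kern N (x - y)) y \<partial>torus)"
    by (simp add: partial_reflect[OF trig_poly_kern])
  also have "\<dots> = conv (kern N) (\<lambda>y. g y $ j) x"
    by (simp add: weak_gradient_trig[OF assms(2) t] conv_def)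
  finally show ?thesis .
qed

lemma H1_dense_trig:
  assumes "u \<in> L2" "is_weak_gradient u g"
  obtains w where "\<And>N. trig_poly (w N)" "(\<lambda>N. L2_norm (\<lambda>x. w N x - u x)) \<longlonglongrightarrow> 0"
    "\<And>j. (\<lambda>N. L2_norm (\<lambda>x. partial j (w N) x - g x $ j)) \<longlonglongrightarrow> 0"
proof (rule that[of "\<lambda>N. conv (kern N) u"])
  show "trig_poly (conv (kern N) u)" for N
    by (intro trig_poly_conv trig_poly_kern L2_integrable assms)
  show "(\<lambda>N. L2_norm (\<lambda>x. conv (kern N) u x - u x)) \<longlonglongrightarrow> 0"
    by (intro conv_kern_tendsto assms)
  show "(\<lambda>N. L2_norm (\<lambda>x. partial j (conv (kern N) u) x - g x $ j)) \<longlonglongrightarrow> 0" for j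
    unfolding partial_conv_weak_gradient[OF assms]
    by (intro conv_kern_tendsto weak_gradient_L2[OF assms(2)])
qed

lemma L2_limit_unique:
  assumes "u \<in> L2" "v \<in> L2" "\<And>N. w N \<in> L2"
    "(\<lambda>N. L2_norm (\<lambda>x. w N x - u x)) \<longlonglongrightarrow> 0" "(\<lambda>N. L2_norm (\<lambda>x. w N x - v x)) \<longlonglongrightarrow> 0"
  shows "AE x in torus. u x = v x"
proof -
  have "L2_norm (\<lambda>x. u x - v x) \<le> L2_norm (\<lambda>x. w N x - u x) + L2_norm (\<lambda>x. w N x - v x)" for N
    using L2_norm_triangle_diff[OF assms(1) assms(3)[of N] assms(2)] L2_norm_uminus[of u "w N"] by simp
  moreover have "(\<lambda>N. L2_norm (\<lambda>x. w N x - u x) + L2_norm (\<lambda>x. w N x - v x)) \<longlonglongrightarrow> 0"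
    using tendsto_add[OF assms(4,5)] by simp
  ultimately have "L2_norm (\<lambda>x. u x - v x) \<le> 0"
    by (intro LIMSEQ_le_const) auto
  then have "L2_norm (\<lambda>x. u x - v x) = 0" using L2_norm_nonneg[of "\<lambda>x. u x - v x"] by linarith
  from L2_norm_zero_AE[OF L2_diff[OF assms(1,2)] this] show ?thesis by simp
qed

text \<open>The classical gradient of the mollified function converges in L^2 to both candidates.
  This is what makes the choice in \<open>weak_gradient\<close> immaterial under integrals.\<close>

lemma weak_gradient_unique:
  assumes "u \<in> L2" "is_weak_gradient u g" "is_weak_gradient u h"
  shows "AE x in torus. g x = h x"
proof -
  have "AE x in torus. g x $ j = h x $ j" for j
  proof (rule L2_limit_unique)
    show "(\<lambda>N. L2_norm (\<lambda>x. partial j (conv (kern N) u) x - g x $ j)) \<longlonglongrightarrow> 0"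
      unfolding partial_conv_weak_gradient[OF assms(1,2)]
      by (intro conv_kern_tendsto weak_gradient_L2[OF assms(2)])
    show "(\<lambda>N. L2_norm (\<lambda>x. partial j (conv (kern N) u) x - h x $ j)) \<longlonglongrightarrow> 0"
      unfolding partial_conv_weak_gradient[OF assms(1,3)]
      by (intro conv_kern_tendsto weak_gradient_L2[OF assms(3)])
    show "partial j (conv (kern N) u) \<in> L2" for N
      by (intro L2_trig trig_poly_partial trig_poly_conv[OF trig_poly_kern] L2_integrable assms)
  qed (rule weak_gradient_L2[OF assms(2)], rule weak_gradient_L2[OF assms(3)])
  then have "AE x in torus. \<forall>j. g x $ j = h x $ j" by (subst AE_all_countable) auto
  then show ?thesis by (simp add: vec_eq_iff)
qed

lemma weak_gradient_is: "u \<in> H1 \<Longrightarrow> is_weak_gradient u (weak_gradient u)"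
  unfolding H1_def weak_gradient_def using someI_ex[of "is_weak_gradient u"] by blast

lemma weak_gradient_AE:
  assumes "u \<in> L2" "is_weak_gradient u g"
  shows "AE x in torus. weak_gradient u x = g x"
proof -
  have "u \<in> H1" using assms by (auto simp: H1_def)
  then show ?thesis using weak_gradient_unique[OF assms(1) weak_gradient_is assms(2)] by blast
qed

lemma integral_by_parts:
  assumes "C1 f" "C1 g"
  shows "(\<integral>x. f x * partial j g x \<partial>torus) = - (\<integral>x. partial j f x * g x \<partial>torus)"
proof -
  have "(\<integral>x. f x * partial j g x + partial j f x * g x \<partial>torus) = 0"
    using integral_partial_zero[OF C1_mult[OF assms], of j]
    unfolding partial_mult[OF C1_simps(1)[OF assms(1)] C1_simps(1)[OF assms(2)]] .
  moreover have "integrable torus (\<lambda>x. f x * partial j g x)" "integrable torus (\<lambda>x. partial j f x * g x)"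
    using assms by (intro L2_integrable_mult L2_C1; simp)+
  ultimately show ?thesis by simp
qed

lemma C1_weak_gradient:
  fixes f :: "real^'n \<Rightarrow> real"
  assumes "C1 f"
  shows "is_weak_gradient f (gradient f)"
  unfolding is_weak_gradient_def gradient_def
proof (intro conjI allI impI)
  fix \<phi> :: "real^'n \<Rightarrow> real" and j assume "periodic \<phi> \<and> (\<forall>k. Ck k \<phi>)"
  then have "C1 \<phi>" by (rule smooth_C1)
  then show "(\<integral>x. f x * partial j \<phi> x \<partial>torus) = - (\<integral>x. (\<chi> j. partial j f x) $ j * \<phi> x \<partial>torus)"
    using integral_by_parts[OF assms] by simp
qed (use L2_C1(2)[OF assms] in simp)

lemma L2_tendsto_integral:
  assumes "u \<in> L2" "\<phi> \<in> L2" "\<And>N. w N \<in> L2" "(\<lambda>N. L2_norm (\<lambda>x. w N x - u x)) \<longlonglongrightarrow> 0"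
  shows "(\<lambda>N. \<integral>x. w N x * \<phi> x \<partial>torus) \<longlonglongrightarrow> (\<integral>x. u x * \<phi> x \<partial>torus)"
proof -
  have "norm ((\<integral>x. w N x * \<phi> x \<partial>torus) - (\<integral>x. u x * \<phi> x \<partial>torus)) \<le> L2_norm (\<lambda>x. w N x - u x) * L2_norm \<phi>" for N
    using L2_Cauchy_Schwarz[OF L2_diff[OF assms(3)[of N] assms(1)] assms(2)]
      L2_integrable_mult[OF assms(3)[of N] assms(2)] L2_integrable_mult[OF assms(1,2)]
    by (simp add: left_diff_distrib)
  moreover have "(\<lambda>N. L2_norm (\<lambda>x. w N x - u x) * L2_norm \<phi>) \<longlonglongrightarrow> 0"
    using assms(4) by (rule tendsto_mult_left_zero)
  ultimately have "(\<lambda>N. (\<integral>x. w N x * \<phi> x \<partial>torus) - (\<integral>x. u x * \<phi> x \<partial>torus)) \<longlonglongrightarrow> 0"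
    by (rule Lim_null_comparison[OF always_eventually[OF allI]])
  then show ?thesis by (simp add: LIM_zero_iff)
qed

text \<open>Both sides of the defining identity are continuous under L^2 convergence for a fixed
  test function. The product rules below are obtained by passing to the limit through this
  closedness.\<close>

lemma weak_gradient_closed:
  fixes u :: "real^'n \<Rightarrow> real"
  assumes u: "u \<in> L2" and g: "\<And>j. (\<lambda>x. g x $ j) \<in> L2" and w: "\<And>N. w N \<in> L2" "\<And>N. is_weak_gradient (w N) (h N)"
    and lim: "(\<lambda>N. L2_norm (\<lambda>x. w N x - u x)) \<longlonglongrightarrow> 0"
    "\<And>j. (\<lambda>N. L2_norm (\<lambda>x. h N x $ j - g x $ j)) \<longlonglongrightarrow> 0"
  shows "is_weak_gradient u g"
  unfolding is_weak_gradient_def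
proof (intro conjI allI impI g)
  fix \<phi> :: "real^'n \<Rightarrow> real" and j assume \<phi>: "periodic \<phi> \<and> (\<forall>k. Ck k \<phi>)"
  then have C: "C1 \<phi>" by (rule smooth_C1)
  have "(\<lambda>N. \<integral>x. w N x * partial j \<phi> x \<partial>torus) \<longlonglongrightarrow> (\<integral>x. u x * partial j \<phi> x \<partial>torus)"
    by (intro L2_tendsto_integral u w(1) lim L2_C1 C)
  moreover have "(\<lambda>N. \<integral>x. h N x $ j * \<phi> x \<partial>torus) \<longlonglongrightarrow> (\<integral>x. g x $ j * \<phi> x \<partial>torus)"
    by (intro L2_tendsto_integral g weak_gradient_L2[OF w(2)] lim L2_C1(1) C)
  moreover have "(\<integral>x. w N x * partial j \<phi> x \<partial>torus) = - (\<integral>x. h N x $ j * \<phi> x \<partial>torus)" for N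
    using w(2)[of N] \<phi> unfolding is_weak_gradient_def by blast
  ultimately show "(\<integral>x. u x * partial j \<phi> x \<partial>torus) = - (\<integral>x. g x $ j * \<phi> x \<partial>torus)"
    using LIMSEQ_unique[OF _ tendsto_minus] by auto
qed

lemma weak_gradient_add:
  fixes u v :: "real^'n \<Rightarrow> real"
  assumes "u \<in> L2" "v \<in> L2" "is_weak_gradient u g" "is_weak_gradient v h"
  shows "is_weak_gradient (\<lambda>x. u x + c * v x) (\<lambda>x. g x + c *\<^sub>R h x)"
  unfolding is_weak_gradient_def
proof (intro conjI allI impI)
  show "(\<lambda>x. (g x + c *\<^sub>R h x) $ j) \<in> L2" for j
    using L2_add[OF weak_gradient_L2[OF assms(3)] L2_cmult[OF weak_gradient_L2[OF assms(4)]]] by simp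
  fix \<phi> :: "real^'n \<Rightarrow> real" and j assume \<phi>: "periodic \<phi> \<and> (\<forall>k. Ck k \<phi>)"
  then have "C1 \<phi>" by (rule smooth_C1)
  note L = L2_C1[OF this]
  have "(\<integral>x. (u x + c * v x) * partial j \<phi> x \<partial>torus) = (\<integral>x. u x * partial j \<phi> x + c * (v x * partial j \<phi> x) \<partial>torus)"
    by (simp add: algebra_simps)
  also have "\<dots> = (\<integral>x. u x * partial j \<phi> x \<partial>torus) + c * (\<integral>x. v x * partial j \<phi> x \<partial>torus)"
    using L2_integrable_mult[OF assms(1) L(2)] L2_integrable_mult[OF assms(2) L(2)] by simp
  also have "\<dots> = - ((\<integral>x. g x $ j * \<phi> x \<partial>torus) + c * (\<integral>x. h x $ j * \<phi> x \<partial>torus))"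
    using assms(3,4) \<phi> by (simp add: is_weak_gradient_def)
  also have "\<dots> = - (\<integral>x. g x $ j * \<phi> x + c * (h x $ j * \<phi> x) \<partial>torus)"
    using L2_integrable_mult[OF weak_gradient_L2[OF assms(3)] L(1)] L2_integrable_mult[OF weak_gradient_L2[OF assms(4)] L(1)] by simp
  also have "\<dots> = - (\<integral>x. (g x + c *\<^sub>R h x) $ j * \<phi> x \<partial>torus)"
    by (simp add: algebra_simps)
  finally show "(\<integral>x. (u x + c * v x) * partial j \<phi> x \<partial>torus) = - (\<integral>x. (g x + c *\<^sub>R h x) $ j * \<phi> x \<partial>torus)" .
qed

lemma H1_add:
  assumes "u \<in> H1" "v \<in> H1"
  shows "(\<lambda>x. u x + c * v x) \<in> H1"
proof -
  have L: "u \<in> L2" "v \<in> L2" using assms by (auto simp: H1_def)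
  show ?thesis
    using weak_gradient_add[OF L weak_gradient_is[OF assms(1)] weak_gradient_is[OF assms(2)]] L2_add[OF L(1) L2_cmult[OF L(2)]]
    unfolding H1_def by blast
qed

lemma L2_norm_tendsto_add:
  assumes "\<And>N. a N \<in> L2" "\<And>N. b N \<in> L2" "(\<lambda>N. L2_norm (a N)) \<longlonglongrightarrow> 0" "(\<lambda>N. L2_norm (b N)) \<longlonglongrightarrow> 0"
  shows "(\<lambda>N. L2_norm (\<lambda>x. a N x + b N x)) \<longlonglongrightarrow> 0"
proof (rule Lim_null_comparison)
  show "\<forall>\<^sub>F N in sequentially. norm (L2_norm (\<lambda>x. a N x + b N x)) \<le> L2_norm (a N) + L2_norm (b N)"
    using L2_norm_triangle[OF assms(1,2)] by simp
  show "(\<lambda>N. L2_norm (a N) + L2_norm (b N)) \<longlonglongrightarrow> 0" using tendsto_add[OF assms(3,4)] by simp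
qed

text \<open>Moving \<open>q\<close> onto the test function would leave the smooth class, since
  \<open>q\<close> is only C^1. Instead \<open>u\<close> is approximated by trigonometric
  polynomials, for which the product rule is classical, and the gradient is closed.\<close>

lemma weak_gradient_mult_C1:
  fixes u :: "real^'n \<Rightarrow> real"
  assumes u: "u \<in> L2" "is_weak_gradient u g" and q: "C1 q"
  shows "is_weak_gradient (\<lambda>x. q x * u x) (\<lambda>x. \<chi> j. q x * g x $ j + partial j q x * u x)"
proof -
  obtain w where w: "\<And>N. trig_poly (w N)" "(\<lambda>N. L2_norm (\<lambda>x. w N x - u x)) \<longlonglongrightarrow> 0"
    "\<And>j. (\<lambda>N. L2_norm (\<lambda>x. partial j (w N) x - g x $ j)) \<longlonglongrightarrow> 0"
    using H1_dense_trig[OF u] by blast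
  have mult: "(\<lambda>N. L2_norm (\<lambda>x. b x * v N x)) \<longlonglongrightarrow> 0"
    if b: "periodic b" "continuous_on UNIV b" and v: "\<And>N. v N \<in> L2" "(\<lambda>N. L2_norm (v N)) \<longlonglongrightarrow> 0"
    for b :: "real^'n \<Rightarrow> real" and v
  proof -
    obtain B where B: "\<And>x. \<bar>b x\<bar> \<le> B" using periodic_bounded[OF b] by metis
    show ?thesis
    proof (rule Lim_null_comparison)
      show "\<forall>\<^sub>F N in sequentially. norm (L2_norm (\<lambda>x. b x * v N x)) \<le> B * L2_norm (v N)"
        using L2_norm_mult_bounded[OF v(1) continuous_measurable_torus[OF b(2)] B] by simp
      show "(\<lambda>N. B * L2_norm (v N)) \<longlonglongrightarrow> 0" using v(2) by (rule tendsto_mult_right_zero)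
    qed
  qed
  have qc: "periodic q" "continuous_on UNIV q" by (rule C1_simps(3)[OF q], rule C1_continuous[OF q])
  have pc: "periodic (partial j q)" "continuous_on UNIV (partial j q)" for j by (rule C1_simps(4)[OF q], rule C1_simps(2)[OF q])
  have gL: "(\<lambda>x. g x $ j) \<in> L2" for j using weak_gradient_L2[OF u(2)] .
  have wL: "w N \<in> L2" "partial j (w N) \<in> L2" for N j
    by (rule L2_trig[OF w(1)], rule L2_trig[OF trig_poly_partial[OF w(1)]])
  show ?thesis
  proof (rule weak_gradient_closed[where w="\<lambda>N x. q x * w N x" and h="\<lambda>N. gradient (\<lambda>x. q x * w N x)"])
    show "(\<lambda>x. q x * u x) \<in> L2" by (intro L2_mult_continuous u qc)
    show "(\<lambda>x. (\<chi> j. q x * g x $ j + partial j q x * u x) $ j) \<in> L2" for j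
      using L2_add[OF L2_mult_continuous[OF gL qc] L2_mult_continuous[OF u(1) pc]] by simp
    have C: "C1 (\<lambda>x. q x * w N x)" for N by (rule C1_mult[OF q trig_poly_C1[OF w(1)]])
    show "(\<lambda>x. q x * w N x) \<in> L2" "is_weak_gradient (\<lambda>x. q x * w N x) (gradient (\<lambda>x. q x * w N x))" for N
      by (rule L2_C1(1)[OF C], rule C1_weak_gradient[OF C])
    show "(\<lambda>N. L2_norm (\<lambda>x. q x * w N x - q x * u x)) \<longlonglongrightarrow> 0"
      using mult[OF qc L2_diff[OF wL(1) u(1)] w(2)] by (simp add: right_diff_distrib)
    fix j
    have "(\<lambda>N. L2_norm (\<lambda>x. q x * (partial j (w N) x - g x $ j) + partial j q x * (w N x - u x))) \<longlonglongrightarrow> 0"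
    proof (rule L2_norm_tendsto_add)
      show "(\<lambda>N. L2_norm (\<lambda>x. q x * (partial j (w N) x - g x $ j))) \<longlonglongrightarrow> 0"
        by (rule mult[OF qc L2_diff[OF wL(2) gL] w(3)])
      show "(\<lambda>N. L2_norm (\<lambda>x. partial j q x * (w N x - u x))) \<longlonglongrightarrow> 0"
        by (rule mult[OF pc L2_diff[OF wL(1) u(1)] w(2)])
      show "(\<lambda>x. q x * (partial j (w N) x - g x $ j)) \<in> L2" for N
        by (rule L2_mult_continuous[OF L2_diff[OF wL(2) gL] qc])
      show "(\<lambda>x. partial j q x * (w N x - u x)) \<in> L2" for N
        by (rule L2_mult_continuous[OF L2_diff[OF wL(1) u(1)] pc])
    qed
    moreover have "q x * (partial j (w N) x - g x $ j) + partial j q x * (w N x - u x) =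
      gradient (\<lambda>x. q x * w N x) x $ j - (\<chi> j. q x * g x $ j + partial j q x * u x) $ j" for N x
      using partial_mult[OF C1_simps(1)[OF q] C1_simps(1)[OF trig_poly_C1[OF w(1)]]]
      by (simp add: gradient_def algebra_simps)
    ultimately show "(\<lambda>N. L2_norm (\<lambda>x. gradient (\<lambda>x. q x * w N x) x $ j - (\<chi> j. q x * g x $ j + partial j q x * u x) $ j)) \<longlonglongrightarrow> 0"
      by simp
  qed
qed

lemma H1_mult_C1:
  assumes "u \<in> H1" "C1 q"
  shows "(\<lambda>x. q x * u x) \<in> H1"
proof -
  have L: "u \<in> L2" using assms by (auto simp: H1_def)
  show ?thesis
    using weak_gradient_mult_C1[OF L weak_gradient_is[OF assms(1)] assms(2)]
      L2_mult_continuous[OF L C1_simps(3)[OF assms(2)] C1_continuous[OF assms(2)]]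
    unfolding H1_def by blast
qed

text \<open>Prepared for factors that are not C^1: pointwise convergence of the factors and almost
  everywhere convergence of their partial derivatives, all under one bound \<open>B\<close>, suffice
  for dominated convergence in the product rule. \<open>G\<close> becomes the weak gradient of
  \<open>Q\<close>.\<close>

lemma H1_mult_limit:
  fixes u :: "real^'n \<Rightarrow> real"
  assumes u: "u \<in> H1"
    and q: "\<And>N. C1 (q N)" "\<And>x. (\<lambda>N. q N x) \<longlonglongrightarrow> Q x" "\<And>N x. \<bar>q N x\<bar> \<le> B"
    and G: "\<And>j. periodic (G j)" "\<And>j. G j \<in> borel_measurable torus" "\<And>j. AE x in torus. (\<lambda>N. partial j (q N) x) \<longlonglongrightarrow> G j x"
      "\<And>N j x. \<bar>partial j (q N) x\<bar> \<le> B" "\<And>j x. \<bar>G j x\<bar> \<le> B"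
    and Q: "periodic Q" "Q \<in> borel_measurable torus"
  shows "(\<lambda>x. Q x * u x) \<in> H1"
proof -
  obtain g where g: "is_weak_gradient u g" and uL: "u \<in> L2" using u by (auto simp: H1_def)
  have QB: "\<bar>Q x\<bar> \<le> B" for x
    using tendsto_rabs[OF q(2)[of x]] q(3) by (intro LIMSEQ_le_const2) auto
  have gL: "(\<lambda>x. g x $ j) \<in> L2" for j using weak_gradient_L2[OF g] .
  have lim: "(\<lambda>N. L2_norm (\<lambda>x. a N x * f x - b x * f x)) \<longlonglongrightarrow> 0"
    if f: "f \<in> L2" and a: "\<And>N. a N \<in> borel_measurable torus" "\<And>N x. \<bar>a N x\<bar> \<le> B"
      and b: "b \<in> borel_measurable torus" "\<And>x. \<bar>b x\<bar> \<le> B" and l: "AE x in torus. (\<lambda>N. a N x) \<longlonglongrightarrow> b x"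
    for f a and b :: "real^'n \<Rightarrow> real"
  proof (rule L2_dominated)
    show "(\<lambda>x. a N x * f x - b x * f x) \<in> borel_measurable torus" for N
      using a(1)[of N] b(1) L2D(2)[OF f] by simp
    show "AE x in torus. (\<lambda>N. a N x * f x - b x * f x) \<longlonglongrightarrow> 0"
      using l
    proof eventually_elim
      case (elim x)
      show ?case
        using tendsto_diff[OF tendsto_mult[OF elim tendsto_const[of "f x"]] tendsto_const[of "b x * f x"]] by simp
    qed
    have "(\<lambda>x. 2 * B * f x) \<in> L2" by (intro L2_cmult f)
    then show "(\<lambda>x. \<bar>2 * B * f x\<bar>) \<in> L2" by (auto simp: L2_def periodic_def)
    show "AE x in torus. \<bar>a N x * f x - b x * f x\<bar> \<le> \<bar>2 * B * f x\<bar>" for N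
    proof (rule AE_I2)
      fix x
      have "\<bar>a N x - b x\<bar> \<le> \<bar>2 * B\<bar>" using a(2)[of N x] b(2)[of x] by linarith
      then have "\<bar>a N x - b x\<bar> * \<bar>f x\<bar> \<le> \<bar>2 * B\<bar> * \<bar>f x\<bar>" by (intro mult_right_mono) auto
      then show "\<bar>a N x * f x - b x * f x\<bar> \<le> \<bar>2 * B * f x\<bar>"
        by (simp only: abs_mult left_diff_distrib[symmetric])
    qed
  qed
  have qm: "q N \<in> borel_measurable torus" "partial j (q N) \<in> borel_measurable torus" for N j
    by (intro continuous_measurable_torus C1_continuous q(1) C1_simps(2)[OF q(1)])+
  have "is_weak_gradient (\<lambda>x. Q x * u x) (\<lambda>x. \<chi> j. Q x * g x $ j + G j x * u x)"
  proof (rule weak_gradient_closed)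
    show "(\<lambda>x. Q x * u x) \<in> L2" by (rule L2_mult_bounded[OF uL Q QB])
    show "(\<lambda>x. (\<chi> j. Q x * g x $ j + G j x * u x) $ j) \<in> L2" for j
      using L2_add[OF L2_mult_bounded[OF gL Q QB] L2_mult_bounded[OF uL G(1,2,5)]] by simp
    show "is_weak_gradient (\<lambda>x. q N x * u x) (\<lambda>x. \<chi> j. q N x * g x $ j + partial j (q N) x * u x)" for N
      by (intro weak_gradient_mult_C1 uL g q)
    show "(\<lambda>x. q N x * u x) \<in> L2" for N
      by (rule L2_mult_bounded[OF uL C1_simps(3)[OF q(1)] qm(1) q(3)])
    show "(\<lambda>N. L2_norm (\<lambda>x. q N x * u x - Q x * u x)) \<longlonglongrightarrow> 0"
      by (intro lim uL qm q(3) Q QB) (use q(2) in auto)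
    fix j
    have "(\<lambda>N. L2_norm (\<lambda>x. (q N x * g x $ j - Q x * g x $ j) + (partial j (q N) x * u x - G j x * u x))) \<longlonglongrightarrow> 0"
    proof (rule L2_norm_tendsto_add)
      show "(\<lambda>N. L2_norm (\<lambda>x. q N x * g x $ j - Q x * g x $ j)) \<longlonglongrightarrow> 0"
        by (intro lim gL qm q(3) Q QB) (use q(2) in auto)
      show "(\<lambda>N. L2_norm (\<lambda>x. partial j (q N) x * u x - G j x * u x)) \<longlonglongrightarrow> 0"
        by (intro lim uL qm G)
      show "(\<lambda>x. q N x * g x $ j - Q x * g x $ j) \<in> L2" for N
        by (rule L2_diff[OF L2_mult_bounded[OF gL C1_simps(3)[OF q(1)] qm(1) q(3)] L2_mult_bounded[OF gL Q QB]])
      show "(\<lambda>x. partial j (q N) x * u x - G j x * u x) \<in> L2" for N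
        by (rule L2_diff[OF L2_mult_bounded[OF uL C1_simps(4)[OF q(1)] qm(2) G(4)] L2_mult_bounded[OF uL G(1,2,5)]])
    qed
    then show "(\<lambda>N. L2_norm (\<lambda>x. (\<chi> j. q N x * g x $ j + partial j (q N) x * u x) $ j -
       (\<chi> j. Q x * g x $ j + G j x * u x) $ j)) \<longlonglongrightarrow> 0"
      by (simp add: algebra_simps)
  qed
  then show ?thesis
    unfolding H1_def using L2_mult_bounded[OF uL Q QB] by blast
qed

subsection \<open>Rapid oscillations\<close>

text \<open>
  Translating the integrand by \<open>s\<close> leaves the integral unchanged; averaging over \<open>s\<close> in the cube
  removes the oscillating factor, at the price of a difference of translates of \<open>\<psi>\<close>.
\<close>

lemma oscillating_integral_bound:
  fixes g \<psi> :: "real^'n \<Rightarrow> real"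
  assumes g: "periodic g" "continuous_on UNIV g" "\<And>x. \<bar>g x\<bar> \<le> M" "(\<integral>x. g x \<partial>torus) = 0"
    and \<epsilon>: "\<epsilon> > 0" "periodic (\<lambda>x. g (x /\<^sub>R \<epsilon>))" and \<psi>: "C1 \<psi>"
  shows "\<bar>\<integral>x. g (x /\<^sub>R \<epsilon>) * \<psi> x \<partial>torus\<bar> \<le> \<epsilon> * M * (\<Sum>j\<in>UNIV. \<integral>x. \<bar>partial j \<psi> x\<bar> \<partial>torus)"
proof -
  define I where "I = (\<integral>x. g (x /\<^sub>R \<epsilon>) * \<psi> x \<partial>torus)"
  define J where "J = (\<lambda>s. \<integral>x. g (x /\<^sub>R \<epsilon> + s) * \<psi> x \<partial>torus)"
  define R where "R = \<epsilon> * M * (\<Sum>j\<in>UNIV. \<integral>x. \<bar>partial j \<psi> x\<bar> \<partial>torus)"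
  note c\<psi> = C1_continuous[OF \<psi>]
  have M0: "M \<ge> 0" using g(3)[of 0] by linarith
  have cg: "continuous_on UNIV (\<lambda>x. g (x /\<^sub>R \<epsilon> + s))" for s
    by (rule continuous_on_compose2[OF g(2)]) (auto intro!: continuous_intros)
  \<comment> \<open>The substitution \<open>x + \<epsilon> *\<^sub>R s\<close> shifts the phase by
    exactly \<open>s\<close>. It uses the period 1 of the scaled function, while the later average
    over \<open>s\<close> uses the period 1 of \<open>g\<close> itself; \<epsilon> need not be the
    reciprocal of an integer.\<close>
  have near: "\<bar>I - J s\<bar> \<le> R" if s: "s \<in> cbox 0 One" for s
  proof -
    have "(\<integral>x. g ((x + \<epsilon> *\<^sub>R s) /\<^sub>R \<epsilon>) * \<psi> (x + \<epsilon> *\<^sub>R s) \<partial>torus) = I"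
      unfolding I_def
      by (rule integral_torus_shift[of "\<lambda>x. g (x /\<^sub>R \<epsilon>) * \<psi> x"])
         (use cg[of 0] c\<psi> in \<open>auto intro!: continuous_intros periodic_mult \<epsilon>(2) C1_simps(3)[OF \<psi>]\<close>)
    moreover have "(x + \<epsilon> *\<^sub>R s) /\<^sub>R \<epsilon> = x /\<^sub>R \<epsilon> + s" for x :: "real^'n"
      using \<epsilon>(1) by (simp add: scaleR_add_right)
    ultimately have I: "I = (\<integral>x. g (x /\<^sub>R \<epsilon> + s) * \<psi> (x + \<epsilon> *\<^sub>R s) \<partial>torus)" by simp
    have "I - J s = (\<integral>x. g (x /\<^sub>R \<epsilon> + s) * (\<psi> (x + \<epsilon> *\<^sub>R s) - \<psi> x) \<partial>torus)"
      unfolding I J_def right_diff_distrib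
      by (intro Bochner_Integration.integral_diff[symmetric] integrable_torus_continuous continuous_on_mult
          cg c\<psi> continuous_shift[OF c\<psi>])
    also have "\<bar>\<dots>\<bar> \<le> (\<integral>x. \<bar>g (x /\<^sub>R \<epsilon> + s) * (\<psi> (x + \<epsilon> *\<^sub>R s) - \<psi> x)\<bar> \<partial>torus)"
      by (rule integral_abs_bound)
    also have "\<dots> \<le> (\<integral>x. M * \<bar>\<psi> (x + \<epsilon> *\<^sub>R s) - \<psi> x\<bar> \<partial>torus)"
      by (rule integral_mono)
         (use g(3) in \<open>auto intro!: integrable_torus_continuous continuous_intros cg c\<psi> continuous_shift[OF c\<psi>] mult_right_mono simp: abs_mult\<close>)
    also have "\<dots> = M * (\<integral>x. \<bar>\<psi> (x + \<epsilon> *\<^sub>R s) - \<psi> x\<bar> \<partial>torus)" by simp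
    also have "\<dots> \<le> M * (\<Sum>j\<in>UNIV. \<bar>(\<epsilon> *\<^sub>R s) $ j\<bar> * (\<integral>x. \<bar>partial j \<psi> x\<bar> \<partial>torus))"
      by (intro mult_left_mono L1_shift_le \<psi> M0)
    also have "\<dots> \<le> M * (\<Sum>j\<in>UNIV. \<epsilon> * (\<integral>x. \<bar>partial j \<psi> x\<bar> \<partial>torus))"
    proof (intro mult_left_mono sum_mono mult_right_mono M0)
      fix j
      have "0 \<le> s $ j" "s $ j \<le> 1" using s by (auto simp: mem_box_cart)
      then show "\<bar>(\<epsilon> *\<^sub>R s) $ j\<bar> \<le> \<epsilon>" using \<epsilon>(1) by (simp add: abs_mult)
    qed (auto intro: integral_nonneg_AE)
    finally show ?thesis by (simp add: R_def sum_distrib_left mult.assoc mult.left_commute)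
  qed
  obtain B where B: "B > 0" "\<And>x. \<bar>\<psi> x\<bar> \<le> B" using periodic_bounded[OF C1_simps(3)[OF \<psi>] c\<psi>] by metis
  interpret T: sigma_finite_measure "torus :: (real^'n) measure" by (rule sigma_finite_torus)
  interpret P: pair_sigma_finite "torus :: (real^'n) measure" "torus :: (real^'n) measure" ..
  interpret F: finite_measure "torus :: (real^'n) measure" by (rule finite_measure_torus)
  interpret FP: finite_measure "torus \<Otimes>\<^sub>M (torus :: (real^'n) measure)"
    by (intro finite_measure_pair_measure finite_measure_torus)
  have mg: "g \<in> borel_measurable borel" "\<psi> \<in> borel_measurable borel"
    by (intro borel_measurable_continuous_onI g c\<psi>)+
  have idt: "(\<lambda>x. x) \<in> measurable (torus :: (real^'n) measure) borel"
    by (intro measurable_torus) simp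
  have meas: "(\<lambda>(s, x). g (x /\<^sub>R \<epsilon> + s) * \<psi> x) \<in> borel_measurable (torus \<Otimes>\<^sub>M torus)"
  proof -
    have 1: "fst \<in> borel_measurable ((torus :: (real^'n) measure) \<Otimes>\<^sub>M (torus :: (real^'n) measure))"
      by (rule measurable_compose[OF measurable_fst idt])
    have 2: "snd \<in> borel_measurable ((torus :: (real^'n) measure) \<Otimes>\<^sub>M (torus :: (real^'n) measure))"
      by (rule measurable_compose[OF measurable_snd idt])
    have "(\<lambda>p. snd p /\<^sub>R \<epsilon> + fst p) \<in> borel_measurable ((torus :: (real^'n) measure) \<Otimes>\<^sub>M (torus :: (real^'n) measure))"
      using 1 2 by (intro borel_measurable_add borel_measurable_scaleR borel_measurable_const)
    then show ?thesis
      unfolding case_prod_beta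
      by (intro borel_measurable_times measurable_compose[OF _ mg(1)] measurable_compose[OF 2 mg(2)])
  qed
  have int: "integrable (torus \<Otimes>\<^sub>M torus) (\<lambda>(s, x). g (x /\<^sub>R \<epsilon> + s) * \<psi> x)"
  proof (rule FP.integrable_const_bound[OF AE_I2 meas])
    fix p :: "(real^'n) \<times> (real^'n)"
    show "norm ((\<lambda>(s, x). g (x /\<^sub>R \<epsilon> + s) * \<psi> x) p) \<le> M * B"
      using g(3) B M0 by (auto simp: case_prod_beta abs_mult intro!: mult_mono)
  qed
  \<comment> \<open>For fixed \<open>x\<close> the average over the phase is the mean of a translate
    of \<open>g\<close>, hence zero. After Fubini this annihilates the average of
    \<open>J\<close>.\<close>
  have gs: "(\<integral>s. g (x /\<^sub>R \<epsilon> + s) \<partial>torus) = 0" for x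
    using integral_torus_shift[OF g(2,1), of "x /\<^sub>R \<epsilon>"] g(4) by (simp add: add.commute)
  have iJ: "integrable torus J" unfolding J_def using P.integrable_fst[OF int] by simp
  have "(\<integral>s. J s \<partial>torus) = (\<integral>x. (\<integral>s. g (x /\<^sub>R \<epsilon> + s) * \<psi> x \<partial>torus) \<partial>torus)"
    unfolding J_def using P.Fubini_integral[OF int] by simp
  also have "\<dots> = 0" by (simp add: gs)
  finally have J0: "(\<integral>s. J s \<partial>torus) = 0" .
  have "I = (\<integral>s. I - J s \<partial>torus)" using iJ J0 by simp
  also have "\<bar>\<dots>\<bar> \<le> (\<integral>s. \<bar>I - J s\<bar> \<partial>torus)" by (rule integral_abs_bound)
  also have "\<dots> \<le> (\<integral>s. R \<partial>(torus :: (real^'n) measure))"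
    by (rule integral_mono_AE) (use iJ near in \<open>auto intro!: AE_I2\<close>)
  finally show ?thesis unfolding I_def R_def by simp
qed

subsection \<open>Uniform limits of equi-Lipschitz potentials\<close>

lemma C1_cmult: "C1 f \<Longrightarrow> C1 (\<lambda>x. c * f x)"
  by (rule C1_mult[OF C1_const])

lemma C1_diff: "C1 f \<Longrightarrow> C1 g \<Longrightarrow> C1 (\<lambda>x. f x - g x)"
  using C1_add[OF _ C1_cmult[of g "-1"]] by simp

lemma C1_exp:
  assumes "C1 f"
  shows "C1 (\<lambda>x. exp (c * f x))" "partial j (\<lambda>x. exp (c * f x)) x = c * exp (c * f x) * partial j f x"
proof -
  have d: "f differentiable (at x)" for x by (rule C1_simps(1)[OF assms])
  have e: "((\<lambda>t. exp (c * t)) has_real_derivative c * exp (c * t)) (at t)" for t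
    by (auto intro!: derivative_eq_intros)
  have p: "partial j (\<lambda>x. exp (c * f x)) = (\<lambda>x. c * exp (c * f x) * partial j f x)" for j
    by (rule ext) (rule partial_chain_real(2)[OF d e])
  then show "partial j (\<lambda>x. exp (c * f x)) x = c * exp (c * f x) * partial j f x" by simp
  have "periodic (\<lambda>x. exp (c * f x))" by (rule periodic_compose[OF C1_simps(3)[OF assms]])
  moreover have "(\<lambda>x. exp (c * f x)) differentiable (at x)" for x
    by (rule partial_chain_real(1)[OF d e])
  moreover have "continuous_on UNIV (partial j (\<lambda>x. exp (c * f x)))" for j
    unfolding p by (intro continuous_intros C1_continuous[OF assms] C1_simps(2)[OF assms])
  ultimately show "C1 (\<lambda>x. exp (c * f x))" by (simp add: C1_def)
qed

lemma parallelogram_L2: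
  assumes "f \<in> L2" "g \<in> L2"
  shows "(L2_norm (\<lambda>x. f x - g x))\<^sup>2 = 2 * (L2_norm f)\<^sup>2 + 2 * (L2_norm g)\<^sup>2 - 4 * (L2_norm (\<lambda>x. (f x + g x) / 2))\<^sup>2"
proof -
  have i: "integrable torus (\<lambda>x. (f x)\<^sup>2)" "integrable torus (\<lambda>x. (g x)\<^sup>2)" "integrable torus (\<lambda>x. ((f x + g x) / 2)\<^sup>2)"
    using L2D(3)[OF assms(1)] L2D(3)[OF assms(2)] L2D(3)[OF L2_cmult[OF L2_add[OF assms], of "1/2"]] by auto
  have "(\<integral>x. (f x - g x)\<^sup>2 \<partial>torus) = (\<integral>x. 2 * (f x)\<^sup>2 + 2 * (g x)\<^sup>2 - 4 * ((f x + g x) / 2)\<^sup>2 \<partial>torus)"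
    by (intro Bochner_Integration.integral_cong refl) (simp add: power2_eq_square field_simps)
  also have "\<dots> = 2 * (\<integral>x. (f x)\<^sup>2 \<partial>torus) + 2 * (\<integral>x. (g x)\<^sup>2 \<partial>torus) - 4 * (\<integral>x. ((f x + g x) / 2)\<^sup>2 \<partial>torus)"
    using i by simp
  finally show ?thesis unfolding L2_norm_power2 .
qed

text \<open>The torus has measure one, so L^1 norms are at most L^2 norms. By monotone convergence
  the series of absolute values has a finite integral and is therefore finite almost
  everywhere.\<close>

lemma geometric_summable_AE:
  fixes f :: "nat \<Rightarrow> real^'n \<Rightarrow> real"
  assumes f: "\<And>k. f k \<in> L2" "\<And>k. L2_norm (f k) \<le> (1/2) ^ k"
  shows "AE x in torus. summable (\<lambda>k. f k x)"
proof -
  have m: "f k \<in> borel_measurable torus" for k by (rule L2D(2)[OF f(1)])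
  have "(\<integral>\<^sup>+x. ennreal \<bar>f k x\<bar> \<partial>torus) \<le> ennreal ((1/2) ^ k)" for k
  proof -
    have a: "(\<lambda>x. \<bar>f k x\<bar>) \<in> L2" using f(1)[of k] by (auto simp: L2_def periodic_def)
    have "(\<integral>\<^sup>+x. ennreal \<bar>f k x\<bar> \<partial>torus) = ennreal (\<integral>x. \<bar>f k x\<bar> \<partial>torus)"
      by (intro nn_integral_eq_integral L2_integrable a) auto
    also have "(\<integral>x. \<bar>f k x\<bar> \<partial>torus) \<le> L2_norm (\<lambda>x. \<bar>f k x\<bar>) * L2_norm (\<lambda>_::real^'n. 1)"
      using L2_Cauchy_Schwarz[OF a L2_const[of 1]] by simp
    also have "\<dots> = L2_norm (f k)" by (simp add: L2_norm_def)
    finally show ?thesis using f(2)[of k] by (meson ennreal_leI order_trans)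
  qed
  then have "(\<Sum>k. (\<integral>\<^sup>+x. ennreal \<bar>f k x\<bar> \<partial>torus)) \<le> (\<Sum>k. ennreal ((1/2) ^ k))"
    by (intro suminf_le) auto
  also have "\<dots> = ennreal (\<Sum>k. (1/2) ^ k)"
    by (intro suminf_ennreal2) (auto intro: summable_geometric)
  also have "\<dots> < \<infinity>" by simp
  finally have "(\<integral>\<^sup>+x. (\<Sum>k. ennreal \<bar>f k x\<bar>) \<partial>torus) < \<infinity>"
    using m by (subst nn_integral_suminf) auto
  then have "(\<integral>\<^sup>+x. (\<Sum>k. ennreal \<bar>f k x\<bar>) \<partial>torus) \<noteq> \<infinity>" by (simp add: less_top)
  then have "AE x in torus. (\<Sum>k. ennreal \<bar>f k x\<bar>) \<noteq> \<infinity>"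
    using m by (intro nn_integral_PInf_AE) auto
  then show ?thesis
  proof eventually_elim
    case (elim x)
    then have "summable (\<lambda>k. \<bar>f k x\<bar>)" by (intro summable_suminf_not_top) auto
    then show ?case by (rule summable_rabs_cancel)
  qed
qed

text \<open>
  Among the admissible approximations of \<open>V\<close> up to error \<open>1/(k+1)\<close>, which form a convex set, take
  near-minimizers of the Dirichlet energy. By the parallelogram law their gradients are Cauchy, so
  no weak compactness is needed.
\<close>

lemma equi_lipschitz_limit:
  fixes V :: "real^'n \<Rightarrow> real"
  assumes ex: "\<And>k. \<exists>q. C1 q \<and> (\<forall>j x. \<bar>partial j q x\<bar> \<le> L) \<and> (\<forall>x. \<bar>q x - V x\<bar> \<le> 1 / real (Suc k))"
  obtains q G where "\<And>k. C1 (q k)" "\<And>k j x. \<bar>partial j (q k) x\<bar> \<le> L" "\<And>k x. \<bar>q k x - V x\<bar> \<le> 1 / real (Suc k)"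
    "\<And>j. periodic (G j)" "\<And>j. G j \<in> borel_measurable torus" "\<And>j x. \<bar>G j x\<bar> \<le> L"
    "\<And>j. AE x in torus. (\<lambda>k. partial j (q k) x) \<longlonglongrightarrow> G j x"
proof -
  define S where "S = (\<lambda>k. {q. C1 q \<and> (\<forall>j x. \<bar>partial j q x\<bar> \<le> L) \<and> (\<forall>x. \<bar>q x - V x\<bar> \<le> 1 / real (Suc k))})"
  define D where "D = (\<lambda>q :: real^'n \<Rightarrow> real. \<Sum>j\<in>UNIV. (L2_norm (partial j q))\<^sup>2)"
  have D0: "D q \<ge> 0" for q unfolding D_def by (intro sum_nonneg) auto
  have L0: "L \<ge> 0" 
  proof -
    obtain q :: "real^'n \<Rightarrow> real" where "\<forall>j x. \<bar>partial j q x\<bar> \<le> L" using ex[of 0] by blast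
    then have "\<bar>partial undefined q 0\<bar> \<le> L" by blast
    then show ?thesis by linarith
  qed
  have Sne: "S k \<noteq> {}" for k using ex[of k] by (auto simp: S_def)
  have Smono: "S l \<subseteq> S k" if "k \<le> l" for k l
  proof -
    have "1 / real (Suc l) \<le> 1 / real (Suc k)" using that by (intro divide_left_mono) auto
    then have "\<bar>q x - V x\<bar> \<le> 1 / real (Suc k)" if "\<bar>q x - V x\<bar> \<le> 1 / real (Suc l)" for q :: "real^'n \<Rightarrow> real" and x
      using that by (rule order_trans[rotated])
    then show ?thesis unfolding S_def by blast
  qed
  have mid: "(\<lambda>x. 1/2 * (q x + r x)) \<in> S k" and midp: "partial j (\<lambda>x. 1/2 * (q x + r x)) x = (partial j q x + partial j r x) / 2"
    if "q \<in> S k" "r \<in> S k" for q r k j x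
  proof -
    have C: "C1 q" "C1 r" using that by (auto simp: S_def)
    have d: "q differentiable (at x)" "r differentiable (at x)" for x by (rule C1_simps(1)[OF C(1)], rule C1_simps(1)[OF C(2)])
    have d2: "(\<lambda>x. q x + r x) differentiable (at x)" for x by (rule C1_simps(1)[OF C1_add[OF C]])
    have p: "partial j (\<lambda>x. 1/2 * (q x + r x)) x = (partial j q x + partial j r x) / 2" for j x
      using partial_cmult[OF d2[of x], of j "1/2"] partial_add[OF d[of x], of j] by simp
    then show "partial j (\<lambda>x. 1/2 * (q x + r x)) x = (partial j q x + partial j r x) / 2" .
    have "\<bar>(partial j q x + partial j r x) / 2\<bar> \<le> L" for j x
    proof -
      have "\<bar>partial j q x\<bar> \<le> L" "\<bar>partial j r x\<bar> \<le> L" using that by (auto simp: S_def)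
      then have "\<bar>partial j q x + partial j r x\<bar> \<le> 2 * L" by linarith
      then show ?thesis by simp
    qed
    moreover have "\<bar>1/2 * (q x + r x) - V x\<bar> \<le> 1 / real (Suc k)" for x
    proof -
      have "\<bar>q x - V x\<bar> \<le> 1 / real (Suc k)" "\<bar>r x - V x\<bar> \<le> 1 / real (Suc k)" using that by (auto simp: S_def)
      then show ?thesis by (simp only: abs_le_iff) (simp add: field_simps)
    qed
    ultimately show "(\<lambda>x. 1/2 * (q x + r x)) \<in> S k"
      unfolding S_def mem_Collect_eq p using C1_cmult[OF C1_add[OF C], of "1/2"] by blast
  qed
  define d where "d = (\<lambda>k. Inf (D ` S k))"
  have bdd: "bdd_below (D ` S k)" for k using D0 by (intro bdd_belowI2[of _ 0]) auto
  have d_le: "d k \<le> D q" if "q \<in> S k" for k q unfolding d_def by (intro cInf_lower bdd imageI that)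
  have d_mono: "d k \<le> d l" if "k \<le> l" for k l
    unfolding d_def using Sne Smono[OF that] by (intro cInf_superset_mono bdd) auto
  have d_bound: "d k \<le> real CARD('n) * L\<^sup>2" for k
  proof -
    obtain q where q: "q \<in> S k" using Sne by blast
    have "(L2_norm (partial j q))\<^sup>2 \<le> L\<^sup>2" for j
    proof (rule power_mono)
      show "L2_norm (partial j q) \<le> L"
        using q by (intro L2_norm_bounded continuous_measurable_torus C1_simps) (auto simp: S_def)
    qed simp
    then have "D q \<le> (\<Sum>j\<in>(UNIV::'n set). L\<^sup>2)" unfolding D_def by (intro sum_mono)
    then show ?thesis using d_le[OF q] by simp
  qed
  have "\<exists>q\<in>S k. D q < d k + 1 / real (Suc k)" for k
  proof -
    have ne: "D ` S k \<noteq> {}" using Sne by simp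
    have "0 < 1 / real (Suc k)" by simp
    then have "Inf (D ` S k) < d k + 1 / real (Suc k)" unfolding d_def by linarith
    from cInf_lessD[OF ne this] show ?thesis by (elim bexE imageE) (rule bexI, simp_all)
  qed
  then obtain q where q: "\<And>k. q k \<in> S k" "\<And>k. D (q k) < d k + 1 / real (Suc k)" by metis
  have "incseq d" using d_mono by (simp add: incseq_def)
  have "\<forall>k. d k \<le> real CARD('n) * L\<^sup>2" by (rule allI[OF d_bound])
  with \<open>incseq d\<close> obtain dl where dl: "d \<longlonglongrightarrow> dl" by (rule incseq_convergent)
  have d_le_dl: "d k \<le> dl" for k using incseq_le[OF \<open>incseq d\<close> dl] .
  \<comment> \<open>The parallelogram law, near-minimality, and the lower bound \<open>d k\<close>
    for the energy of the midpoint give at most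
    \<open>2 * (d l - d k) + 2 / (k + 1) + 2 / (l + 1)\<close>; for \<open>l \<ge> k\<close> this is
    at most \<open>e k\<close>, which involves only the smaller index. Both functions count as
    members of \<open>S k\<close> because the sets decrease.\<close>
  define e where "e = (\<lambda>k. 2 * (dl - d k) + 4 / real (Suc k))"
  have cauchy: "(\<Sum>j\<in>UNIV. (L2_norm (\<lambda>x. partial j (q k) x - partial j (q l) x))\<^sup>2) \<le> e k" if kl: "k \<le> l" for k l
  proof -
    have ql: "q l \<in> S k" using q(1)[of l] Smono[OF kl] by blast
    have C: "C1 (q k)" "C1 (q l)" using q(1)[of k] ql by (auto simp: S_def)
    have "(\<Sum>j\<in>UNIV. (L2_norm (\<lambda>x. partial j (q k) x - partial j (q l) x))\<^sup>2)
       = 2 * D (q k) + 2 * D (q l) - 4 * D (\<lambda>x. 1/2 * (q k x + q l x))"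
    proof -
      have "partial j (\<lambda>x. 1/2 * (q k x + q l x)) = (\<lambda>x. (partial j (q k) x + partial j (q l) x) / 2)" for j
        by (rule ext) (rule midp[OF q(1) ql])
      then show ?thesis
        unfolding D_def parallelogram_L2[OF L2_C1(2)[OF C(1)] L2_C1(2)[OF C(2)]]
        by (simp add: sum.distrib sum_subtractf sum_distrib_left)
    qed
    also have "\<dots> \<le> 2 * (d k + 1 / real (Suc k)) + 2 * (d l + 1 / real (Suc l)) - 4 * d k"
      using q(2)[of k] q(2)[of l] d_le[OF mid[OF q(1) ql]] by argo
    also have "\<dots> \<le> e k"
    proof -
      have "1 / real (Suc l) \<le> 1 / real (Suc k)" using kl by (intro divide_left_mono) auto
      moreover have "4 / real (Suc k) = 4 * (1 / real (Suc k))" by simp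
      ultimately show ?thesis using d_le_dl[of l] unfolding e_def by argo
    qed
    finally show ?thesis .
  qed
  have "e \<longlonglongrightarrow> 2 * (dl - dl) + 4 * 0"
  proof -
    have "(\<lambda>k. 2 * (dl - d k) + 4 * (1 / real (Suc k))) \<longlonglongrightarrow> 2 * (dl - dl) + 4 * 0"
      using LIMSEQ_inverse_real_of_nat by (intro tendsto_intros dl) (simp add: inverse_eq_divide)
    then show ?thesis by (simp add: e_def)
  qed
  then have e0: "e \<longlonglongrightarrow> 0" by simp
  \<comment> \<open>A selection fast enough for the gradients to be summable. Requiring
    \<open>m k \<ge> k\<close> keeps the selected function in \<open>S k\<close>.\<close>
  have "\<exists>m\<ge>k. e m \<le> ((1/2) ^ k)\<^sup>2" for k
  proof -
    have "\<forall>\<^sub>F m in sequentially. e m < ((1/2) ^ k)\<^sup>2" using e0 by (rule order_tendstoD) simp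
    then obtain M where "\<forall>m\<ge>M. e m < ((1/2) ^ k)\<^sup>2" by (auto simp: eventually_sequentially)
    then have "e (max M k) < ((1/2) ^ k)\<^sup>2" "max M k \<ge> k" by auto
    then show ?thesis by (intro exI[of _ "max M k"]) simp
  qed
  then obtain m where m: "\<And>k. m k \<ge> k" "\<And>k. e (m k) \<le> ((1/2) ^ k)\<^sup>2" by metis
  define p where "p = (\<lambda>k. q (m k))"
  have pS: "p k \<in> S k" for k using q(1)[of "m k"] Smono[OF m(1)] unfolding p_def by blast
  have pC: "C1 (p k)" and pL: "\<bar>partial j (p k) x\<bar> \<le> L" and pV: "\<bar>p k x - V x\<bar> \<le> 1 / real (Suc k)" for k j x
    using pS[of k] by (auto simp: S_def)
  have step: "L2_norm (\<lambda>x. partial j (p (Suc k)) x - partial j (p k) x) \<le> (1/2) ^ k" for j k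
  proof (rule power2_le_imp_le)
    have le: "(L2_norm (\<lambda>x. partial j (q a) x - partial j (q b) x))\<^sup>2 \<le> e a" if "a \<le> b" for a b
    proof -
      have "(L2_norm (\<lambda>x. partial j (q a) x - partial j (q b) x))\<^sup>2 \<le> (\<Sum>j\<in>UNIV. (L2_norm (\<lambda>x. partial j (q a) x - partial j (q b) x))\<^sup>2)"
        by (rule member_le_sum) auto
      then show ?thesis using cauchy[OF that] by linarith
    qed
    show "(L2_norm (\<lambda>x. partial j (p (Suc k)) x - partial j (p k) x))\<^sup>2 \<le> ((1/2) ^ k)\<^sup>2"
    \<comment> \<open>The indices \<open>m k\<close> need not increase, and the Cauchy bound is
      governed by the smaller of the two.\<close>
    proof (cases "m (Suc k) \<le> m k")
      case True
      have "((1/2::real) ^ Suc k)\<^sup>2 \<le> ((1/2) ^ k)\<^sup>2" by (intro power_mono power_decreasing) auto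
      then show ?thesis using le[OF True] m(2)[of "Suc k"] unfolding p_def by linarith
    next
      case False
      then have "m k \<le> m (Suc k)" by simp
      from le[OF this] show ?thesis
        using m(2)[of k] unfolding p_def L2_norm_uminus[of "partial j (q (m (Suc k)))"] by (rule order_trans)
    qed
  qed simp
  \<comment> \<open>Where the sequence diverges \<open>lim\<close> is arbitrary; clipping enforces
    the bound by \<open>L\<close> at every point and changes nothing where the limit exists.
    Defining the limit pointwise also keeps \<open>G\<close> periodic.\<close>
  define G where "G = (\<lambda>j x. max (- L) (min L (lim (\<lambda>k. partial j (p k) x))))"
  show thesis
  proof (rule that[of p G])
    show "C1 (p k)" "\<bar>partial j (p k) x\<bar> \<le> L" "\<bar>p k x - V x\<bar> \<le> 1 / real (Suc k)" for k j x
      by (rule pC, rule pL, rule pV)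
    have pm: "partial j (p k) \<in> borel_measurable torus" for j k
      by (rule continuous_measurable_torus[OF C1_simps(2)[OF pC]])
    then show "G j \<in> borel_measurable torus" for j
      unfolding G_def by (intro borel_measurable_max borel_measurable_min borel_measurable_const borel_measurable_lim_metric)
    show "periodic (G j)" for j
      unfolding periodic_def G_def using periodicD[OF C1_simps(4)[OF pC]] by (simp only: simp_thms)
    show "\<bar>G j x\<bar> \<le> L" for j x using L0 by (auto simp: G_def)
    fix j
    have "AE x in torus. summable (\<lambda>k. partial j (p (Suc k)) x - partial j (p k) x)"
      by (rule geometric_summable_AE[OF L2_diff[OF L2_C1(2)[OF pC] L2_C1(2)[OF pC]] step])
    then show "AE x in torus. (\<lambda>k. partial j (p k) x) \<longlonglongrightarrow> G j x"
    proof eventually_elim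
      case (elim x)
      then have "(\<lambda>n. \<Sum>k<n. partial j (p (Suc k)) x - partial j (p k) x) \<longlonglongrightarrow> (\<Sum>k. partial j (p (Suc k)) x - partial j (p k) x)"
        by (rule summable_LIMSEQ)
      then have "(\<lambda>n. partial j (p n) x - partial j (p 0) x) \<longlonglongrightarrow> (\<Sum>k. partial j (p (Suc k)) x - partial j (p k) x)"
        unfolding sum_lessThan_telescope[of "\<lambda>k. partial j (p k) x"] .
      from tendsto_add[OF this tendsto_const[of "partial j (p 0) x"]]
      obtain l where l: "(\<lambda>n. partial j (p n) x) \<longlonglongrightarrow> l" by auto
      have "\<bar>l\<bar> \<le> L" using tendsto_rabs[OF l] pL by (intro LIMSEQ_le_const2) auto
      then have "G j x = l" unfolding G_def limI[OF l] by auto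
      then show ?case using l by simp
    qed
  qed
qed

text \<open>Used with \<open>c = -1\<close> and \<open>c = 1\<close>: multiplication by the limit
  weight and division by it preserve H^1, although its exponent is only a uniform limit of C^1
  functions with bounded gradients.\<close>

lemma H1_mult_exp_limit:
  fixes V :: "real^'n \<Rightarrow> real"
  assumes ex: "\<And>k. \<exists>q. C1 q \<and> (\<forall>j x. \<bar>partial j q x\<bar> \<le> L) \<and> (\<forall>x. \<bar>q x - V x\<bar> \<le> 1 / real (Suc k))"
    and V: "periodic V" "continuous_on UNIV V" "\<And>x. \<bar>V x\<bar> \<le> M" and u: "u \<in> H1"
  shows "(\<lambda>x. exp (c * V x) * u x) \<in> H1"
proof -
  obtain q G where q: "\<And>k. C1 (q k)" "\<And>k j x. \<bar>partial j (q k) x\<bar> \<le> L" "\<And>k x. \<bar>q k x - V x\<bar> \<le> 1 / real (Suc k)"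
    and G: "\<And>j. periodic (G j)" "\<And>j. G j \<in> borel_measurable torus" "\<And>j x. \<bar>G j x\<bar> \<le> L"
    "\<And>j. AE x in torus. (\<lambda>k. partial j (q k) x) \<longlonglongrightarrow> G j x"
    using equi_lipschitz_limit[OF ex] by blast
  have M0: "M \<ge> 0" using V(3)[of 0] by linarith
  have L0: "L \<ge> 0" using q(2)[of undefined 0 0] by linarith
  have qM: "\<bar>q k x\<bar> \<le> M + 1" for k x
  proof -
    have "1 / real (Suc k) \<le> 1" by simp
    then show ?thesis using q(3)[of k x] V(3)[of x] by linarith
  qed
  \<comment> \<open>\<open>M + 1\<close> bounds the approximants as well as \<open>V\<close>, since
    their distance is at most 1; \<open>B\<close> then dominates both the exponentials and, by the
    chain rule, their partial derivatives.\<close>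
  define B where "B = exp (\<bar>c\<bar> * (M + 1)) * (1 + \<bar>c\<bar> * L)"
  have expB: "exp (c * t) \<le> exp (\<bar>c\<bar> * (M + 1))" if "\<bar>t\<bar> \<le> M + 1" for t
  proof -
    have "c * t \<le> \<bar>c\<bar> * \<bar>t\<bar>" by (metis abs_ge_self abs_mult)
    also have "\<dots> \<le> \<bar>c\<bar> * (M + 1)" using that by (intro mult_left_mono) auto
    finally show ?thesis by simp
  qed
  have B1: "exp (\<bar>c\<bar> * (M + 1)) \<le> B" unfolding B_def using L0 by (simp add: algebra_simps)
  have B2: "\<bar>c * exp (c * t) * s\<bar> \<le> B" if "\<bar>t\<bar> \<le> M + 1" "\<bar>s\<bar> \<le> L" for t s
  proof -
    have "\<bar>c * exp (c * t) * s\<bar> = exp (c * t) * (\<bar>c\<bar> * \<bar>s\<bar>)" by (simp add: abs_mult)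
    also have "\<dots> \<le> exp (\<bar>c\<bar> * (M + 1)) * (1 + \<bar>c\<bar> * L)"
    proof (rule mult_mono[OF expB[OF that(1)]])
      have "\<bar>c\<bar> * \<bar>s\<bar> \<le> \<bar>c\<bar> * L" using that by (intro mult_left_mono) auto
      then show "\<bar>c\<bar> * \<bar>s\<bar> \<le> 1 + \<bar>c\<bar> * L" by linarith
    qed auto
    finally show ?thesis by (simp add: B_def)
  qed
  have qV: "(\<lambda>k. q k x) \<longlonglongrightarrow> V x" for x
  proof -
    have "(\<lambda>k. q k x - V x) \<longlonglongrightarrow> 0"
    proof (rule Lim_null_comparison)
      show "\<forall>\<^sub>F k in sequentially. norm (q k x - V x) \<le> 1 / real (Suc k)" using q(3) by simp
      show "(\<lambda>k. 1 / real (Suc k)) \<longlonglongrightarrow> 0" using LIMSEQ_inverse_real_of_nat by (simp add: inverse_eq_divide)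
    qed
    then show ?thesis by (simp add: LIM_zero_iff)
  qed
  have Vm: "V \<in> borel_measurable torus" by (rule continuous_measurable_torus[OF V(2)])
  have VM: "\<bar>V x\<bar> \<le> M + 1" for x using V(3)[of x] by linarith
  show ?thesis
  proof (rule H1_mult_limit[OF u, where q="\<lambda>k x. exp (c * q k x)" and G="\<lambda>j x. c * exp (c * V x) * G j x" and B=B])
    show "C1 (\<lambda>x. exp (c * q N x))" for N by (rule C1_exp(1)[OF q(1)])
    show "(\<lambda>N. exp (c * q N x)) \<longlonglongrightarrow> exp (c * V x)" for x by (intro tendsto_intros qV)
    show "\<bar>exp (c * q N x)\<bar> \<le> B" for N x using expB[OF qM[of N x]] B1 by (simp only: abs_exp_cancel)
    show "periodic (\<lambda>x. c * exp (c * V x) * G j x)" for j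
      using V(1) G(1) by (simp add: periodic_def)
    show "(\<lambda>x. c * exp (c * V x) * G j x) \<in> borel_measurable torus" for j
      using Vm G(2)[of j] by measurable
    show "AE x in torus. (\<lambda>N. partial j (\<lambda>x. exp (c * q N x)) x) \<longlonglongrightarrow> c * exp (c * V x) * G j x" for j
      using G(4)[of j]
    proof eventually_elim
      case (elim x)
      then show ?case unfolding C1_exp(2)[OF q(1)] by (intro tendsto_intros qV)
    qed
    show "\<bar>partial j (\<lambda>x. exp (c * q N x)) x\<bar> \<le> B" for N j x
      unfolding C1_exp(2)[OF q(1)] by (rule B2[OF qM q(2)])
    show "\<bar>c * exp (c * V x) * G j x\<bar> \<le> B" for j x by (rule B2[OF VM G(3)])
    show "periodic (\<lambda>x. exp (c * V x))" by (rule periodic_compose[OF V(1)])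
    show "(\<lambda>x. exp (c * V x)) \<in> borel_measurable torus" using Vm by measurable
  qed
qed

subsection \<open>The Euler--Lagrange equation\<close>

text \<open>The first-order condition for a minimum. With \<open>s = \<bar>c\<bar> + 1\<close> the
  value at \<open>t = - b / s\<close> is \<open>(b / s)\<^sup>2 * (c - s)\<close>, which is negative
  unless \<open>b = 0\<close>.\<close>

lemma quadratic_nonneg_imp_zero:
  fixes b c :: real
  assumes "\<And>t. 0 \<le> t * b + t\<^sup>2 * c"
  shows "b = 0"
proof (rule ccontr)
  assume b: "b \<noteq> 0"
  define s where "s = \<bar>c\<bar> + 1"
  have s: "s > 0" "c - s < 0" by (auto simp: s_def)
  have "0 \<le> (- (b / s)) * b + (- (b / s))\<^sup>2 * c" by (rule assms)
  also have "\<dots> = (b / s)\<^sup>2 * (c - s)" using s by (simp add: power2_eq_square field_simps)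
  also have "\<dots> < 0" using b s by (intro mult_pos_neg) auto
  finally show False by simp
qed

text \<open>Integrand of the weighted bilinear form. The gradient fields are arguments, so that any
  representative may be inserted, in particular the classical gradient of a test function.\<close>

definition flux_form :: "(real^'n \<Rightarrow> real) \<Rightarrow> (real^'n \<Rightarrow> real^'n^'n) \<Rightarrow> (real^'n \<Rightarrow> real^'n)
    \<Rightarrow> (real^'n \<Rightarrow> real^'n) \<Rightarrow> real^'n \<Rightarrow> real" where
  "flux_form p a g h x = (p x *\<^sub>R (a x *v g x)) \<bullet> h x"

lemma flux_form_expand:
  "flux_form p a g h x = (\<Sum>j\<in>UNIV. \<Sum>k\<in>UNIV. (p x * a x $ j $ k) * (g x $ k * h x $ j))"
  by (simp add: flux_form_def inner_vec_def matrix_vector_mult_def sum_distrib_left sum_distrib_right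
      algebra_simps)

definition admissible_coeff :: "(real^'n \<Rightarrow> real) \<Rightarrow> (real^'n \<Rightarrow> real^'n^'n) \<Rightarrow> bool" where
  "admissible_coeff p a \<longleftrightarrow> periodic p \<and> continuous_on UNIV p \<and> (\<forall>x. p x > 0) \<and>
     (\<forall>j k. periodic (\<lambda>x. a x $ j $ k) \<and> continuous_on UNIV (\<lambda>x. a x $ j $ k)) \<and>
     (\<forall>j k x. a x $ j $ k = a x $ k $ j)"

lemma admissible_coeff_entry:
  assumes "admissible_coeff p a"
  shows "periodic (\<lambda>x. p x * a x $ j $ k)" "continuous_on UNIV (\<lambda>x. p x * a x $ j $ k)"
proof -
  have "periodic p" "continuous_on UNIV p" "periodic (\<lambda>x. a x $ j $ k)" "continuous_on UNIV (\<lambda>x. a x $ j $ k)"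
    using assms by (simp_all add: admissible_coeff_def)
  from periodic_mult[OF this(1,3)] continuous_on_mult[OF this(2,4)]
  show "periodic (\<lambda>x. p x * a x $ j $ k)" "continuous_on UNIV (\<lambda>x. p x * a x $ j $ k)" .
qed

lemma flux_form_integrable:
  assumes "admissible_coeff p a" "\<And>j. (\<lambda>x. g x $ j) \<in> L2" "\<And>j. (\<lambda>x. h x $ j) \<in> L2"
  shows "integrable torus (flux_form p a g h)"
proof -
  have "integrable torus (\<lambda>x. (p x * a x $ j $ k) * (g x $ k * h x $ j))" for j k
    using L2_integrable_mult[OF L2_mult_continuous[OF assms(2) admissible_coeff_entry[OF assms(1)]] assms(3)]
    by (simp add: mult.assoc)
  then show ?thesis unfolding flux_form_expand[abs_def] by (intro Bochner_Integration.integrable_sum)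
qed

lemma flux_form_sym:
  assumes "admissible_coeff p a"
  shows "flux_form p a g h x = flux_form p a h g x"
proof -
  have "a x $ j $ k = a x $ k $ j" for j k using assms by (simp add: admissible_coeff_def)
  then show ?thesis
    unfolding flux_form_expand by (subst sum.swap) (intro sum.cong refl, simp add: mult.commute)
qed

lemma flux_form_quadratic:
  assumes "admissible_coeff p a"
  shows "flux_form p a (\<lambda>x. g x + t *\<^sub>R h x) (\<lambda>x. g x + t *\<^sub>R h x) x
    = flux_form p a g g x + 2 * t * flux_form p a g h x + t\<^sup>2 * flux_form p a h h x"
proof -
  have "flux_form p a (\<lambda>x. g x + t *\<^sub>R h x) (\<lambda>x. g x + t *\<^sub>R h x) x
    = flux_form p a g g x + t * flux_form p a g h x + t * flux_form p a h g x + t\<^sup>2 * flux_form p a h h x"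
    by (simp add: flux_form_def matrix_vector_right_distrib matrix_vector_mult_scaleR inner_add_left inner_add_right
        algebra_simps power2_eq_square)
  then show ?thesis using flux_form_sym[OF assms, of h g x] by (simp add: algebra_simps)
qed

text \<open>Frees the energy from the gradient picked by the choice operator: two weak gradients
  agree almost everywhere, and the form only enters under the integral.\<close>

lemma energy_eq:
  assumes "admissible_coeff p a" "(\<lambda>x. u x / p x) \<in> L2" "is_weak_gradient (\<lambda>x. u x / p x) g"
  shows "energy p a u = 1/2 * (\<integral>x. flux_form p a g g x \<partial>torus)"
proof -
  let ?w = "weak_gradient (\<lambda>x. u x / p x)"
  have w: "is_weak_gradient (\<lambda>x. u x / p x) ?w"
    by (rule weak_gradient_is) (use assms(2,3) in \<open>auto simp: H1_def\<close>)
  have "(\<integral>x. flux_form p a ?w ?w x \<partial>torus) = (\<integral>x. flux_form p a g g x \<partial>torus)"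
  proof (rule integral_cong_AE)
    show "AE x in torus. flux_form p a ?w ?w x = flux_form p a g g x"
      using weak_gradient_AE[OF assms(2,3)] by eventually_elim (simp add: flux_form_def)
  qed (intro borel_measurable_integrable flux_form_integrable assms(1) weak_gradient_L2[OF w] weak_gradient_L2[OF assms(3)])+
  then show ?thesis by (simp add: energy_def flux_form_def)
qed

text \<open>The minimizer is varied in the direction \<open>p * \<phi>\<close>, which changes the
  quotient \<open>m / p\<close> by a multiple of \<phi>. The functional is then a quadratic
  polynomial in \<open>t\<close> whose linear coefficient must vanish, and the weight cancels in the
  zero-order term. The hypotheses \<open>mul\<close> keep the variation inside H^1 and ensure that
  the quotient has a weak gradient.\<close>

lemma euler_lagrange:
  fixes m :: "real^'n \<Rightarrow> real"
  assumes adm: "admissible_coeff p a"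
    and mul: "\<And>u. u \<in> H1 \<Longrightarrow> (\<lambda>x. p x * u x) \<in> H1" "\<And>u. u \<in> H1 \<Longrightarrow> (\<lambda>x. u x / p x) \<in> H1"
    and prev: "prev \<in> L2" and \<tau>: "\<tau> > 0"
    and min: "is_arg_min (\<lambda>\<nu>. energy p a \<nu> + 1 / (2 * \<tau>) * (weighted_dist p \<nu> prev)\<^sup>2) (\<lambda>\<nu>. \<nu> \<in> H1) m"
    and g: "is_weak_gradient (\<lambda>x. m x / p x) g"
    and \<phi>: "\<phi> \<in> L2" "is_weak_gradient \<phi> h"
  shows "(\<integral>x. flux_form p a g h x \<partial>torus) + 1 / \<tau> * (\<integral>x. (m x - prev x) * \<phi> x \<partial>torus) = 0"
proof -
  have p: "periodic p" "continuous_on UNIV p" "\<And>x. p x > 0" using adm by (auto simp: admissible_coeff_def)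
  have pn: "p x \<noteq> 0" for x using p(3)[of x] by simp
  have cp: "periodic (\<lambda>x. 1 / p x)" "continuous_on UNIV (\<lambda>x. 1 / p x)"
    using p pn by (auto intro!: continuous_intros periodic_compose[of p "\<lambda>t. 1 / t"])
  have m: "m \<in> H1" using min by (simp add: is_arg_min_def)
  have mL: "m \<in> L2" using m by (simp add: H1_def)
  have uL: "(\<lambda>x. m x / p x) \<in> L2" using mul(2)[OF m] by (simp add: H1_def)
  have \<phi>H: "\<phi> \<in> H1" using \<phi> by (auto simp: H1_def)
  define J where "J = (\<lambda>\<nu>. energy p a \<nu> + 1 / (2 * \<tau>) * (weighted_dist p \<nu> prev)\<^sup>2)"
  have wd: "(weighted_dist p u v)\<^sup>2 = (\<integral>x. (u x - v x)\<^sup>2 / p x \<partial>torus)" for u v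
  proof -
    have "0 \<le> (\<integral>x. (u x - v x)\<^sup>2 / p x \<partial>torus)"
      by (intro integral_nonneg_AE AE_I2 divide_nonneg_pos p(3)) auto
    then show ?thesis by (simp add: weighted_dist_def)
  qed
  define gg gh hh where "gg = (\<integral>x. flux_form p a g g x \<partial>torus)" and "gh = (\<integral>x. flux_form p a g h x \<partial>torus)"
    and "hh = (\<integral>x. flux_form p a h h x \<partial>torus)"
  define dd d\<phi> \<phi>\<phi> where "dd = (\<integral>x. (m x - prev x)\<^sup>2 / p x \<partial>torus)" and "d\<phi> = (\<integral>x. (m x - prev x) * \<phi> x \<partial>torus)"
    and "\<phi>\<phi> = (\<integral>x. p x * (\<phi> x)\<^sup>2 \<partial>torus)"
  note fi = flux_form_integrable[OF adm]
  have int: "integrable torus (flux_form p a g g)" "integrable torus (flux_form p a g h)" "integrable torus (flux_form p a h h)"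
    by (intro fi weak_gradient_L2[OF g] weak_gradient_L2[OF \<phi>(2)])+
  have dL: "(\<lambda>x. m x - prev x) \<in> L2" by (intro L2_diff mL prev)
  have int2: "integrable torus (\<lambda>x. (m x - prev x)\<^sup>2 / p x)" "integrable torus (\<lambda>x. (m x - prev x) * \<phi> x)"
    "integrable torus (\<lambda>x. p x * (\<phi> x)\<^sup>2)"
  proof -
    show "integrable torus (\<lambda>x. (m x - prev x)\<^sup>2 / p x)"
      using integrable_mult_continuous[OF L2D(3)[OF dL] cp] by simp
    show "integrable torus (\<lambda>x. (m x - prev x) * \<phi> x)" by (rule L2_integrable_mult[OF dL \<phi>(1)])
    show "integrable torus (\<lambda>x. p x * (\<phi> x)\<^sup>2)"
      using integrable_mult_continuous[OF L2D(3)[OF \<phi>(1)] p(1,2)] by (simp add: mult.commute)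
  qed
  have J: "J (\<lambda>x. m x + t * (p x * \<phi> x)) = 1/2 * (gg + 2 * t * gh + t\<^sup>2 * hh) + 1 / (2 * \<tau>) * (dd + 2 * t * d\<phi> + t\<^sup>2 * \<phi>\<phi>)" for t
  proof -
    have eq: "(\<lambda>x. (m x + t * (p x * \<phi> x)) / p x) = (\<lambda>x. m x / p x + t * \<phi> x)"
      using pn by (auto simp: field_simps)
    have "energy p a (\<lambda>x. m x + t * (p x * \<phi> x)) = 1/2 * (\<integral>x. flux_form p a (\<lambda>x. g x + t *\<^sub>R h x) (\<lambda>x. g x + t *\<^sub>R h x) x \<partial>torus)"
    proof (rule energy_eq[OF adm])
      show "(\<lambda>x. (m x + t * (p x * \<phi> x)) / p x) \<in> L2"
        unfolding eq by (intro L2_add uL L2_cmult \<phi>(1))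
      show "is_weak_gradient (\<lambda>x. (m x + t * (p x * \<phi> x)) / p x) (\<lambda>x. g x + t *\<^sub>R h x)"
        unfolding eq by (rule weak_gradient_add[OF uL \<phi>(1) g \<phi>(2)])
    qed
    also have "(\<integral>x. flux_form p a (\<lambda>x. g x + t *\<^sub>R h x) (\<lambda>x. g x + t *\<^sub>R h x) x \<partial>torus) = gg + 2 * t * gh + t\<^sup>2 * hh"
      unfolding flux_form_quadratic[OF adm] gg_def gh_def hh_def using int by simp
    finally have e: "energy p a (\<lambda>x. m x + t * (p x * \<phi> x)) = 1/2 * (gg + 2 * t * gh + t\<^sup>2 * hh)" .
    have "(weighted_dist p (\<lambda>x. m x + t * (p x * \<phi> x)) prev)\<^sup>2
       = (\<integral>x. (m x - prev x)\<^sup>2 / p x + 2 * t * ((m x - prev x) * \<phi> x) + t\<^sup>2 * (p x * (\<phi> x)\<^sup>2) \<partial>torus)"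
      unfolding wd
    proof (intro Bochner_Integration.integral_cong refl)
      fix x
      have "(m x + t * (p x * \<phi> x) - prev x)\<^sup>2 = (m x - prev x)\<^sup>2 + p x * (2 * t * ((m x - prev x) * \<phi> x)) + p x * (t\<^sup>2 * (p x * (\<phi> x)\<^sup>2))"
        by (simp add: power2_eq_square algebra_simps)
      then show "(m x + t * (p x * \<phi> x) - prev x)\<^sup>2 / p x
        = (m x - prev x)\<^sup>2 / p x + 2 * t * ((m x - prev x) * \<phi> x) + t\<^sup>2 * (p x * (\<phi> x)\<^sup>2)"
        using pn[of x] by (simp add: add_divide_distrib)
    qed
    also have "\<dots> = dd + 2 * t * d\<phi> + t\<^sup>2 * \<phi>\<phi>"
      unfolding dd_def d\<phi>_def \<phi>\<phi>_def using int2 by simp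
    finally show ?thesis unfolding J_def e by simp
  qed
  have "J m = J (\<lambda>x. m x + 0 * (p x * \<phi> x))" by simp
  also have "\<dots> = 1/2 * gg + 1 / (2 * \<tau>) * dd" unfolding J by simp
  finally have Jm: "J m = 1/2 * gg + 1 / (2 * \<tau>) * dd" .
  have "0 \<le> t * (gh + 1 / \<tau> * d\<phi>) + t\<^sup>2 * (1/2 * hh + 1 / (2 * \<tau>) * \<phi>\<phi>)" for t
  proof -
    have "(\<lambda>x. m x + t * (p x * \<phi> x)) \<in> H1" by (intro H1_add m mul(1) \<phi>H)
    then have "\<not> J (\<lambda>x. m x + t * (p x * \<phi> x)) < J m"
      using min unfolding is_arg_min_def J_def by blast
    then have "0 \<le> J (\<lambda>x. m x + t * (p x * \<phi> x)) - J m" by simp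
    also have "\<dots> = t * (gh + 1 / \<tau> * d\<phi>) + t\<^sup>2 * (1/2 * hh + 1 / (2 * \<tau>) * \<phi>\<phi>)"
      unfolding J Jm using \<tau> by (simp add: field_simps)
    finally show ?thesis .
  qed
  then have "gh + 1 / \<tau> * d\<phi> = 0" by (rule quadratic_nonneg_imp_zero)
  then show ?thesis by (simp add: gh_def d\<phi>_def)
qed

subsection \<open>The cell problem\<close>

lemma Ck_2_C1:
  assumes "periodic f" "Ck 2 f"
  shows "C1 f" "C1 (partial j f)"
proof -
  have d: "f differentiable (at x)" and p: "Ck 1 (partial j f)" for x j
    using assms(2) by (simp_all add: numeral_2_eq_2)
  have c: "C1 (partial j f)" for j unfolding C1_iff_Ck using p periodic_partial[OF assms(1)] by blast
  then show "C1 (partial j f)" .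
  show "C1 f" unfolding C1_def using assms(1) d C1_continuous[OF c] by blast
qed

lemma C1_shift:
  assumes "C1 f"
  shows "C1 (\<lambda>x. f (x + v))" "partial j (\<lambda>x. f (x + v)) x = partial j f (x + v)"
proof -
  have d: "f differentiable (at x)" for x by (rule C1_simps(1)[OF assms])
  have p: "partial j (\<lambda>x. f (x + v)) = (\<lambda>x. partial j f (x + v))" for j
    by (rule ext) (rule partial_shift(2)[OF d])
  then show "partial j (\<lambda>x. f (x + v)) x = partial j f (x + v)" by simp
  show "C1 (\<lambda>x. f (x + v))"
    unfolding C1_def p using partial_shift(1)[OF d] periodic_shift[OF C1_simps(3)[OF assms]]
      continuous_shift[OF C1_simps(2)[OF assms]] by blast
qed

lemma C1_scale:
  assumes "C1 f" "periodic (\<lambda>x. f (x /\<^sub>R \<epsilon>))"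
  shows "C1 (\<lambda>x. f (x /\<^sub>R \<epsilon>))" "partial j (\<lambda>x. f (x /\<^sub>R \<epsilon>)) x = inverse \<epsilon> * partial j f (x /\<^sub>R \<epsilon>)"
proof -
  have d: "f differentiable (at x)" for x by (rule C1_simps(1)[OF assms(1)])
  have p: "partial j (\<lambda>x. f (x /\<^sub>R \<epsilon>)) = (\<lambda>x. inverse \<epsilon> * partial j f (x /\<^sub>R \<epsilon>))" for j
    by (rule ext) (rule partial_scale(2)[OF d])
  then show "partial j (\<lambda>x. f (x /\<^sub>R \<epsilon>)) x = inverse \<epsilon> * partial j f (x /\<^sub>R \<epsilon>)" by simp
  have "continuous_on UNIV (\<lambda>x. partial j f (x /\<^sub>R \<epsilon>))" for j
    by (rule continuous_on_compose2[OF C1_simps(2)[OF assms(1)]]) (auto intro!: continuous_intros)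
  then have "continuous_on UNIV (\<lambda>x. inverse \<epsilon> * partial j f (x /\<^sub>R \<epsilon>))" for j
    by (intro continuous_on_mult continuous_on_const)
  then show "C1 (\<lambda>x. f (x /\<^sub>R \<epsilon>))"
    unfolding C1_def p using partial_scale(1)[OF d] assms(2) by blast
qed

locale cell_problem =
  fixes A :: "real^'n \<Rightarrow> real^'n^'n" and cor :: "'n \<Rightarrow> real^'n \<Rightarrow> real" and \<Lambda>0 :: real
  assumes A_periodic: "periodic A" and A_C2: "\<And>j k. Ck 2 (\<lambda>x. A x $ j $ k)"
    and \<Lambda>0_pos: "\<Lambda>0 > 0" and elliptic: "\<And>x v. \<Lambda>0 * (v \<bullet> v) \<le> v \<bullet> (A x *v v)"
    and symmetric: "\<And>x j k. A x $ j $ k = A x $ k $ j"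
    and corrector: "cell_solution A cor"
begin

lemma entry_C1: "C1 (\<lambda>x. A x $ j $ k)"
  by (rule Ck_2_C1(1)[OF periodic_compose[OF A_periodic] A_C2])

lemma corrector_C1: "C1 (cor k)" "C1 (partial l (cor k))"
  using Ck_2_C1[of "cor k"] corrector by (auto simp: cell_solution_def)

text \<open>Component \<open>j\<close> of \<open>A (e\<^sub>k + \<nabla>\<chi>\<^sub>k)\<close>.\<close>

definition flux :: "'n \<Rightarrow> 'n \<Rightarrow> real^'n \<Rightarrow> real" where
  "flux k j x = A x $ j $ k + (\<Sum>l\<in>UNIV. A x $ j $ l * partial l (cor k) x)"

lemma flux_C1: "C1 (flux k j)"
  unfolding flux_def by (intro C1_add C1_sum C1_mult entry_C1 corrector_C1)

text \<open>This is the cell equation: both of its sides are collected into the divergence of one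
  C^1 vector field.\<close>

lemma flux_divergence: "(\<Sum>j\<in>UNIV. partial j (flux k j) x) = 0"
proof -
  have c: "C1 (\<lambda>x. A x $ j $ l * partial l (cor k) x)" for j l
    by (intro C1_mult entry_C1 corrector_C1)
  have cs: "C1 (\<lambda>x. \<Sum>l\<in>UNIV. A x $ j $ l * partial l (cor k) x)" for j
    by (rule C1_sum[OF c])
  have "partial j (flux k j) x = partial j (\<lambda>x. A x $ j $ k) x + (\<Sum>l\<in>UNIV. partial j (\<lambda>x. A x $ j $ l * partial l (cor k) x) x)" for j
    unfolding flux_def partial_sum[OF C1_simps(1)[OF c], symmetric]
    by (rule partial_add[OF C1_simps(1)[OF entry_C1] C1_simps(1)[OF cs]])
  then have "(\<Sum>j\<in>UNIV. partial j (flux k j) x) = (\<Sum>j\<in>UNIV. partial j (\<lambda>x. A x $ j $ k) x)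
     + (\<Sum>j\<in>UNIV. \<Sum>l\<in>UNIV. partial j (\<lambda>x. A x $ j $ l * partial l (cor k) x) x)"
    by (simp add: sum.distrib)
  moreover have "- (\<Sum>j\<in>UNIV. \<Sum>l\<in>UNIV. partial j (\<lambda>y. A y $ j $ l * partial l (cor k) y) x)
              = (\<Sum>j\<in>UNIV. partial j (\<lambda>y. A y $ j $ k) x)"
    using corrector by (simp add: cell_solution_def)
  ultimately show ?thesis by simp
qed

lemma divergence_free_orthogonal:
  assumes "\<And>j. C1 (F j)" "\<And>x. (\<Sum>j\<in>UNIV. partial j (F j) x) = 0" "C1 \<psi>"
  shows "(\<integral>x. (\<Sum>j\<in>UNIV. F j x * partial j \<psi> x) \<partial>torus) = 0"
proof -
  have "(\<integral>x. (\<Sum>j\<in>UNIV. F j x * partial j \<psi> x) \<partial>torus) = (\<Sum>j\<in>UNIV. \<integral>x. F j x * partial j \<psi> x \<partial>torus)"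
    by (intro Bochner_Integration.integral_sum L2_integrable_mult L2_C1 assms)
  also have "\<dots> = (\<Sum>j\<in>UNIV. - (\<integral>x. partial j (F j) x * \<psi> x \<partial>torus))"
    by (intro sum.cong refl integral_by_parts assms)
  also have "\<dots> = - (\<Sum>j\<in>UNIV. (\<integral>x. partial j (F j) x * \<psi> x \<partial>torus))"
    by (rule sum_negf)
  also have "(\<Sum>j\<in>UNIV. (\<integral>x. partial j (F j) x * \<psi> x \<partial>torus)) = (\<integral>x. (\<Sum>j\<in>UNIV. partial j (F j) x * \<psi> x) \<partial>torus)"
    by (intro Bochner_Integration.integral_sum[symmetric] L2_integrable_mult L2_C1 assms)
  also have "\<dots> = 0" by (simp add: assms(2) flip: sum_distrib_right)
  finally show ?thesis by simp
qed

lemma effective_matrix_flux: "effective_matrix A cor $ j $ k = (\<integral>x. flux k j x \<partial>torus)"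
  by (simp add: effective_matrix_def flux_def)

text \<open>The flux is divergence free, so its pairing with the gradient of \<open>cor j\<close>
  integrates to zero and may be added. This turns the entry into the energy form of
  \<open>e_j + grad cor j\<close> and \<open>e_k + grad cor k\<close>, which is symmetric because
  \<open>A\<close> is. Symmetry is what the Euler-Lagrange equation of the limit problem requires of
  its coefficient.\<close>

lemma effective_matrix_symmetric: "effective_matrix A cor $ j $ k = effective_matrix A cor $ k $ j"
proof -
  define D where "D = (\<lambda>k l x. (if l = k then 1 else 0) + partial l (cor k) x)"
  have fluxD: "flux k i x = (\<Sum>l\<in>UNIV. A x $ i $ l * D k l x)" for k i x
    by (simp add: flux_def D_def distrib_left sum.distrib if_distrib[of "\<lambda>t. _ * t"] cong: if_cong)
  have "(\<integral>x. flux k j x \<partial>torus) = (\<integral>x. (\<Sum>i\<in>UNIV. \<Sum>l\<in>UNIV. D j i x * A x $ i $ l * D k l x) \<partial>torus)" for j k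
  proof -
    have "(\<integral>x. flux k j x \<partial>torus) = (\<integral>x. flux k j x \<partial>torus) + (\<integral>x. (\<Sum>i\<in>UNIV. flux k i x * partial i (cor j) x) \<partial>torus)"
      using divergence_free_orthogonal[OF flux_C1 flux_divergence corrector_C1(1)] by simp
    also have "\<dots> = (\<integral>x. flux k j x + (\<Sum>i\<in>UNIV. flux k i x * partial i (cor j) x) \<partial>torus)"
      by (intro Bochner_Integration.integral_add[symmetric] Bochner_Integration.integrable_sum L2_integrable_mult
          L2_integrable L2_C1 flux_C1 corrector_C1)
    also have "\<dots> = (\<integral>x. (\<Sum>i\<in>UNIV. flux k i x * D j i x) \<partial>torus)"
      by (simp add: D_def distrib_left sum.distrib if_distrib[of "\<lambda>t. _ * t"] cong: if_cong)
    also have "\<dots> = (\<integral>x. (\<Sum>i\<in>UNIV. \<Sum>l\<in>UNIV. D j i x * A x $ i $ l * D k l x) \<partial>torus)"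
      unfolding fluxD by (intro Bochner_Integration.integral_cong refl sum.cong) (simp add: sum_distrib_right sum_distrib_left algebra_simps)
    finally show ?thesis .
  qed
  moreover have "(\<Sum>i\<in>UNIV. \<Sum>l\<in>UNIV. D j i x * A x $ i $ l * D k l x) = (\<Sum>i\<in>UNIV. \<Sum>l\<in>UNIV. D k i x * A x $ i $ l * D j l x)" for x
  proof -
    have "(\<Sum>i\<in>UNIV. \<Sum>l\<in>UNIV. D j i x * A x $ i $ l * D k l x) = (\<Sum>i\<in>UNIV. \<Sum>l\<in>UNIV. D k l x * A x $ l $ i * D j i x)"
      using symmetric[of x] by (intro sum.cong refl) simp
    also have "\<dots> = (\<Sum>l\<in>UNIV. \<Sum>i\<in>UNIV. D k l x * A x $ l $ i * D j i x)"
      by (rule sum.swap)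
    finally show ?thesis .
  qed
  ultimately show ?thesis by (simp add: effective_matrix_flux)
qed

text \<open>
  The scales in \<^term>\<open>admissible_scales A\<close> are those for which \<open>e\<^sub>j / \<epsilon>\<close> is a period of \<open>A\<close>, which
  need not be an integer vector; uniqueness for the cell problem makes it a period of the correctors.
\<close>

lemma corrector_period:
  assumes v: "\<And>x. A (x + v) = A x"
  shows "cor k (x + v) = cor k x"
proof -
  \<comment> \<open>Since \<open>A\<close> is invariant under \<open>v\<close>, the terms without
    corrector cancel in the difference of the two fluxes, and \<psi> solves the homogeneous
    equation. Testing with \<psi> itself and ellipticity make its gradient vanish.\<close>
  define \<psi> where "\<psi> = (\<lambda>x. cor k (x + v) - cor k x)"
  have \<psi>C: "C1 \<psi>" unfolding \<psi>_def by (intro C1_diff C1_shift corrector_C1)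
  have p\<psi>: "partial l \<psi> x = partial l (cor k) (x + v) - partial l (cor k) x" for l x
    unfolding \<psi>_def using partial_diff[OF C1_simps(1)[OF C1_shift(1)[OF corrector_C1(1)]] C1_simps(1)[OF corrector_C1(1)]]
      C1_shift(2)[OF corrector_C1(1)] by simp
  define F where "F = (\<lambda>j x. flux k j (x + v) - flux k j x)"
  have FC: "C1 (F j)" for j unfolding F_def by (intro C1_diff C1_shift flux_C1)
  have pF: "partial j (F j) x = partial j (flux k j) (x + v) - partial j (flux k j) x" for j x
    unfolding F_def using partial_diff[OF C1_simps(1)[OF C1_shift(1)[OF flux_C1]] C1_simps(1)[OF flux_C1]]
      C1_shift(2)[OF flux_C1] by simp
  have divF: "(\<Sum>j\<in>UNIV. partial j (F j) x) = 0" for x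
    unfolding pF sum_subtractf by (simp add: flux_divergence)
  have F\<psi>: "F j x = (\<Sum>l\<in>UNIV. A x $ j $ l * partial l \<psi> x)" for j x
    unfolding F_def flux_def v p\<psi> by (simp add: right_diff_distrib sum_subtractf)
  have quad: "(\<Sum>j\<in>UNIV. F j x * partial j \<psi> x) = gradient \<psi> x \<bullet> (A x *v gradient \<psi> x)" for x
    unfolding F\<psi> by (simp add: inner_vec_def matrix_vector_mult_def gradient_def mult.commute)
  define S where "S = (\<lambda>x. \<Sum>j\<in>UNIV. (partial j \<psi> x)\<^sup>2)"
  have S: "\<Lambda>0 * S x \<le> (\<Sum>j\<in>UNIV. F j x * partial j \<psi> x)" for x
    using elliptic[of "gradient \<psi> x" x] unfolding quad by (simp add: S_def inner_vec_def gradient_def power2_eq_square)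
  have Sc: "continuous_on UNIV S" unfolding S_def by (intro continuous_intros C1_simps(2)[OF \<psi>C])
  have "(\<integral>x. \<Lambda>0 * S x \<partial>torus) \<le> (\<integral>x. (\<Sum>j\<in>UNIV. F j x * partial j \<psi> x) \<partial>torus)"
    by (intro integral_mono S integrable_torus_continuous continuous_intros Sc C1_continuous[OF FC] C1_simps(2)[OF \<psi>C])
  also have "\<dots> = 0" by (rule divergence_free_orthogonal[OF FC divF \<psi>C])
  finally have "(\<integral>x. S x \<partial>torus) \<le> 0" using \<Lambda>0_pos by (simp add: mult_le_0_iff)
  moreover have S0: "S x \<ge> 0" for x unfolding S_def by (intro sum_nonneg) auto
  ultimately have "(\<integral>x. S x \<partial>torus) = 0"
    by (intro antisym integral_nonneg_AE AE_I2 S0)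
  moreover have "periodic S" unfolding S_def
    by (intro periodic_sum periodic_compose[of _ "\<lambda>t. t\<^sup>2"] C1_simps(4)[OF \<psi>C])
  ultimately have "S x = 0" for x using integral_zero_imp_zero[OF _ Sc S0] by blast
  then have p0: "partial j \<psi> x = 0" for j x
    unfolding S_def by (subst (asm) sum_nonneg_eq_0_iff) auto
  have "(\<psi> has_derivative (\<lambda>h. 0)) (at x within UNIV)" for x
    using has_derivative_partial[OF C1_simps(1)[OF \<psi>C], of x] p0 by simp
  then obtain c where c: "\<And>x. \<psi> x = c"
    using has_derivative_zero_constant[of UNIV \<psi>] by auto
  \<comment> \<open>The corrector is so far known to be periodic up to the additive constant
    \<open>c\<close>; a nonzero \<open>c\<close> would accumulate under repeated shifts and
    contradict boundedness.\<close>
  have iter: "cor k (real n *\<^sub>R v + x) = cor k x + real n * c" for n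
  proof (induction n)
    case (Suc n)
    have "cor k (real (Suc n) *\<^sub>R v + x) = cor k ((real n *\<^sub>R v + x) + v)" by (simp add: algebra_simps)
    also have "\<dots> = cor k (real n *\<^sub>R v + x) + c" using c[of "real n *\<^sub>R v + x"] by (simp add: \<psi>_def)
    finally show ?case using Suc by (simp add: algebra_simps)
  qed simp
  obtain B where B: "\<And>x. \<bar>cor k x\<bar> \<le> B"
    using periodic_bounded[OF C1_simps(3)[OF corrector_C1(1)] C1_continuous[OF corrector_C1(1)]] by blast
  have "c = 0"
  proof (rule ccontr)
    assume "c \<noteq> 0"
    then obtain n :: nat where "2 * B < real n * \<bar>c\<bar>" using reals_Archimedean3[of "\<bar>c\<bar>"] by auto
    moreover have "real n * \<bar>c\<bar> = \<bar>cor k (real n *\<^sub>R v + x) - cor k x\<bar>"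
      unfolding iter by (simp add: abs_mult)
    moreover have "\<bar>cor k (real n *\<^sub>R v + x) - cor k x\<bar> \<le> 2 * B"
      using B[of "real n *\<^sub>R v + x"] B[of x] by linarith
    ultimately show False by linarith
  qed
  then show ?thesis using c[of x] by (simp add: \<psi>_def)
qed

context
  fixes \<epsilon> :: real
  assumes \<epsilon>: "\<epsilon> \<in> admissible_scales A"
begin

lemma \<epsilon>_pos: "\<epsilon> > 0"
  using \<epsilon> by (simp add: admissible_scales_def)

lemma A_scaled_period: "A (x + axis i 1 /\<^sub>R \<epsilon>) = A x"
proof -
  have "A ((\<epsilon> *\<^sub>R x + axis i 1) /\<^sub>R \<epsilon>) = A ((\<epsilon> *\<^sub>R x) /\<^sub>R \<epsilon>)"
    using \<epsilon> by (simp add: admissible_scales_def periodic_def)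
  then show ?thesis using \<epsilon>_pos by (simp add: scaleR_add_right)
qed

lemma A_scaled_periodic: "periodic (\<lambda>x. A (x /\<^sub>R \<epsilon>))"
  using \<epsilon> by (simp add: admissible_scales_def)

lemma corrector_scaled: "periodic (\<lambda>x. cor k (x /\<^sub>R \<epsilon>))"
  unfolding periodic_def scaleR_add_right using corrector_period[OF A_scaled_period] by blast

lemma flux_scaled: "periodic (\<lambda>x. flux k j (x /\<^sub>R \<epsilon>))"
proof -
  have "flux k j (x + axis i 1 /\<^sub>R \<epsilon>) = flux k j x" for x i
  proof -
    have "(\<lambda>x. cor k (x + axis i 1 /\<^sub>R \<epsilon>)) = cor k"
      by (rule ext) (rule corrector_period[OF A_scaled_period])
    then have "partial l (cor k) (x + axis i 1 /\<^sub>R \<epsilon>) = partial l (cor k) x" for l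
      using C1_shift(2)[OF corrector_C1(1), of l k "axis i 1 /\<^sub>R \<epsilon>" x] by simp
    then show ?thesis by (simp add: flux_def A_scaled_period)
  qed
  then show ?thesis unfolding periodic_def scaleR_add_right by blast
qed

end

end

subsection \<open>Consistency of the two-scale expansion\<close>

text \<open>A sum norm equivalent to the usual H^1 norm; each component is directly below it in
  estimates of residuals. The comparison with the Hilbert norm later costs the factor
  \<open>CARD('n) + 1\<close>.\<close>

definition sob_norm :: "(real^'n \<Rightarrow> real) \<Rightarrow> (real^'n \<Rightarrow> real^'n) \<Rightarrow> real" where
  "sob_norm u g = L2_norm u + (\<Sum>j\<in>UNIV. L2_norm (\<lambda>x. g x $ j))"

lemma sob_norm_ge: "L2_norm u \<le> sob_norm u g" "L2_norm (\<lambda>x. g x $ j) \<le> sob_norm u g" "0 \<le> sob_norm u g"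
proof -
  have "L2_norm (\<lambda>x. g x $ j) \<le> (\<Sum>j\<in>UNIV. L2_norm (\<lambda>x. g x $ j))" by (rule member_le_sum) auto
  moreover have "0 \<le> (\<Sum>j\<in>UNIV. L2_norm (\<lambda>x. g x $ j))" by (intro sum_nonneg) auto
  ultimately show "L2_norm u \<le> sob_norm u g" "L2_norm (\<lambda>x. g x $ j) \<le> sob_norm u g" "0 \<le> sob_norm u g"
    unfolding sob_norm_def using L2_norm_nonneg[of u] L2_norm_nonneg[of "\<lambda>x. g x $ j"] by linarith+
qed

lemma integral_mult_bounded_le:
  fixes b :: "real^'n \<Rightarrow> real"
  assumes "f \<in> L2" "periodic b" "b \<in> borel_measurable torus" "\<And>x. \<bar>b x\<bar> \<le> B"
  shows "\<bar>\<integral>x. b x * f x \<partial>torus\<bar> \<le> B * L2_norm f"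
proof -
  have "\<bar>\<integral>x. b x * f x \<partial>torus\<bar> \<le> L2_norm b * L2_norm f"
    by (intro L2_Cauchy_Schwarz assms(1) L2_bounded[OF assms(2-4)])
  also have "\<dots> \<le> B * L2_norm f"
    by (intro mult_right_mono L2_norm_bounded assms(3,4)) auto
  finally show ?thesis .
qed

lemma integral_abs_mult_bounded_le:
  fixes b :: "real^'n \<Rightarrow> real"
  assumes "f \<in> L2" "periodic b" "continuous_on UNIV b" "\<And>x. \<bar>b x\<bar> \<le> B"
  shows "(\<integral>x. \<bar>b x * f x\<bar> \<partial>torus) \<le> B * L2_norm f"
proof -
  have a: "(\<lambda>x. \<bar>f x\<bar>) \<in> L2" using assms(1) by (auto simp: L2_def periodic_def)
  have "(\<integral>x. \<bar>b x * f x\<bar> \<partial>torus) = (\<integral>x. \<bar>b x\<bar> * \<bar>f x\<bar> \<partial>torus)" by (simp add: abs_mult)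
  also have "\<dots> \<le> \<bar>\<dots>\<bar>" by simp
  also have "\<dots> \<le> B * L2_norm (\<lambda>x. \<bar>f x\<bar>)"
    by (rule integral_mult_bounded_le[OF a])
       (use assms in \<open>auto simp: periodic_def intro!: continuous_measurable_torus continuous_intros\<close>)
  also have "L2_norm (\<lambda>x. \<bar>f x\<bar>) = L2_norm f" by (simp add: L2_norm_def)
  finally show ?thesis .
qed

text \<open>The product rule and the Cauchy-Schwarz inequality bound the L^1 norm of the gradient of
  \<open>h * \<phi>\<close> by the H^1 norm of \<phi>. The order of quantifiers matters:
  \<open>C\<close> depends on \<open>g\<close> and \<open>h\<close> alone, and is uniform in the
  scale and in \<phi>.\<close>

lemma oscillating_pairing_bound:
  fixes g h :: "real^'n \<Rightarrow> real"
  assumes g: "periodic g" "continuous_on UNIV g" "(\<integral>x. g x \<partial>torus) = 0" and h: "trig_poly h"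
  shows "\<exists>C\<ge>0. \<forall>\<epsilon> \<phi>. \<epsilon> > 0 \<longrightarrow> periodic (\<lambda>x. g (x /\<^sub>R \<epsilon>)) \<longrightarrow> trig_poly \<phi> \<longrightarrow>
    \<bar>\<integral>x. g (x /\<^sub>R \<epsilon>) * (h x * \<phi> x) \<partial>torus\<bar> \<le> C * \<epsilon> * sob_norm \<phi> (gradient \<phi>)"
proof -
  obtain M where M: "M > 0" "\<And>x. \<bar>g x\<bar> \<le> M" using periodic_bounded[OF g(1,2)] by blast
  note hc = trig_poly_periodic[OF h] trig_poly_continuous[OF h]
  have pc: "periodic (partial j h)" "continuous_on UNIV (partial j h)" for j
    by (rule trig_poly_periodic[OF trig_poly_partial[OF h]], rule trig_poly_continuous[OF trig_poly_partial[OF h]])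
  obtain B0 where B0: "B0 > 0" "\<And>x. \<bar>h x\<bar> \<le> B0" using periodic_bounded[OF hc] by blast
  have "\<exists>B>0. \<forall>x. \<bar>partial j h x\<bar> \<le> B" for j using periodic_bounded[OF pc] by metis
  then obtain B1 where B1: "\<And>j. B1 j > 0" "\<And>j x. \<bar>partial j h x\<bar> \<le> B1 j" by metis
  define C where "C = M * (\<Sum>j\<in>(UNIV::'n set). B0 + B1 j)"
  have C0: "C \<ge> 0" unfolding C_def using M B0 B1 by (intro mult_nonneg_nonneg sum_nonneg) (auto intro!: add_nonneg_nonneg intro: less_imp_le)
  show ?thesis
  proof (intro exI[of _ C] conjI C0 allI impI)
    fix \<epsilon> :: real and \<phi> :: "real^'n \<Rightarrow> real"
    assume \<epsilon>: "\<epsilon> > 0" "periodic (\<lambda>x. g (x /\<^sub>R \<epsilon>))" and \<phi>: "trig_poly \<phi>"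
    let ?N = "sob_norm \<phi> (gradient \<phi>)"
    have L: "\<phi> \<in> L2" "partial j \<phi> \<in> L2" for j by (rule L2_trig[OF \<phi>], rule L2_trig[OF trig_poly_partial[OF \<phi>]])
    have "(\<integral>x. \<bar>partial j (\<lambda>x. h x * \<phi> x) x\<bar> \<partial>torus) \<le> (B0 + B1 j) * ?N" for j
    proof -
      have p: "partial j (\<lambda>x. h x * \<phi> x) x = h x * partial j \<phi> x + partial j h x * \<phi> x" for x
        by (rule partial_mult[OF C1_simps(1)[OF trig_poly_C1[OF h]] C1_simps(1)[OF trig_poly_C1[OF \<phi>]]])
      have i: "integrable torus (\<lambda>x. \<bar>h x * partial j \<phi> x\<bar>)" "integrable torus (\<lambda>x. \<bar>partial j h x * \<phi> x\<bar>)"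
        by (intro integrable_torus_continuous continuous_intros hc pc trig_poly_continuous \<phi> trig_poly_partial)+
      have "(\<integral>x. \<bar>partial j (\<lambda>x. h x * \<phi> x) x\<bar> \<partial>torus) \<le> (\<integral>x. \<bar>h x * partial j \<phi> x\<bar> + \<bar>partial j h x * \<phi> x\<bar> \<partial>torus)"
        unfolding p
        by (intro integral_mono abs_triangle_ineq Bochner_Integration.integrable_add i
            integrable_torus_continuous continuous_intros hc pc trig_poly_continuous \<phi> trig_poly_partial)
      also have "\<dots> = (\<integral>x. \<bar>h x * partial j \<phi> x\<bar> \<partial>torus) + (\<integral>x. \<bar>partial j h x * \<phi> x\<bar> \<partial>torus)"
        by (rule Bochner_Integration.integral_add[OF i])
      also have "\<dots> \<le> B0 * L2_norm (partial j \<phi>) + B1 j * L2_norm \<phi>"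
        by (intro add_mono integral_abs_mult_bounded_le L hc pc B0 B1)
      also have "\<dots> \<le> B0 * ?N + B1 j * ?N"
        using sob_norm_ge(1)[of \<phi> "gradient \<phi>"] sob_norm_ge(2)[of "gradient \<phi>" j \<phi>] B0(1) B1(1)[of j]
        by (intro add_mono mult_left_mono) (auto simp: gradient_def)
      finally show ?thesis by (simp add: distrib_right)
    qed
    then have "(\<Sum>j\<in>UNIV. \<integral>x. \<bar>partial j (\<lambda>x. h x * \<phi> x) x\<bar> \<partial>torus) \<le> (\<Sum>j\<in>UNIV. (B0 + B1 j) * ?N)"
      by (rule sum_mono)
    then have "\<epsilon> * M * (\<Sum>j\<in>UNIV. \<integral>x. \<bar>partial j (\<lambda>x. h x * \<phi> x) x\<bar> \<partial>torus) \<le> \<epsilon> * M * (\<Sum>j\<in>UNIV. (B0 + B1 j) * ?N)"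
      using \<epsilon> M by (intro mult_left_mono) auto
    also have "\<dots> = C * \<epsilon> * ?N" by (simp add: C_def sum_distrib_right[symmetric])
    finally show "\<bar>\<integral>x. g (x /\<^sub>R \<epsilon>) * (h x * \<phi> x) \<partial>torus\<bar> \<le> C * \<epsilon> * ?N"
      using oscillating_integral_bound[OF g(1,2) M(2) g(3) \<epsilon> trig_poly_C1[OF trig_poly.mult[OF h \<phi>]]] by linarith
  qed
qed

lemma periodic_bounded_family:
  fixes f :: "'i \<Rightarrow> real^'n \<Rightarrow> real"
  assumes "\<And>i. periodic (f i)" "\<And>i. continuous_on UNIV (f i)"
  obtains B where "\<And>i. B i > 0" "\<And>i x. \<bar>f i x\<bar> \<le> B i"
proof -
  have "\<exists>B>0. \<forall>x. \<bar>f i x\<bar> \<le> B" for i using periodic_bounded[OF assms] by metis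
  then show thesis using that by metis
qed

lemma gradient_nth [simp]: "gradient f x $ j = partial j f x"
  by (simp add: gradient_def)

lemma continuous_scaled:
  fixes f :: "real^'n \<Rightarrow> real"
  shows "continuous_on UNIV f \<Longrightarrow> continuous_on UNIV (\<lambda>x. f (x /\<^sub>R \<epsilon>))"
  by (rule continuous_on_compose2[where t=UNIV]) (auto intro!: continuous_intros)

context cell_problem
begin

definition two_scale :: "real \<Rightarrow> (real^'n \<Rightarrow> real) \<Rightarrow> real^'n \<Rightarrow> real" where
  "two_scale \<epsilon> w x = w x + \<epsilon> * (\<Sum>k\<in>UNIV. cor k (x /\<^sub>R \<epsilon>) * partial k w x)"

definition fluctuation :: "'n \<Rightarrow> 'n \<Rightarrow> real^'n \<Rightarrow> real" where
  "fluctuation k j x = flux k j x - effective_matrix A cor $ j $ k"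

text \<open>The flux produced when the gradient falls on the slow factor \<open>partial k w\<close>
  of the correction term. It stays bounded as \<epsilon> tends to 0, and it appears with a factor
  \<epsilon>.\<close>

definition remainder :: "real \<Rightarrow> (real^'n \<Rightarrow> real) \<Rightarrow> 'n \<Rightarrow> real^'n \<Rightarrow> real" where
  "remainder \<epsilon> w j x = (\<Sum>l\<in>UNIV. A (x /\<^sub>R \<epsilon>) $ j $ l * (\<Sum>k\<in>UNIV. cor k (x /\<^sub>R \<epsilon>) * partial l (partial k w) x))"

lemma fluctuation_C1: "C1 (fluctuation k j)"
  unfolding fluctuation_def by (intro C1_diff flux_C1 C1_const)

lemma integral_fluctuation: "(\<integral>x. fluctuation k j x \<partial>torus) = 0"
  unfolding fluctuation_def using L2_integrable[OF L2_C1(1)[OF flux_C1]]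
  by (simp add: effective_matrix_flux)

lemma fluctuation_divergence: "(\<Sum>j\<in>UNIV. partial j (fluctuation k j) x) = 0"
proof -
  have "partial j (fluctuation k j) x = partial j (flux k j) x" for j
    unfolding fluctuation_def using partial_diff[OF C1_simps(1)[OF flux_C1] C1_simps(1)[OF C1_const]] by simp
  then show ?thesis using flux_divergence by simp
qed

context
  fixes \<epsilon> :: real and w :: "real^'n \<Rightarrow> real"
  assumes \<epsilon>: "\<epsilon> \<in> admissible_scales A" and w: "trig_poly w"
begin

lemma fluctuation_scaled: "periodic (\<lambda>x. fluctuation k j (x /\<^sub>R \<epsilon>))"
  unfolding fluctuation_def by (intro periodic_diff flux_scaled[OF \<epsilon>] periodic_const)

lemma corrector_scaled_C1: "C1 (\<lambda>x. cor k (x /\<^sub>R \<epsilon>))"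
  by (rule C1_scale(1)[OF corrector_C1(1) corrector_scaled[OF \<epsilon>]])

lemma partial_w_C1: "C1 (partial k w)"
  by (rule trig_poly_C1[OF trig_poly_partial[OF w]])

lemma two_scale_C1: "C1 (two_scale \<epsilon> w)"
  unfolding two_scale_def by (intro C1_add C1_cmult C1_sum C1_mult corrector_scaled_C1 partial_w_C1 trig_poly_C1[OF w])

lemma partial_two_scale:
  "partial l (two_scale \<epsilon> w) x = partial l w x + (\<Sum>k\<in>UNIV. partial l (cor k) (x /\<^sub>R \<epsilon>) * partial k w x)
     + \<epsilon> * (\<Sum>k\<in>UNIV. cor k (x /\<^sub>R \<epsilon>) * partial l (partial k w) x)"
proof -
  have c: "C1 (\<lambda>x. cor k (x /\<^sub>R \<epsilon>) * partial k w x)" for k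
    by (rule C1_mult[OF corrector_scaled_C1 partial_w_C1])
  have "partial l (two_scale \<epsilon> w) x = partial l w x + partial l (\<lambda>x. \<epsilon> * (\<Sum>k\<in>UNIV. cor k (x /\<^sub>R \<epsilon>) * partial k w x)) x"
    unfolding two_scale_def by (rule partial_add[OF C1_simps(1)[OF trig_poly_C1[OF w]] C1_simps(1)[OF C1_cmult[OF C1_sum[OF c]]]])
  also have "partial l (\<lambda>x. \<epsilon> * (\<Sum>k\<in>UNIV. cor k (x /\<^sub>R \<epsilon>) * partial k w x)) x
    = \<epsilon> * partial l (\<lambda>x. \<Sum>k\<in>UNIV. cor k (x /\<^sub>R \<epsilon>) * partial k w x) x"
    by (rule partial_cmult[OF C1_simps(1)[OF C1_sum[OF c]]])
  also have "partial l (\<lambda>x. \<Sum>k\<in>UNIV. cor k (x /\<^sub>R \<epsilon>) * partial k w x) x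
    = (\<Sum>k\<in>UNIV. partial l (\<lambda>x. cor k (x /\<^sub>R \<epsilon>) * partial k w x) x)"
    by (rule partial_sum[OF C1_simps(1)[OF c]])
  also have "\<dots> = (\<Sum>k\<in>UNIV. cor k (x /\<^sub>R \<epsilon>) * partial l (partial k w) x + inverse \<epsilon> * partial l (cor k) (x /\<^sub>R \<epsilon>) * partial k w x)"
    unfolding partial_mult[OF C1_simps(1)[OF corrector_scaled_C1] C1_simps(1)[OF partial_w_C1]]
      C1_scale(2)[OF corrector_C1(1) corrector_scaled[OF \<epsilon>]] ..
  finally show ?thesis
    using \<epsilon>_pos[OF \<epsilon>] by (simp add: sum.distrib distrib_left sum_distrib_left mult.assoc[symmetric])
qed

text \<open>The factor \<epsilon> of the expansion cancels the inverse scale from differentiating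
  the scaled corrector, so that at leading order the matrix acts on the unit vector plus the
  corrector gradient. This is the cell flux, split here into its mean, which is the effective
  matrix, and its fluctuation.\<close>

lemma flux_two_scale:
  "(A (x /\<^sub>R \<epsilon>) *v gradient (two_scale \<epsilon> w) x) $ j = (effective_matrix A cor *v gradient w x) $ j
     + (\<Sum>k\<in>UNIV. fluctuation k j (x /\<^sub>R \<epsilon>) * partial k w x) + \<epsilon> * remainder \<epsilon> w j x"
proof -
  let ?A = "\<lambda>l. A (x /\<^sub>R \<epsilon>) $ j $ l" and ?c = "\<lambda>l k. partial l (cor k) (x /\<^sub>R \<epsilon>)" and ?w = "\<lambda>k. partial k w x"
  have "(\<Sum>l\<in>UNIV. ?A l * (?w l + (\<Sum>k\<in>UNIV. ?c l k * ?w k))) = (\<Sum>l\<in>UNIV. ?A l * ?w l) + (\<Sum>l\<in>UNIV. \<Sum>k\<in>UNIV. ?A l * ?c l k * ?w k)"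
    by (simp add: distrib_left sum.distrib sum_distrib_left mult.assoc)
  also have "(\<Sum>l\<in>UNIV. \<Sum>k\<in>UNIV. ?A l * ?c l k * ?w k) = (\<Sum>k\<in>UNIV. \<Sum>l\<in>UNIV. ?A l * ?c l k * ?w k)"
    by (rule sum.swap)
  also have "(\<Sum>l\<in>UNIV. ?A l * ?w l) + \<dots> = (\<Sum>k\<in>UNIV. flux k j (x /\<^sub>R \<epsilon>) * ?w k)"
    by (simp add: flux_def distrib_right sum.distrib sum_distrib_right)
  finally have "(\<Sum>l\<in>UNIV. ?A l * (?w l + (\<Sum>k\<in>UNIV. ?c l k * ?w k))) = (\<Sum>k\<in>UNIV. flux k j (x /\<^sub>R \<epsilon>) * ?w k)" .
  moreover have "(A (x /\<^sub>R \<epsilon>) *v gradient (two_scale \<epsilon> w) x) $ j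
     = (\<Sum>l\<in>UNIV. ?A l * (?w l + (\<Sum>k\<in>UNIV. ?c l k * ?w k))) + \<epsilon> * remainder \<epsilon> w j x"
    by (simp add: matrix_vector_mult_def partial_two_scale remainder_def distrib_left sum.distrib sum_distrib_left mult.left_commute)
  moreover have "(\<Sum>k\<in>UNIV. flux k j (x /\<^sub>R \<epsilon>) * ?w k) = (effective_matrix A cor *v gradient w x) $ j + (\<Sum>k\<in>UNIV. fluctuation k j (x /\<^sub>R \<epsilon>) * ?w k)"
    by (simp add: matrix_vector_mult_def fluctuation_def left_diff_distrib sum_subtractf)
  ultimately show ?thesis by simp
qed

lemma remainder_continuous: "periodic (remainder \<epsilon> w j)" "continuous_on UNIV (remainder \<epsilon> w j)"
proof -
  have t: "trig_poly (partial l (partial k w))" for l k by (intro trig_poly_partial w)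
  have c: "continuous_on UNIV (\<lambda>x. A (x /\<^sub>R \<epsilon>) $ j $ l)" for j l
    by (rule continuous_scaled[OF C1_continuous[OF entry_C1]])
  have "periodic (\<lambda>x. A (x /\<^sub>R \<epsilon>) $ j $ l)" for j l
    using A_scaled_periodic[OF \<epsilon>] by (simp add: periodic_def)
  then show "periodic (remainder \<epsilon> w j)" unfolding remainder_def
    by (intro periodic_sum periodic_mult corrector_scaled[OF \<epsilon>] trig_poly_periodic[OF t])
  show "continuous_on UNIV (remainder \<epsilon> w j)" unfolding remainder_def
    by (intro continuous_on_sum continuous_on_mult c C1_continuous[OF corrector_scaled_C1] trig_poly_continuous[OF t])
qed

text \<open>The divergence-free fluctuation is tested with \<open>P * partial k w * \<phi>\<close>,
  which moves the derivative from \<phi> to the smooth factor. Afterwards \<phi> appears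
  undifferentiated and the oscillating pairing bound applies; this takes the place of a
  skew-symmetric potential for the flux.\<close>

lemma fluctuation_integration_by_parts:
  assumes P: "trig_poly P" and \<phi>: "trig_poly \<phi>"
  shows "(\<Sum>j\<in>UNIV. \<integral>x. P x * fluctuation k j (x /\<^sub>R \<epsilon>) * partial k w x * partial j \<phi> x \<partial>torus)
    = - (\<Sum>j\<in>UNIV. \<integral>x. fluctuation k j (x /\<^sub>R \<epsilon>) * (partial j (\<lambda>x. P x * partial k w x) x * \<phi> x) \<partial>torus)"
proof -
  define Q where "Q = (\<lambda>x. P x * partial k w x)"
  have Q: "trig_poly Q" unfolding Q_def by (intro trig_poly.mult P trig_poly_partial w)
  define f where "f = (\<lambda>j x. fluctuation k j (x /\<^sub>R \<epsilon>))"
  have fC: "C1 (f j)" for j unfolding f_def by (rule C1_scale(1)[OF fluctuation_C1 fluctuation_scaled])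
  have pf: "partial j (f j) x = inverse \<epsilon> * partial j (fluctuation k j) (x /\<^sub>R \<epsilon>)" for j x
    unfolding f_def by (rule C1_scale(2)[OF fluctuation_C1 fluctuation_scaled])
  have div: "(\<Sum>j\<in>UNIV. partial j (f j) x) = 0" for x
    unfolding pf sum_distrib_left[symmetric] by (simp add: fluctuation_divergence)
  have p: "partial j (\<lambda>x. Q x * \<phi> x) x = Q x * partial j \<phi> x + partial j Q x * \<phi> x" for j x
    by (rule partial_mult[OF C1_simps(1)[OF trig_poly_C1[OF Q]] C1_simps(1)[OF trig_poly_C1[OF \<phi>]]])
  have i: "integrable torus (\<lambda>x. f j x * (Q x * partial j \<phi> x))" "integrable torus (\<lambda>x. f j x * (partial j Q x * \<phi> x))" for j
    by (intro integrable_torus_continuous continuous_on_mult C1_continuous[OF fC] trig_poly_continuous trig_poly_partial Q \<phi>)+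
  have "0 = (\<integral>x. (\<Sum>j\<in>UNIV. f j x * (Q x * partial j \<phi> x) + f j x * (partial j Q x * \<phi> x)) \<partial>torus)"
    using divergence_free_orthogonal[OF fC div trig_poly_C1[OF trig_poly.mult[OF Q \<phi>]]] unfolding p distrib_left by simp
  also have "\<dots> = (\<Sum>j\<in>UNIV. \<integral>x. f j x * (Q x * partial j \<phi> x) \<partial>torus) + (\<Sum>j\<in>UNIV. \<integral>x. f j x * (partial j Q x * \<phi> x) \<partial>torus)"
    using i by (simp add: Bochner_Integration.integral_sum sum.distrib)
  finally have "(\<Sum>j\<in>UNIV. \<integral>x. f j x * (Q x * partial j \<phi> x) \<partial>torus) = - (\<Sum>j\<in>UNIV. \<integral>x. f j x * (partial j Q x * \<phi> x) \<partial>torus)"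
    by simp
  then show ?thesis by (simp add: f_def Q_def mult_ac)
qed

end

text \<open>The consistency error in its weak form: both fluxes carry the same weight
  \<open>p\<close>, so that only the oscillation is measured here and the change of weight is
  accounted for elsewhere.\<close>

definition flux_gap :: "real \<Rightarrow> (real^'n \<Rightarrow> real) \<Rightarrow> (real^'n \<Rightarrow> real) \<Rightarrow> (real^'n \<Rightarrow> real) \<Rightarrow> real" where
  "flux_gap \<epsilon> p w \<phi> = (\<integral>x. flux_form p (\<lambda>x. A (x /\<^sub>R \<epsilon>)) (gradient (two_scale \<epsilon> w)) (gradient \<phi>) x \<partial>torus)
    - (\<integral>x. flux_form p (\<lambda>x. effective_matrix A cor) (gradient w) (gradient \<phi>) x \<partial>torus)"

text \<open>Three contributions: the fluctuation against \<open>p - P\<close>, bounded pointwise;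
  the fluctuation against \<open>P\<close>, which is O(\<epsilon>) after integration by parts; and
  the remainder, which carries a factor \<epsilon>. The nesting of quantifiers is essential:
  \<open>C\<close> depends on \<open>w\<close> only, \<open>C'\<close> also on \<open>P\<close>, and
  both are uniform in the scale, the weight and the test function. Hence \<open>P\<close> can be
  chosen with knowledge of \<open>C\<close> before \<epsilon> is made small.\<close>

lemma two_scale_consistency:
  assumes w: "trig_poly w"
  obtains C where "C \<ge> 0" "\<And>P. trig_poly P \<Longrightarrow> \<exists>C'\<ge>0. \<forall>\<epsilon> p \<delta> \<phi>. \<epsilon> \<in> admissible_scales A \<longrightarrow> periodic p \<longrightarrow>
    continuous_on UNIV p \<longrightarrow> (\<forall>x. \<bar>p x\<bar> \<le> 1) \<longrightarrow> (\<forall>x. \<bar>p x - P x\<bar> \<le> \<delta>) \<longrightarrow> trig_poly \<phi> \<longrightarrow>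
    \<bar>flux_gap \<epsilon> p w \<phi>\<bar>
    \<le> (C * \<delta> + C' * \<epsilon>) * sob_norm \<phi> (gradient \<phi>)"
proof -
  have wc: "periodic (partial k w)" "continuous_on UNIV (partial k w)" for k
    by (rule trig_poly_periodic[OF trig_poly_partial[OF w]], rule trig_poly_continuous[OF trig_poly_partial[OF w]])
  have wc2: "periodic (partial l (partial k w))" "continuous_on UNIV (partial l (partial k w))" for k l
    by (rule trig_poly_periodic[OF trig_poly_partial[OF trig_poly_partial[OF w]]],
        rule trig_poly_continuous[OF trig_poly_partial[OF trig_poly_partial[OF w]]])
  obtain W where W: "\<And>k. W k > 0" "\<And>k x. \<bar>partial k w x\<bar> \<le> W k"
    using periodic_bounded_family[where f="\<lambda>k. partial k w", OF wc] by blast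
  obtain W2 where W2: "\<And>l. W2 l > 0" "\<And>l x. \<bar>partial (fst l) (partial (snd l) w) x\<bar> \<le> W2 l"
    using periodic_bounded_family[where f="\<lambda>l. partial (fst l) (partial (snd l) w)", OF wc2] by blast
  obtain K where K: "\<And>k. K k > 0" "\<And>k x. \<bar>cor k x\<bar> \<le> K k"
    using periodic_bounded_family[where f=cor, OF C1_simps(3)[OF corrector_C1(1)] C1_continuous[OF corrector_C1(1)]] by blast
  obtain a where a: "\<And>l. a l > 0" "\<And>l x. \<bar>A x $ fst l $ snd l\<bar> \<le> a l"
    using periodic_bounded_family[where f="\<lambda>l x. A x $ fst l $ snd l", OF C1_simps(3)[OF entry_C1] C1_continuous[OF entry_C1]] by blast
  obtain G where G: "\<And>l. G l > 0" "\<And>l x. \<bar>fluctuation (fst l) (snd l) x\<bar> \<le> G l"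
    using periodic_bounded_family[where f="\<lambda>l. fluctuation (fst l) (snd l)", OF C1_simps(3)[OF fluctuation_C1] C1_continuous[OF fluctuation_C1]] by blast
  \<comment> \<open>Bound of the remainder uniform in \<epsilon>: the coefficients and correctors
    are bounded on the whole space, so evaluating them at the scaled point costs nothing.\<close>
  define R where "R = (\<lambda>j::'n. \<Sum>l\<in>UNIV. a (j, l) * (\<Sum>k\<in>UNIV. K k * W2 (l, k)))"
  have R: "\<bar>remainder \<epsilon> w j x\<bar> \<le> R j" for \<epsilon> j x
    unfolding remainder_def R_def
  proof (rule order_trans[OF sum_abs sum_mono], unfold abs_mult, rule mult_mono)
    fix l
    show "\<bar>A (x /\<^sub>R \<epsilon>) $ j $ l\<bar> \<le> a (j, l)" using a(2)[of _ "(j, l)"] by simp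
    show "0 \<le> a (j, l)" using a(1) by (simp add: less_imp_le)
    show "\<bar>\<Sum>k\<in>UNIV. cor k (x /\<^sub>R \<epsilon>) * partial l (partial k w) x\<bar> \<le> (\<Sum>k\<in>UNIV. K k * W2 (l, k))"
    proof (rule order_trans[OF sum_abs sum_mono], unfold abs_mult, rule mult_mono)
      fix k
      show "\<bar>partial l (partial k w) x\<bar> \<le> W2 (l, k)" using W2(2)[of "(l, k)"] by simp
    qed (use K in \<open>auto simp: less_imp_le\<close>)
  qed simp
  define C where "C = (\<Sum>j\<in>UNIV. \<Sum>k\<in>UNIV. G (k, j) * W k)"
  have C0: "C \<ge> 0" unfolding C_def using G(1) W(1) by (intro sum_nonneg mult_nonneg_nonneg) (auto simp: less_imp_le)
  show thesis
  proof (rule that[OF C0])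
    fix P :: "real^'n \<Rightarrow> real" assume P: "trig_poly P"
    define Bd where "Bd = (\<lambda>k j C. 0 \<le> C \<and> (\<forall>\<epsilon> \<phi>. \<epsilon> > 0 \<longrightarrow> periodic (\<lambda>x. fluctuation k j (x /\<^sub>R \<epsilon>)) \<longrightarrow> trig_poly \<phi> \<longrightarrow>
      \<bar>\<integral>x. fluctuation k j (x /\<^sub>R \<epsilon>) * (partial j (\<lambda>x. P x * partial k w x) x * \<phi> x) \<partial>torus\<bar> \<le> C * \<epsilon> * sob_norm \<phi> (gradient \<phi>)))"
    have "\<exists>C. Bd k j C" for k j
      unfolding Bd_def
      by (rule oscillating_pairing_bound[OF C1_simps(3)[OF fluctuation_C1] C1_continuous[OF fluctuation_C1] integral_fluctuation
          trig_poly_partial[OF trig_poly.mult[OF P trig_poly_partial[OF w]]]])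
    then obtain Z where ZB: "\<And>k j. Bd k j (Z k j)" by metis
    have Z: "Z k j \<ge> 0" "\<epsilon> > 0 \<Longrightarrow> periodic (\<lambda>x. fluctuation k j (x /\<^sub>R \<epsilon>)) \<Longrightarrow> trig_poly \<phi> \<Longrightarrow>
      \<bar>\<integral>x. fluctuation k j (x /\<^sub>R \<epsilon>) * (partial j (\<lambda>x. P x * partial k w x) x * \<phi> x) \<partial>torus\<bar> \<le> Z k j * \<epsilon> * sob_norm \<phi> (gradient \<phi>)" for k j \<epsilon> \<phi>
      using ZB[of k j] unfolding Bd_def by simp_all
    define C' where "C' = (\<Sum>k\<in>UNIV. \<Sum>j\<in>UNIV. Z k j) + (\<Sum>j\<in>UNIV. \<bar>R j\<bar>)"
    have C'0: "C' \<ge> 0" unfolding C'_def using Z(1) by (intro add_nonneg_nonneg sum_nonneg) auto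
    show "\<exists>C'\<ge>0. \<forall>\<epsilon> p \<delta> \<phi>. \<epsilon> \<in> admissible_scales A \<longrightarrow> periodic p \<longrightarrow>
      continuous_on UNIV p \<longrightarrow> (\<forall>x. \<bar>p x\<bar> \<le> 1) \<longrightarrow> (\<forall>x. \<bar>p x - P x\<bar> \<le> \<delta>) \<longrightarrow> trig_poly \<phi> \<longrightarrow>
      \<bar>flux_gap \<epsilon> p w \<phi>\<bar>
      \<le> (C * \<delta> + C' * \<epsilon>) * sob_norm \<phi> (gradient \<phi>)"
    proof (intro exI[of _ C'] conjI C'0 allI impI)
      fix \<epsilon> \<delta> :: real and p \<phi> :: "real^'n \<Rightarrow> real"
      assume \<epsilon>: "\<epsilon> \<in> admissible_scales A" and p: "periodic p" "continuous_on UNIV p" "\<forall>x. \<bar>p x\<bar> \<le> 1"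
        and pP: "\<forall>x. \<bar>p x - P x\<bar> \<le> \<delta>" and \<phi>: "trig_poly \<phi>"
      let ?N = "sob_norm \<phi> (gradient \<phi>)" and ?f = "\<lambda>k j x. fluctuation k j (x /\<^sub>R \<epsilon>)"
      note Pc = trig_poly_periodic[OF P] trig_poly_continuous[OF P]
      have \<phi>c: "continuous_on UNIV (partial j \<phi>)" for j by (rule trig_poly_continuous[OF trig_poly_partial[OF \<phi>]])
      have \<phi>L: "partial j \<phi> \<in> L2" for j by (rule L2_trig[OF trig_poly_partial[OF \<phi>]])
      have \<phi>N: "L2_norm (partial j \<phi>) \<le> ?N" for j using sob_norm_ge(2)[of "gradient \<phi>" j \<phi>] by simp
      have N0: "?N \<ge> 0" by (rule sob_norm_ge(3))
      have \<epsilon>0: "\<epsilon> > 0" by (rule \<epsilon>_pos[OF \<epsilon>])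
      have \<delta>0: "\<delta> \<ge> 0" using pP[rule_format, of 0] abs_ge_zero[of "p 0 - P 0"] by linarith
      have fc: "continuous_on UNIV (?f k j)" for k j by (rule continuous_scaled[OF C1_continuous[OF fluctuation_C1]])
      have fp: "periodic (?f k j)" for k j by (rule fluctuation_scaled[OF \<epsilon> w])
      have rc: "periodic (remainder \<epsilon> w j)" "continuous_on UNIV (remainder \<epsilon> w j)" for j
        by (rule remainder_continuous(1)[OF \<epsilon> w], rule remainder_continuous(2)[OF \<epsilon> w])
      \<comment> \<open>The weight in front of the fluctuation is split as
        \<open>(p - P) + P\<close>; the effective part and the remainder keep the original weight
        \<open>p\<close>.\<close>
      have pw: "flux_form p (\<lambda>x. A (x /\<^sub>R \<epsilon>)) (gradient (two_scale \<epsilon> w)) (gradient \<phi>) x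
         = flux_form p (\<lambda>x. effective_matrix A cor) (gradient w) (gradient \<phi>) x
         + (\<Sum>j\<in>UNIV. \<Sum>k\<in>UNIV. (p x - P x) * ?f k j x * partial k w x * partial j \<phi> x)
         + (\<Sum>j\<in>UNIV. \<Sum>k\<in>UNIV. P x * ?f k j x * partial k w x * partial j \<phi> x)
         + (\<Sum>j\<in>UNIV. \<epsilon> * ((p x * remainder \<epsilon> w j x) * partial j \<phi> x))" for x
      proof -
        have "flux_form p (\<lambda>x. A (x /\<^sub>R \<epsilon>)) (gradient (two_scale \<epsilon> w)) (gradient \<phi>) x
          = (\<Sum>j\<in>UNIV. p x * (A (x /\<^sub>R \<epsilon>) *v gradient (two_scale \<epsilon> w) x) $ j * partial j \<phi> x)"
          by (simp add: flux_form_def inner_vec_def)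
        also have "\<dots> = (\<Sum>j\<in>UNIV. p x * (effective_matrix A cor *v gradient w x) $ j * partial j \<phi> x)
          + (\<Sum>j\<in>UNIV. (\<Sum>k\<in>UNIV. p x * ?f k j x * partial k w x * partial j \<phi> x))
          + (\<Sum>j\<in>UNIV. \<epsilon> * ((p x * remainder \<epsilon> w j x) * partial j \<phi> x))"
          unfolding flux_two_scale[OF \<epsilon> w] by (simp add: algebra_simps sum.distrib sum_distrib_left sum_distrib_right)
        also have "(\<Sum>j\<in>UNIV. p x * (effective_matrix A cor *v gradient w x) $ j * partial j \<phi> x)
          = flux_form p (\<lambda>x. effective_matrix A cor) (gradient w) (gradient \<phi>) x"
          by (simp add: flux_form_def inner_vec_def)
        finally show ?thesis by (simp add: left_diff_distrib sum_subtractf)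
      qed
      have i1: "integrable torus (\<lambda>x. (p x - P x) * ?f k j x * partial k w x * partial j \<phi> x)"
        "integrable torus (\<lambda>x. P x * ?f k j x * partial k w x * partial j \<phi> x)"
        "integrable torus (\<lambda>x. \<epsilon> * ((p x * remainder \<epsilon> w j x) * partial j \<phi> x))" for j k
        by (intro integrable_torus_continuous continuous_on_mult continuous_on_diff continuous_on_const p(2) Pc fc wc \<phi>c rc)+
      have i2: "integrable torus (flux_form p (\<lambda>x. effective_matrix A cor) (gradient w) (gradient \<phi>))"
        unfolding flux_form_expand[abs_def] gradient_nth
        by (intro integrable_torus_continuous continuous_on_sum continuous_on_mult continuous_on_const p(2) wc \<phi>c)
      have T1: "\<bar>\<Sum>j\<in>UNIV. \<Sum>k\<in>UNIV. \<integral>x. (p x - P x) * ?f k j x * partial k w x * partial j \<phi> x \<partial>torus\<bar> \<le> C * \<delta> * ?N"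
      proof -
        have "\<bar>\<integral>x. (p x - P x) * ?f k j x * partial k w x * partial j \<phi> x \<partial>torus\<bar> \<le> G (k, j) * W k * \<delta> * ?N" for k j
        proof -
          have "\<bar>\<integral>x. ((p x - P x) * ?f k j x * partial k w x) * partial j \<phi> x \<partial>torus\<bar> \<le> (\<delta> * G (k, j) * W k) * L2_norm (partial j \<phi>)"
          proof (rule integral_mult_bounded_le[OF \<phi>L])
            show "periodic (\<lambda>x. (p x - P x) * ?f k j x * partial k w x)"
              by (intro periodic_mult periodic_diff p Pc fp wc)
            show "(\<lambda>x. (p x - P x) * ?f k j x * partial k w x) \<in> borel_measurable torus"
              by (intro continuous_measurable_torus continuous_on_mult continuous_on_diff p(2) Pc fc wc)
            show "\<bar>(p x - P x) * ?f k j x * partial k w x\<bar> \<le> \<delta> * G (k, j) * W k" for x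
              unfolding abs_mult using pP W G(1) G(2)[of "(k, j)"] \<delta>0 by (intro mult_mono mult_nonneg_nonneg) (auto simp: less_imp_le)
          qed
          also have "\<dots> \<le> (\<delta> * G (k, j) * W k) * ?N"
            using G(1)[of "(k, j)"] W(1)[of k] \<delta>0 by (intro mult_left_mono \<phi>N mult_nonneg_nonneg) auto
          finally show ?thesis by (simp add: mult_ac)
        qed
        then have "\<bar>\<Sum>j\<in>UNIV. \<Sum>k\<in>UNIV. \<integral>x. (p x - P x) * ?f k j x * partial k w x * partial j \<phi> x \<partial>torus\<bar>
          \<le> (\<Sum>j\<in>UNIV. \<Sum>k\<in>UNIV. G (k, j) * W k * \<delta> * ?N)"
          by (intro order_trans[OF sum_abs sum_mono])
        then show ?thesis by (simp add: C_def sum_distrib_right)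
      qed
      have T2: "\<bar>\<Sum>j\<in>UNIV. \<Sum>k\<in>UNIV. \<integral>x. P x * ?f k j x * partial k w x * partial j \<phi> x \<partial>torus\<bar> \<le> (\<Sum>k\<in>UNIV. \<Sum>j\<in>UNIV. Z k j) * \<epsilon> * ?N"
      proof -
        have "(\<Sum>j\<in>UNIV. \<Sum>k\<in>UNIV. \<integral>x. P x * ?f k j x * partial k w x * partial j \<phi> x \<partial>torus)
          = (\<Sum>k\<in>UNIV. \<Sum>j\<in>UNIV. \<integral>x. P x * ?f k j x * partial k w x * partial j \<phi> x \<partial>torus)"
          by (rule sum.swap)
        also have "\<bar>\<dots>\<bar> \<le> (\<Sum>k\<in>UNIV. \<Sum>j\<in>UNIV. Z k j * \<epsilon> * ?N)"
        proof (rule order_trans[OF sum_abs sum_mono])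
          fix k
          show "\<bar>\<Sum>j\<in>UNIV. \<integral>x. P x * ?f k j x * partial k w x * partial j \<phi> x \<partial>torus\<bar> \<le> (\<Sum>j\<in>UNIV. Z k j * \<epsilon> * ?N)"
            unfolding fluctuation_integration_by_parts[OF \<epsilon> w P \<phi>] abs_minus_cancel
            by (intro order_trans[OF sum_abs sum_mono] Z(2)[OF \<epsilon>0 fp \<phi>])
        qed
        finally show ?thesis by (simp add: sum_distrib_right)
      qed
      have T3: "\<bar>\<Sum>j\<in>UNIV. \<integral>x. \<epsilon> * ((p x * remainder \<epsilon> w j x) * partial j \<phi> x) \<partial>torus\<bar> \<le> (\<Sum>j\<in>UNIV. \<bar>R j\<bar>) * \<epsilon> * ?N"
      proof -
        have "\<bar>\<integral>x. \<epsilon> * ((p x * remainder \<epsilon> w j x) * partial j \<phi> x) \<partial>torus\<bar> \<le> \<bar>R j\<bar> * \<epsilon> * ?N" for j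
        proof -
          have "\<bar>\<integral>x. (p x * remainder \<epsilon> w j x) * partial j \<phi> x \<partial>torus\<bar> \<le> (1 * \<bar>R j\<bar>) * L2_norm (partial j \<phi>)"
          proof (rule integral_mult_bounded_le[OF \<phi>L])
            show "periodic (\<lambda>x. p x * remainder \<epsilon> w j x)" by (intro periodic_mult p rc)
            show "(\<lambda>x. p x * remainder \<epsilon> w j x) \<in> borel_measurable torus"
              by (intro continuous_measurable_torus continuous_on_mult p(2) rc)
            show "\<bar>p x * remainder \<epsilon> w j x\<bar> \<le> 1 * \<bar>R j\<bar>" for x
              unfolding abs_mult using p(3) R[of \<epsilon> j x] by (intro mult_mono) auto
          qed
          also have "\<dots> \<le> (1 * \<bar>R j\<bar>) * ?N" by (intro mult_left_mono \<phi>N) auto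
          finally have "\<epsilon> * \<bar>\<integral>x. (p x * remainder \<epsilon> w j x) * partial j \<phi> x \<partial>torus\<bar> \<le> \<epsilon> * (\<bar>R j\<bar> * ?N)"
            using \<epsilon>0 by simp
          then show ?thesis using \<epsilon>0 by (simp add: abs_mult mult_ac)
        qed
        then have "\<bar>\<Sum>j\<in>UNIV. \<integral>x. \<epsilon> * ((p x * remainder \<epsilon> w j x) * partial j \<phi> x) \<partial>torus\<bar> \<le> (\<Sum>j\<in>UNIV. \<bar>R j\<bar> * \<epsilon> * ?N)"
          by (intro order_trans[OF sum_abs sum_mono])
        then show ?thesis by (simp only: sum_distrib_right)
      qed
      have "(\<integral>x. flux_form p (\<lambda>x. A (x /\<^sub>R \<epsilon>)) (gradient (two_scale \<epsilon> w)) (gradient \<phi>) x \<partial>torus)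
        = (\<integral>x. flux_form p (\<lambda>x. effective_matrix A cor) (gradient w) (gradient \<phi>) x \<partial>torus)
        + (\<Sum>j\<in>UNIV. \<Sum>k\<in>UNIV. \<integral>x. (p x - P x) * ?f k j x * partial k w x * partial j \<phi> x \<partial>torus)
        + (\<Sum>j\<in>UNIV. \<Sum>k\<in>UNIV. \<integral>x. P x * ?f k j x * partial k w x * partial j \<phi> x \<partial>torus)
        + (\<Sum>j\<in>UNIV. \<integral>x. \<epsilon> * ((p x * remainder \<epsilon> w j x) * partial j \<phi> x) \<partial>torus)"
        unfolding pw using i1 i2
        by (simp only: Bochner_Integration.integral_add Bochner_Integration.integral_sum
            Bochner_Integration.integrable_add Bochner_Integration.integrable_sum)
      moreover have "(C * \<delta> + C' * \<epsilon>) * ?N = C * \<delta> * ?N + (\<Sum>k\<in>UNIV. \<Sum>j\<in>UNIV. Z k j) * \<epsilon> * ?N + (\<Sum>j\<in>UNIV. \<bar>R j\<bar>) * \<epsilon> * ?N"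
        by (simp add: C'_def distrib_right)
      ultimately show "\<bar>flux_gap \<epsilon> p w \<phi>\<bar> \<le> (C * \<delta> + C' * \<epsilon>) * ?N"
        unfolding flux_gap_def using T1 T2 T3 by linarith
    qed
  qed
qed

lemma two_scale_close:
  assumes w: "trig_poly w"
  obtains C where "C \<ge> 0" "\<And>\<epsilon> x. \<epsilon> > 0 \<Longrightarrow> \<bar>two_scale \<epsilon> w x - w x\<bar> \<le> C * \<epsilon>"
proof -
  have wc: "periodic (partial k w)" "continuous_on UNIV (partial k w)" for k
    by (rule trig_poly_periodic[OF trig_poly_partial[OF w]], rule trig_poly_continuous[OF trig_poly_partial[OF w]])
  obtain W where W: "\<And>k. W k > 0" "\<And>k x. \<bar>partial k w x\<bar> \<le> W k"
    using periodic_bounded_family[where f="\<lambda>k. partial k w", OF wc] by blast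
  obtain K where K: "\<And>k. K k > 0" "\<And>k x. \<bar>cor k x\<bar> \<le> K k"
    using periodic_bounded_family[where f=cor, OF C1_simps(3)[OF corrector_C1(1)] C1_continuous[OF corrector_C1(1)]] by blast
  show thesis
  proof (rule that)
    show "0 \<le> (\<Sum>k\<in>UNIV. K k * W k)" using K(1) W(1) by (intro sum_nonneg mult_nonneg_nonneg) (auto simp: less_imp_le)
    fix \<epsilon> :: real and x assume \<epsilon>: "\<epsilon> > 0"
    have "\<bar>\<Sum>k\<in>UNIV. cor k (x /\<^sub>R \<epsilon>) * partial k w x\<bar> \<le> (\<Sum>k\<in>UNIV. K k * W k)"
      by (rule order_trans[OF sum_abs sum_mono], unfold abs_mult, rule mult_mono)
         (use K W in \<open>auto simp: less_imp_le\<close>)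
    then have "\<epsilon> * \<bar>\<Sum>k\<in>UNIV. cor k (x /\<^sub>R \<epsilon>) * partial k w x\<bar> \<le> \<epsilon> * (\<Sum>k\<in>UNIV. K k * W k)"
      using \<epsilon> by (intro mult_left_mono) auto
    then show "\<bar>two_scale \<epsilon> w x - w x\<bar> \<le> (\<Sum>k\<in>UNIV. K k * W k) * \<epsilon>"
      using \<epsilon> by (simp add: two_scale_def abs_mult mult.commute)
  qed
qed

end

subsection \<open>Stability of the time step\<close>

lemma flux_form_integral_tendsto:
  assumes "admissible_coeff p a" "\<And>j. (\<lambda>x. g x $ j) \<in> L2" "\<And>j. (\<lambda>x. h x $ j) \<in> L2" "\<And>N j. (\<lambda>x. H N x $ j) \<in> L2"
    and "\<And>j. (\<lambda>N. L2_norm (\<lambda>x. H N x $ j - h x $ j)) \<longlonglongrightarrow> 0"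
  shows "(\<lambda>N. \<integral>x. flux_form p a g (H N) x \<partial>torus) \<longlonglongrightarrow> (\<integral>x. flux_form p a g h x \<partial>torus)"
proof -
  have b: "(\<lambda>x. p x * a x $ j $ k * g x $ k) \<in> L2" for j k
    by (rule L2_mult_continuous[OF assms(2) admissible_coeff_entry[OF assms(1)]])
  have eq: "(\<integral>x. flux_form p a g X x \<partial>torus) = (\<Sum>j\<in>UNIV. \<Sum>k\<in>UNIV. \<integral>x. X x $ j * (p x * a x $ j $ k * g x $ k) \<partial>torus)"
    if X: "\<And>j. (\<lambda>x. X x $ j) \<in> L2" for X
  proof -
    have i: "integrable torus (\<lambda>x. X x $ j * (p x * a x $ j $ k * g x $ k))" for j k
      by (rule L2_integrable_mult[OF X b])
    have "(\<integral>x. flux_form p a g X x \<partial>torus) = (\<integral>x. (\<Sum>j\<in>UNIV. \<Sum>k\<in>UNIV. X x $ j * (p x * a x $ j $ k * g x $ k)) \<partial>torus)"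
      unfolding flux_form_expand by (simp add: mult_ac)
    also have "\<dots> = (\<Sum>j\<in>UNIV. \<Sum>k\<in>UNIV. \<integral>x. X x $ j * (p x * a x $ j $ k * g x $ k) \<partial>torus)"
      using i by (simp only: Bochner_Integration.integral_sum Bochner_Integration.integrable_sum)
    finally show ?thesis .
  qed
  show ?thesis
    unfolding eq[OF assms(3)] eq[OF assms(4)]
    by (intro tendsto_sum L2_tendsto_integral assms b)
qed

lemma sob_norm_tendsto:
  assumes "u \<in> L2" "\<And>j. (\<lambda>x. g x $ j) \<in> L2" "\<And>N. w N \<in> L2" "\<And>N j. (\<lambda>x. H N x $ j) \<in> L2"
    "(\<lambda>N. L2_norm (\<lambda>x. w N x - u x)) \<longlonglongrightarrow> 0" "\<And>j. (\<lambda>N. L2_norm (\<lambda>x. H N x $ j - g x $ j)) \<longlonglongrightarrow> 0"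
  shows "(\<lambda>N. sob_norm (w N) (H N)) \<longlonglongrightarrow> sob_norm u g"
proof -
  have *: "(\<lambda>N. L2_norm (v N)) \<longlonglongrightarrow> L2_norm f"
    if "f \<in> L2" "\<And>N. v N \<in> L2" "(\<lambda>N. L2_norm (\<lambda>x. v N x - f x)) \<longlonglongrightarrow> 0" for v and f :: "real^'a \<Rightarrow> real"
  proof -
    have "norm (L2_norm (v N) - L2_norm f) \<le> L2_norm (\<lambda>x. v N x - f x)" for N
      using L2_norm_le_add_diff[OF that(2)[of N] that(1)] L2_norm_le_add_diff[OF that(1) that(2)[of N]] L2_norm_uminus[of f "v N"]
      by (simp add: abs_le_iff)
    then have "(\<lambda>N. L2_norm (v N) - L2_norm f) \<longlonglongrightarrow> 0"
      using that(3) by (rule Lim_null_comparison[OF always_eventually[OF allI]])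
    then show ?thesis by (simp add: LIM_zero_iff)
  qed
  show ?thesis unfolding sob_norm_def by (intro tendsto_add tendsto_sum * assms)
qed

text \<open>
  Here \<open>\<kappa>\<close> bounds the residual of \<open>w\<close> in the Euler--Lagrange equation of \<open>u\<close>; testing with trigonometric
  polynomials suffices by density.
\<close>

lemma residual_estimate:
  fixes u w prev :: "real^'n \<Rightarrow> real"
  assumes adm: "admissible_coeff p a" and \<tau>: "\<tau> > 0"
    and coer: "\<And>x v. \<alpha> * (v \<bullet> v) \<le> (p x *\<^sub>R (a x *v v)) \<bullet> v" "\<And>x. \<alpha> * \<tau> \<le> p x" and \<alpha>: "\<alpha> > 0"
    and u: "u \<in> L2" "is_weak_gradient u g" and w: "C1 w" and prev: "prev \<in> L2"
    and EL: "\<And>\<phi> h. \<phi> \<in> L2 \<Longrightarrow> is_weak_gradient \<phi> h \<Longrightarrow>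
      (\<integral>x. flux_form p a g h x \<partial>torus) + 1 / \<tau> * (\<integral>x. (p x * u x - prev x) * \<phi> x \<partial>torus) = 0"
    and res: "\<And>\<phi>. trig_poly \<phi> \<Longrightarrow>
      \<bar>(\<integral>x. flux_form p a (gradient w) (gradient \<phi>) x \<partial>torus) + 1 / \<tau> * (\<integral>x. (p x * w x - prev x) * \<phi> x \<partial>torus)\<bar>
        \<le> \<kappa> * sob_norm \<phi> (gradient \<phi>)"
  shows "L2_norm (\<lambda>x. u x - w x) \<le> (real CARD('n) + 1) * \<kappa> / \<alpha>"
proof -
  \<comment> \<open>The error itself serves as test function, paired with its weak gradient. It is
    not smooth, which is why the residual bound first has to be extended by density.\<close>
  define \<phi> h where "\<phi> = (\<lambda>x. u x - w x)" and "h = (\<lambda>x. g x - gradient w x)"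
  have wL: "w \<in> L2" "partial j w \<in> L2" for j by (rule L2_C1[OF w])+
  have \<phi>L: "\<phi> \<in> L2" unfolding \<phi>_def by (intro L2_diff u wL)
  have \<phi>h: "is_weak_gradient \<phi> h"
    using weak_gradient_add[OF u(1) wL(1) u(2) C1_weak_gradient[OF w], of "-1"] by (simp add: \<phi>_def h_def)
  have gL: "(\<lambda>x. g x $ j) \<in> L2" "(\<lambda>x. h x $ j) \<in> L2" "(\<lambda>x. gradient w x $ j) \<in> L2" for j
    using weak_gradient_L2[OF u(2)] weak_gradient_L2[OF \<phi>h] wL by simp_all
  have p: "periodic p" "continuous_on UNIV p" using adm by (auto simp: admissible_coeff_def)
  have rL: "(\<lambda>x. p x * w x - prev x) \<in> L2" "(\<lambda>x. p x * u x - prev x) \<in> L2"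
    by (intro L2_diff L2_mult_continuous p wL u prev)+
  define Rf where "Rf = (\<lambda>\<psi> k. (\<integral>x. flux_form p a (gradient w) k x \<partial>torus) + 1 / \<tau> * (\<integral>x. (p x * w x - prev x) * \<psi> x \<partial>torus))"
  \<comment> \<open>Both sides of the residual bound are continuous in the H^1 sense, so it passes
    from the trigonometric polynomials \<open>z N\<close> to their limit \<phi>.\<close>
  have "\<bar>Rf \<phi> h\<bar> \<le> \<kappa> * sob_norm \<phi> h"
  proof -
    obtain z where z: "\<And>N. trig_poly (z N)" "(\<lambda>N. L2_norm (\<lambda>x. z N x - \<phi> x)) \<longlonglongrightarrow> 0"
      "\<And>j. (\<lambda>N. L2_norm (\<lambda>x. partial j (z N) x - h x $ j)) \<longlonglongrightarrow> 0"
      using H1_dense_trig[OF \<phi>L \<phi>h] by blast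
    have zL: "z N \<in> L2" "(\<lambda>x. gradient (z N) x $ j) \<in> L2" for N j
      using L2_trig[OF z(1)] L2_trig[OF trig_poly_partial[OF z(1)]] by simp_all
    have zlim: "(\<lambda>N. L2_norm (\<lambda>x. gradient (z N) x $ j - h x $ j)) \<longlonglongrightarrow> 0" for j using z(3) by simp
    have "(\<lambda>N. \<integral>x. (p x * w x - prev x) * z N x \<partial>torus) \<longlonglongrightarrow> (\<integral>x. (p x * w x - prev x) * \<phi> x \<partial>torus)"
      using L2_tendsto_integral[OF \<phi>L rL(1) zL(1) z(2)] by (simp add: mult.commute)
    then have "(\<lambda>N. \<bar>Rf (z N) (gradient (z N))\<bar>) \<longlonglongrightarrow> \<bar>Rf \<phi> h\<bar>"
      unfolding Rf_def
      by (intro tendsto_rabs tendsto_add tendsto_mult tendsto_const flux_form_integral_tendsto[OF adm gL(3) gL(2) zL(2) zlim])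
    moreover have "(\<lambda>N. \<kappa> * sob_norm (z N) (gradient (z N))) \<longlonglongrightarrow> \<kappa> * sob_norm \<phi> h"
      by (intro tendsto_mult tendsto_const sob_norm_tendsto[OF \<phi>L gL(2) zL z(2) zlim])
    moreover have "\<exists>N0. \<forall>N\<ge>N0. \<bar>Rf (z N) (gradient (z N))\<bar> \<le> \<kappa> * sob_norm (z N) (gradient (z N))"
      unfolding Rf_def using res[OF z(1)] by blast
    ultimately show ?thesis by (rule LIMSEQ_le)
  qed
  \<comment> \<open>Subtracting the Euler-Lagrange equation from the residual of \<open>w\<close>
    leaves minus the quadratic form of the error. Its gradient part is at least \<alpha> by
    ellipticity, and its zero-order part \<open>p / \<tau>\<close> is at least \<alpha> by the
    second coercivity assumption.\<close>
  moreover have "\<alpha> * ((L2_norm \<phi>)\<^sup>2 + (\<Sum>j\<in>UNIV. (L2_norm (\<lambda>x. h x $ j))\<^sup>2)) \<le> - Rf \<phi> h"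
  proof -
    have i1: "integrable torus (flux_form p a g h)" "integrable torus (flux_form p a (gradient w) h)" "integrable torus (flux_form p a h h)"
      by (intro flux_form_integrable[OF adm] gL)+
    have i2: "integrable torus (\<lambda>x. (p x * w x - prev x) * \<phi> x)" "integrable torus (\<lambda>x. (p x * u x - prev x) * \<phi> x)"
      by (intro L2_integrable_mult rL \<phi>L)+
    have i3: "integrable torus (\<lambda>x. p x * (\<phi> x)\<^sup>2)"
      using L2_integrable_mult[OF L2_mult_continuous[OF \<phi>L p] \<phi>L] by (simp add: power2_eq_square mult.assoc)
    have i4: "integrable torus (\<lambda>x. (\<phi> x)\<^sup>2)" "integrable torus (\<lambda>x. (h x $ j)\<^sup>2)" for j
      by (rule L2D(3)[OF \<phi>L], rule L2D(3)[OF gL(2)])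
    have hh: "flux_form p a h h x = flux_form p a g h x - flux_form p a (gradient w) h x" for x
      by (simp add: flux_form_def h_def matrix_vector_mult_diff_distrib scaleR_diff_right inner_diff_left)
    have \<phi>\<phi>: "p x * (\<phi> x)\<^sup>2 = (p x * u x - prev x) * \<phi> x - (p x * w x - prev x) * \<phi> x" for x
      by (simp add: \<phi>_def power2_eq_square algebra_simps)
    have "- Rf \<phi> h = (\<integral>x. flux_form p a g h x \<partial>torus) + 1 / \<tau> * (\<integral>x. (p x * u x - prev x) * \<phi> x \<partial>torus) - Rf \<phi> h"
      using EL[OF \<phi>L \<phi>h] by simp
    also have "\<dots> = (\<integral>x. flux_form p a h h x \<partial>torus) + 1 / \<tau> * (\<integral>x. p x * (\<phi> x)\<^sup>2 \<partial>torus)"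
      unfolding Rf_def hh \<phi>\<phi> using i1 i2 by (simp add: right_diff_distrib diff_divide_distrib)
    finally have 1: "- Rf \<phi> h = (\<integral>x. flux_form p a h h x \<partial>torus) + 1 / \<tau> * (\<integral>x. p x * (\<phi> x)\<^sup>2 \<partial>torus)" .
    have 2: "(\<integral>x. flux_form p a h h x \<partial>torus) \<ge> (\<integral>x. \<alpha> * (\<Sum>j\<in>UNIV. (h x $ j)\<^sup>2) \<partial>torus)"
    proof (rule integral_mono)
      show "\<alpha> * (\<Sum>j\<in>UNIV. (h x $ j)\<^sup>2) \<le> flux_form p a h h x" for x
        using coer(1)[of "h x" x] by (simp add: flux_form_def inner_vec_def power2_eq_square)
    qed (intro i1 integrable_mult_right Bochner_Integration.integrable_sum i4)+
    have "(\<integral>x. \<alpha> * \<tau> * (\<phi> x)\<^sup>2 \<partial>torus) \<le> (\<integral>x. p x * (\<phi> x)\<^sup>2 \<partial>torus)"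
      by (intro integral_mono i3 integrable_mult_right i4 mult_right_mono coer) auto
    then have 3: "1 / \<tau> * (\<integral>x. \<alpha> * \<tau> * (\<phi> x)\<^sup>2 \<partial>torus) \<le> 1 / \<tau> * (\<integral>x. p x * (\<phi> x)\<^sup>2 \<partial>torus)"
      using \<tau> by (intro mult_left_mono) auto
    have 4: "1 / \<tau> * (\<integral>x. \<alpha> * \<tau> * (\<phi> x)\<^sup>2 \<partial>torus) = \<alpha> * (L2_norm \<phi>)\<^sup>2"
      using \<tau> by (simp add: L2_norm_power2)
    have 5: "(\<integral>x. \<alpha> * (\<Sum>j\<in>UNIV. (h x $ j)\<^sup>2) \<partial>torus) = \<alpha> * (\<Sum>j\<in>UNIV. (L2_norm (\<lambda>x. h x $ j))\<^sup>2)"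
      using i4 by (simp add: L2_norm_power2 Bochner_Integration.integral_sum)
    show ?thesis unfolding distrib_left using 1 2 3 4 5 by linarith
  qed
  moreover have "(sob_norm \<phi> h)\<^sup>2 \<le> (real CARD('n) + 1) * ((L2_norm \<phi>)\<^sup>2 + (\<Sum>j\<in>UNIV. (L2_norm (\<lambda>x. h x $ j))\<^sup>2))"
  proof -
    \<comment> \<open>The type \<open>'n option\<close> indexes the \<open>CARD('n) + 1\<close>
      summands of \<open>sob_norm\<close>, \<open>None\<close> standing for the function and
      \<open>Some j\<close> for the partial derivatives; Cauchy-Schwarz against the constant 1
      yields the factor.\<close>
    define f where "f = (\<lambda>i::'n option. case i of None \<Rightarrow> L2_norm \<phi> | Some j \<Rightarrow> L2_norm (\<lambda>x. h x $ j))"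
    have "(\<Sum>i\<in>UNIV. f i)\<^sup>2 \<le> real (card (UNIV :: 'n option set)) * (\<Sum>i\<in>UNIV. (f i)\<^sup>2)"
      using Cauchy_Schwarz_ineq_sum[of "\<lambda>_. 1" f UNIV] by simp
    moreover have "(\<Sum>i\<in>UNIV. F i) = F None + (\<Sum>j\<in>UNIV. F (Some j))" for F :: "'n option \<Rightarrow> real"
      unfolding UNIV_option_conv by (simp add: sum.reindex)
    ultimately show ?thesis by (simp add: f_def sob_norm_def card_UNIV_option add.commute[of 1])
  qed
  ultimately have "\<alpha> * (sob_norm \<phi> h)\<^sup>2 \<le> (real CARD('n) + 1) * (\<kappa> * sob_norm \<phi> h)"
  proof -
    assume 1: "\<bar>Rf \<phi> h\<bar> \<le> \<kappa> * sob_norm \<phi> h"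
      and 2: "\<alpha> * ((L2_norm \<phi>)\<^sup>2 + (\<Sum>j\<in>UNIV. (L2_norm (\<lambda>x. h x $ j))\<^sup>2)) \<le> - Rf \<phi> h"
      and 3: "(sob_norm \<phi> h)\<^sup>2 \<le> (real CARD('n) + 1) * ((L2_norm \<phi>)\<^sup>2 + (\<Sum>j\<in>UNIV. (L2_norm (\<lambda>x. h x $ j))\<^sup>2))"
    have "\<alpha> * (sob_norm \<phi> h)\<^sup>2 \<le> \<alpha> * ((real CARD('n) + 1) * ((L2_norm \<phi>)\<^sup>2 + (\<Sum>j\<in>UNIV. (L2_norm (\<lambda>x. h x $ j))\<^sup>2)))"
      using 3 \<alpha> by (intro mult_left_mono) auto
    also have "\<dots> = (real CARD('n) + 1) * (\<alpha> * ((L2_norm \<phi>)\<^sup>2 + (\<Sum>j\<in>UNIV. (L2_norm (\<lambda>x. h x $ j))\<^sup>2)))"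
      by (rule mult.left_commute)
    also have "\<dots> \<le> (real CARD('n) + 1) * (\<kappa> * sob_norm \<phi> h)"
      using 1 2 by (intro mult_left_mono) auto
    finally show ?thesis .
  qed
  then have "sob_norm \<phi> h * (\<alpha> * sob_norm \<phi> h) \<le> sob_norm \<phi> h * ((real CARD('n) + 1) * \<kappa>)"
    by (simp add: power2_eq_square mult_ac)
  \<comment> \<open>Seen by testing with the constant 1, whose norm is 1; it covers the case of a
    vanishing error, where the norm cannot be cancelled.\<close>
  moreover have "\<kappa> \<ge> 0"
  proof -
    have "sob_norm (\<lambda>x::real^'n. 1) (gradient (\<lambda>x. 1)) = 1" by (simp add: sob_norm_def L2_norm_def)
    then show ?thesis using res[OF trig_poly.const[of 1]] abs_ge_zero order_trans by fastforce
  qed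
  moreover have "sob_norm \<phi> h \<ge> 0" by (rule sob_norm_ge)
  ultimately have "\<alpha> * sob_norm \<phi> h \<le> (real CARD('n) + 1) * \<kappa>"
    by (cases "sob_norm \<phi> h = 0") (auto simp: mult_le_cancel_left_pos)
  then have "sob_norm \<phi> h \<le> (real CARD('n) + 1) * \<kappa> / \<alpha>" using \<alpha> by (simp add: field_simps)
  then show ?thesis using sob_norm_ge(1)[of \<phi> h] by (simp add: \<phi>_def)
qed

subsection \<open>Convergence of one time step\<close>

lemma flux_form_const_bound:
  fixes M :: "real^'n^'n" and u v :: "real^'n \<Rightarrow> real"
  assumes p: "periodic p" "continuous_on UNIV p" "\<And>x. \<bar>p x\<bar> \<le> B"
    and X: "\<And>j. (\<lambda>x. X x $ j) \<in> L2" and Y: "\<And>j. (\<lambda>x. Y x $ j) \<in> L2"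
  shows "\<bar>\<integral>x. flux_form p (\<lambda>x. M) X Y x \<partial>torus\<bar> \<le> B * (\<Sum>j\<in>UNIV. \<Sum>k\<in>UNIV. \<bar>M $ j $ k\<bar>) * sob_norm u X * sob_norm v Y"
proof -
  have B0: "B \<ge> 0" using p(3)[of 0] by linarith
  have pm: "p \<in> borel_measurable torus" by (rule continuous_measurable_torus[OF p(2)])
  have pX: "(\<lambda>x. p x * X x $ k) \<in> L2" for k by (rule L2_mult_continuous[OF X p(1,2)])
  have i: "integrable torus (\<lambda>x. M $ j $ k * ((p x * X x $ k) * Y x $ j))" for j k
    by (intro integrable_mult_right L2_integrable_mult pX Y)
  have "(\<integral>x. flux_form p (\<lambda>x. M) X Y x \<partial>torus) = (\<integral>x. (\<Sum>j\<in>UNIV. \<Sum>k\<in>UNIV. M $ j $ k * ((p x * X x $ k) * Y x $ j)) \<partial>torus)"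
    unfolding flux_form_expand by (simp add: mult_ac)
  also have "\<dots> = (\<Sum>j\<in>UNIV. \<Sum>k\<in>UNIV. \<integral>x. M $ j $ k * ((p x * X x $ k) * Y x $ j) \<partial>torus)"
    using i by (simp only: Bochner_Integration.integral_sum Bochner_Integration.integrable_sum)
  also have "\<bar>\<dots>\<bar> \<le> (\<Sum>j\<in>UNIV. \<Sum>k\<in>UNIV. \<bar>M $ j $ k\<bar> * (B * sob_norm u X * sob_norm v Y))"
  proof (intro order_trans[OF sum_abs sum_mono])
    fix j k
    have "\<bar>\<integral>x. (p x * X x $ k) * Y x $ j \<partial>torus\<bar> \<le> L2_norm (\<lambda>x. p x * X x $ k) * L2_norm (\<lambda>x. Y x $ j)"
      by (rule L2_Cauchy_Schwarz[OF pX Y])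
    also have "\<dots> \<le> (B * L2_norm (\<lambda>x. X x $ k)) * L2_norm (\<lambda>x. Y x $ j)"
      by (intro mult_right_mono L2_norm_mult_bounded X pm p(3)) auto
    also have "\<dots> \<le> (B * sob_norm u X) * sob_norm v Y"
      by (intro mult_mono mult_left_mono sob_norm_ge mult_nonneg_nonneg B0) auto
    finally show "\<bar>\<integral>x. M $ j $ k * ((p x * X x $ k) * Y x $ j) \<partial>torus\<bar> \<le> \<bar>M $ j $ k\<bar> * (B * sob_norm u X * sob_norm v Y)"
      by (simp add: abs_mult mult_left_mono)
  qed
  also have "\<dots> = B * (\<Sum>j\<in>UNIV. \<Sum>k\<in>UNIV. \<bar>M $ j $ k\<bar>) * sob_norm u X * sob_norm v Y"
    unfolding sum_distrib_right[symmetric] by (simp only: mult_ac)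
  finally show ?thesis .
qed

lemma H1_approx_trig:
  fixes u :: "real^'n \<Rightarrow> real"
  assumes "u \<in> L2" "is_weak_gradient u g" "\<delta> > 0"
  obtains w where "trig_poly w" "sob_norm (\<lambda>x. w x - u x) (\<lambda>x. gradient w x - g x) < \<delta>"
proof -
  obtain w where w: "\<And>N. trig_poly (w N)" "(\<lambda>N. L2_norm (\<lambda>x. w N x - u x)) \<longlonglongrightarrow> 0"
    "\<And>j. (\<lambda>N. L2_norm (\<lambda>x. partial j (w N) x - g x $ j)) \<longlonglongrightarrow> 0"
    using H1_dense_trig[OF assms(1,2)] by blast
  have "(\<lambda>N. sob_norm (\<lambda>x. w N x - u x) (\<lambda>x. gradient (w N) x - g x)) \<longlonglongrightarrow> 0 + (\<Sum>j\<in>(UNIV::'n set). 0)"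
    unfolding sob_norm_def by (intro tendsto_add tendsto_sum) (use w in simp_all)
  then have "(\<lambda>N. sob_norm (\<lambda>x. w N x - u x) (\<lambda>x. gradient (w N) x - g x)) \<longlonglongrightarrow> 0" by simp
  then have "\<forall>\<^sub>F N in sequentially. sob_norm (\<lambda>x. w N x - u x) (\<lambda>x. gradient (w N) x - g x) < \<delta>"
    by (rule order_tendstoD) (rule assms(3))
  then obtain N where "sob_norm (\<lambda>x. w N x - u x) (\<lambda>x. gradient (w N) x - g x) < \<delta>"
    by (auto simp: eventually_sequentially)
  then show thesis using that w(1) by blast
qed

lemma approx_trig_uniform:
  fixes f :: "real^'n \<Rightarrow> real"
  assumes "periodic f" "continuous_on UNIV f" "e > 0"
  obtains P where "trig_poly P" "\<And>x. \<bar>f x - P x\<bar> \<le> e"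
proof -
  obtain N where N: "\<And>x. \<bar>conv (kern N) f x - f x\<bar> \<le> e"
    using conv_kern_uniform[OF assms] by (auto simp: eventually_sequentially)
  have "trig_poly (conv (kern N) f)"
    by (rule trig_poly_conv[OF trig_poly_kern L2_integrable[OF L2_continuous[OF assms(1,2)]]])
  then show thesis using that[of "conv (kern N) f"] N by (simp add: abs_minus_commute)
qed

context cell_problem
begin

lemma admissible_coeff_scaled:
  assumes "\<epsilon> \<in> admissible_scales A" "periodic p" "continuous_on UNIV p" "\<And>x. p x > 0"
  shows "admissible_coeff p (\<lambda>x. A (x /\<^sub>R \<epsilon>))"
proof -
  have "periodic (\<lambda>x. A (x /\<^sub>R \<epsilon>) $ j $ k)" for j k
    using A_scaled_periodic[OF assms(1)] by (simp add: periodic_def)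
  moreover have "continuous_on UNIV (\<lambda>x. A (x /\<^sub>R \<epsilon>) $ j $ k)" for j k
    by (rule continuous_scaled[OF C1_continuous[OF entry_C1]])
  ultimately show ?thesis unfolding admissible_coeff_def using assms(2-4) symmetric by blast
qed

lemma admissible_coeff_effective:
  assumes "periodic p" "continuous_on UNIV p" "\<And>x. p x > 0"
  shows "admissible_coeff p (\<lambda>x. effective_matrix A cor)"
  unfolding admissible_coeff_def using assms effective_matrix_symmetric by simp

text \<open>All error sources of one time step at a fixed scale, without limits: \<rho> is the
  consistency error of the expansion, \<open>s\<close> the distance of the weights, \<delta> the H^1
  error of replacing the limit quotient by \<open>w\<close>, \<open>b\<close> the size of the
  correction term, and the difference of the previous densities enters divided by \<tau>. The
  expansion of \<open>w\<close> is compared with the oscillating solution by the residual estimate,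
  and with the limit solution directly.\<close>

lemma scheme_step_estimate:
  fixes p ps prev prevs m ms w P :: "real^'n \<Rightarrow> real"
  defines "K \<equiv> (\<Sum>j\<in>UNIV. \<Sum>k\<in>UNIV. \<bar>effective_matrix A cor $ j $ k\<bar>)"
  assumes \<epsilon>: "\<epsilon> \<in> admissible_scales A" and \<tau>: "\<tau> > 0" and c0: "c0 > 0"
    and p: "periodic p" "continuous_on UNIV p" "\<And>x. c0 \<le> p x" "\<And>x. p x \<le> 1"
    and ps: "periodic ps" "continuous_on UNIV ps" "\<And>x. c0 \<le> ps x" "\<And>x. ps x \<le> 1"
    and s: "\<And>x. \<bar>p x - ps x\<bar> \<le> s"
    and prev: "prev \<in> L2" "prevs \<in> L2" and m: "m \<in> L2" "ms \<in> L2"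
    and g: "is_weak_gradient (\<lambda>x. m x / p x) g" and gs: "is_weak_gradient (\<lambda>x. ms x / ps x) gs"
    and EL: "\<And>\<phi> h. \<phi> \<in> L2 \<Longrightarrow> is_weak_gradient \<phi> h \<Longrightarrow>
      (\<integral>x. flux_form p (\<lambda>x. A (x /\<^sub>R \<epsilon>)) g h x \<partial>torus) + 1 / \<tau> * (\<integral>x. (m x - prev x) * \<phi> x \<partial>torus) = 0"
    and ELs: "\<And>\<phi> h. \<phi> \<in> L2 \<Longrightarrow> is_weak_gradient \<phi> h \<Longrightarrow>
      (\<integral>x. flux_form ps (\<lambda>x. effective_matrix A cor) gs h x \<partial>torus) + 1 / \<tau> * (\<integral>x. (ms x - prevs x) * \<phi> x \<partial>torus) = 0"
    and w: "trig_poly w" "sob_norm (\<lambda>x. w x - ms x / ps x) (\<lambda>x. gradient w x - gs x) \<le> \<delta>"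
    and close: "\<And>x. \<bar>two_scale \<epsilon> w x - w x\<bar> \<le> b"
    and cons: "\<And>\<phi>. trig_poly \<phi> \<Longrightarrow>
      \<bar>flux_gap \<epsilon> p w \<phi>\<bar>
      \<le> \<rho> * sob_norm \<phi> (gradient \<phi>)"
  shows "L2_norm (\<lambda>x. m x - ms x) \<le> (real CARD('n) + 1) *
      (\<rho> + s * K * sob_norm w (gradient w) + K * \<delta> + (b + s * L2_norm w + \<delta> + L2_norm (\<lambda>x. prev x - prevs x)) / \<tau>)
        / (c0 * min \<Lambda>0 (1 / \<tau>)) + b + \<delta> + s * L2_norm (\<lambda>x. ms x / ps x)"
proof -
  define u us where "u = (\<lambda>x. m x / p x)" and "us = (\<lambda>x. ms x / ps x)"
  define z where "z = two_scale \<epsilon> w"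
  define q where "q = L2_norm (\<lambda>x. prev x - prevs x)"
  define \<kappa> where "\<kappa> = \<rho> + s * K * sob_norm w (gradient w) + K * \<delta> + (b + s * L2_norm w + \<delta> + q) / \<tau>"
  let ?Ae = "\<lambda>x. A (x /\<^sub>R \<epsilon>)" and ?As = "\<lambda>x::real^'n. effective_matrix A cor"
  have p0: "p x > 0" "ps x > 0" for x using p(3)[of x] ps(3)[of x] c0 by linarith+
  have pn: "p x \<noteq> 0" "ps x \<noteq> 0" for x using p0[of x] by simp_all
  have pb: "\<bar>p x\<bar> \<le> 1" "\<bar>ps x\<bar> \<le> 1" for x using p0[of x] p(4)[of x] ps(4)[of x] by simp_all
  have pm: "p \<in> borel_measurable torus" "ps \<in> borel_measurable torus" "(\<lambda>x. p x - ps x) \<in> borel_measurable torus"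
    by (intro continuous_measurable_torus continuous_on_diff p(2) ps(2))+
  have adm: "admissible_coeff p ?Ae"
    by (rule admissible_coeff_scaled[OF \<epsilon> p(1,2) p0(1)])
  have uL: "u \<in> L2" "us \<in> L2"
  proof -
    have "(\<lambda>x. 1 / p x * m x) \<in> L2" "(\<lambda>x. 1 / ps x * ms x) \<in> L2"
      using pn by (intro L2_mult_continuous m periodic_compose[OF p(1), of "\<lambda>t. 1 / t"] periodic_compose[OF ps(1), of "\<lambda>t. 1 / t"]
        continuous_on_divide continuous_on_const p(2) ps(2); simp)+
    then show "u \<in> L2" "us \<in> L2" by (simp_all add: u_def us_def)
  qed
  have mu: "p x * u x = m x" "ps x * us x = ms x" for x using pn by (simp_all add: u_def us_def)
  have wL: "w \<in> L2" "partial j w \<in> L2" for j by (rule L2_trig[OF w(1)], rule L2_trig[OF trig_poly_partial[OF w(1)]])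
  have zC: "C1 z" unfolding z_def by (rule two_scale_C1[OF \<epsilon> w(1)])
  have zL: "z \<in> L2" by (rule L2_C1(1)[OF zC])
  have zw: "L2_norm (\<lambda>x. z x - w x) \<le> b"
    by (rule L2_norm_bounded[OF L2D(2)[OF L2_diff[OF zL wL(1)]]]) (use close z_def in simp)
  have wu: "L2_norm (\<lambda>x. w x - us x) \<le> \<delta>"
    using sob_norm_ge(1)[of "\<lambda>x. w x - us x" "\<lambda>x. gradient w x - gs x"] w(2) unfolding us_def by linarith
  have K0: "K \<ge> 0" unfolding K_def by (intro sum_nonneg) auto
  have s0: "s \<ge> 0" using s[of 0] by linarith
  have "L2_norm (\<lambda>x. u x - z x) \<le> (real CARD('n) + 1) * \<kappa> / (c0 * min \<Lambda>0 (1 / \<tau>))"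
  proof (rule residual_estimate[OF adm \<tau> _ _ _ uL(1) g[folded u_def] zC prev(1)])
    \<comment> \<open>One constant for both parts of the form: \<open>c0 * \<Lambda>0\<close> is
      available for the gradients and \<open>c0 / \<tau>\<close> for the zero-order term.\<close>
    show "c0 * min \<Lambda>0 (1 / \<tau>) > 0" using c0 \<Lambda>0_pos \<tau> by simp
    show "c0 * min \<Lambda>0 (1 / \<tau>) * \<tau> \<le> p x" for x
    proof -
      have "min \<Lambda>0 (1 / \<tau>) * \<tau> \<le> 1 / \<tau> * \<tau>" using \<tau> by (intro mult_right_mono) auto
      then have "c0 * (min \<Lambda>0 (1 / \<tau>) * \<tau>) \<le> c0 * 1" using \<tau> c0 by (intro mult_left_mono) auto
      then show ?thesis using p(3)[of x] by (simp add: mult.assoc)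
    qed
    show "c0 * min \<Lambda>0 (1 / \<tau>) * (v \<bullet> v) \<le> (p x *\<^sub>R (?Ae x *v v)) \<bullet> v" for x v
    proof -
      have "min \<Lambda>0 (1 / \<tau>) * (v \<bullet> v) \<le> \<Lambda>0 * (v \<bullet> v)" by (intro mult_right_mono) auto
      also have "\<dots> \<le> v \<bullet> (?Ae x *v v)" by (rule elliptic)
      finally have 1: "min \<Lambda>0 (1 / \<tau>) * (v \<bullet> v) \<le> v \<bullet> (?Ae x *v v)" .
      have "0 \<le> min \<Lambda>0 (1 / \<tau>) * (v \<bullet> v)" using \<Lambda>0_pos \<tau> by (intro mult_nonneg_nonneg) auto
      then have "c0 * (min \<Lambda>0 (1 / \<tau>) * (v \<bullet> v)) \<le> p x * (v \<bullet> (?Ae x *v v))"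
        using 1 p(3)[of x] p0(1)[of x] by (intro mult_mono) auto
      then show ?thesis by (simp add: mult.assoc inner_commute)
    qed
    show "(\<integral>x. flux_form p ?Ae g h x \<partial>torus) + 1 / \<tau> * (\<integral>x. (p x * u x - prev x) * \<phi> x \<partial>torus) = 0"
      if "\<phi> \<in> L2" "is_weak_gradient \<phi> h" for \<phi> h
      unfolding mu by (rule EL[OF that])
    fix \<phi> :: "real^'n \<Rightarrow> real" assume \<phi>: "trig_poly \<phi>"
    let ?N = "sob_norm \<phi> (gradient \<phi>)"
    have \<phi>L: "\<phi> \<in> L2" by (rule L2_trig[OF \<phi>])
    have L: "(\<lambda>x. gradient \<phi> x $ j) \<in> L2" "(\<lambda>x. gradient w x $ j) \<in> L2" "(\<lambda>x. gs x $ j) \<in> L2"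
      "(\<lambda>x. (gradient w x - gs x) $ j) \<in> L2" for j
      using L2_trig[OF trig_poly_partial[OF \<phi>]] wL(2) weak_gradient_L2[OF gs] L2_diff[OF wL(2) weak_gradient_L2[OF gs]]
      by simp_all
    have fi: "integrable torus (flux_form p ?As (gradient w) (gradient \<phi>))" "integrable torus (flux_form ps ?As (gradient w) (gradient \<phi>))"
      "integrable torus (flux_form ps ?As gs (gradient \<phi>))"
      by (intro flux_form_integrable admissible_coeff_effective p(1,2) ps(1,2) p0 L)+
    \<comment> \<open>A chain from the oscillating flux of the expansion to the flux of the limit
      solution, one change at a time: \<open>X1\<close> to \<open>X2\<close> homogenizes the
      coefficient, \<open>X2\<close> to \<open>X3\<close> changes the weight, and \<open>X3\<close>
      to \<open>X4\<close> replaces \<open>w\<close> by the limit quotient. The last member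
      satisfies the limit equation.\<close>
    define X1 X2 X3 X4 where "X1 = (\<integral>x. flux_form p ?Ae (gradient z) (gradient \<phi>) x \<partial>torus)"
      and "X2 = (\<integral>x. flux_form p ?As (gradient w) (gradient \<phi>) x \<partial>torus)"
      and "X3 = (\<integral>x. flux_form ps ?As (gradient w) (gradient \<phi>) x \<partial>torus)"
      and "X4 = (\<integral>x. flux_form ps ?As gs (gradient \<phi>) x \<partial>torus)"
    define Y1 Y4 where "Y1 = (\<integral>x. (p x * z x - prev x) * \<phi> x \<partial>torus)" and "Y4 = (\<integral>x. (ms x - prevs x) * \<phi> x \<partial>torus)"
    have 12: "\<bar>X1 - X2\<bar> \<le> \<rho> * ?N" unfolding X1_def X2_def z_def flux_gap_def[symmetric] by (rule cons[OF \<phi>])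
    have 23: "\<bar>X2 - X3\<bar> \<le> s * K * sob_norm w (gradient w) * ?N"
    proof -
      have "X2 - X3 = (\<integral>x. flux_form (\<lambda>x. p x - ps x) ?As (gradient w) (gradient \<phi>) x \<partial>torus)"
        unfolding X2_def X3_def Bochner_Integration.integral_diff[OF fi(1,2), symmetric]
        by (intro Bochner_Integration.integral_cong refl) (simp add: flux_form_def left_diff_distrib)
      then show ?thesis
        unfolding K_def by (simp only:) (intro flux_form_const_bound periodic_diff continuous_on_diff p(1,2) ps(1,2) s L)
    qed
    have 34: "\<bar>X3 - X4\<bar> \<le> K * \<delta> * ?N"
    proof -
      have "X3 - X4 = (\<integral>x. flux_form ps ?As (\<lambda>x. gradient w x - gs x) (gradient \<phi>) x \<partial>torus)"
        unfolding X3_def X4_def Bochner_Integration.integral_diff[OF fi(2,3), symmetric]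
        by (intro Bochner_Integration.integral_cong refl)
          (simp add: flux_form_def matrix_vector_mult_diff_distrib inner_diff_left right_diff_distrib)
      also have "\<bar>\<dots>\<bar> \<le> 1 * K * sob_norm (\<lambda>x. w x - us x) (\<lambda>x. gradient w x - gs x) * ?N"
        unfolding K_def by (intro flux_form_const_bound ps(1,2) pb L)
      also have "\<dots> \<le> 1 * K * \<delta> * ?N"
        using w(2) K0 unfolding us_def by (intro mult_right_mono mult_left_mono sob_norm_ge) auto
      finally show ?thesis by simp
    qed
    have 4: "X4 + 1 / \<tau> * Y4 = 0"
      unfolding X4_def Y4_def by (rule ELs[OF \<phi>L C1_weak_gradient[OF trig_poly_C1[OF \<phi>]]])
    have Y: "\<bar>Y1 - Y4\<bar> \<le> (b + s * L2_norm w + \<delta> + q) * ?N"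
    proof -
      \<comment> \<open>The zero-order difference telescopes in the same way: expansion against
        \<open>w\<close>, change of weight, \<open>w\<close> against the limit quotient, and change
        of the previous density.\<close>
      let ?a = "\<lambda>x. p x * (z x - w x)" and ?b = "\<lambda>x. (p x - ps x) * w x" and ?c = "\<lambda>x. ps x * (w x - us x)" and ?d = "\<lambda>x. prevs x - prev x"
      have aL: "?a \<in> L2" "?b \<in> L2" "?c \<in> L2" "?d \<in> L2"
        by (intro L2_mult_continuous L2_diff zL wL(1) uL prev p(1,2) ps(1,2) periodic_diff continuous_on_diff)+
      have i: "integrable torus (\<lambda>x. (p x * z x - prev x) * \<phi> x)" "integrable torus (\<lambda>x. (ms x - prevs x) * \<phi> x)"
        by (intro L2_integrable_mult L2_diff L2_mult_continuous zL p(1,2) prev m \<phi>L)+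
      have YY: "Y1 - Y4 = (\<integral>x. (?a x + ?b x + ?c x + ?d x) * \<phi> x \<partial>torus)"
        unfolding Y1_def Y4_def Bochner_Integration.integral_diff[OF i, symmetric]
        by (intro Bochner_Integration.integral_cong refl) (simp add: mu(2)[symmetric] algebra_simps)
      have "\<bar>Y1 - Y4\<bar> \<le> L2_norm (\<lambda>x. ?a x + ?b x + ?c x + ?d x) * L2_norm \<phi>"
        unfolding YY by (rule L2_Cauchy_Schwarz[OF L2_add[OF L2_add[OF L2_add[OF aL(1,2)] aL(3)] aL(4)] \<phi>L])
      also have "\<dots> \<le> (b + s * L2_norm w + \<delta> + q) * ?N"
      proof (rule mult_mono)
        have "L2_norm (\<lambda>x. ?a x + ?b x + ?c x + ?d x) \<le> L2_norm (\<lambda>x. ?a x + ?b x + ?c x) + L2_norm ?d"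
          by (intro L2_norm_triangle L2_add aL)
        moreover have "L2_norm (\<lambda>x. ?a x + ?b x + ?c x) \<le> L2_norm (\<lambda>x. ?a x + ?b x) + L2_norm ?c"
          by (intro L2_norm_triangle L2_add aL)
        moreover have "L2_norm (\<lambda>x. ?a x + ?b x) \<le> L2_norm ?a + L2_norm ?b"
          by (intro L2_norm_triangle aL)
        moreover have "L2_norm ?a \<le> 1 * L2_norm (\<lambda>x. z x - w x)"
          by (intro L2_norm_mult_bounded L2_diff zL wL(1) pm pb)
        moreover have "L2_norm ?b \<le> s * L2_norm w"
          by (intro L2_norm_mult_bounded wL(1) pm s)
        moreover have "L2_norm ?c \<le> 1 * L2_norm (\<lambda>x. w x - us x)"
          by (intro L2_norm_mult_bounded L2_diff uL wL(1) pm pb)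
        moreover have "L2_norm ?d = q" unfolding q_def by (rule L2_norm_uminus)
        ultimately show le: "L2_norm (\<lambda>x. ?a x + ?b x + ?c x + ?d x) \<le> b + s * L2_norm w + \<delta> + q"
          using zw wu by linarith
        then show "0 \<le> b + s * L2_norm w + \<delta> + q" using L2_norm_nonneg order_trans by blast
      qed (rule sob_norm_ge, simp)
      finally show ?thesis .
    qed
    have "X1 + 1 / \<tau> * Y1 = (X1 - X2) + (X2 - X3) + (X3 - X4) + 1 / \<tau> * (Y1 - Y4)"
      unfolding right_diff_distrib[of "1 / \<tau>"] using 4 by linarith
    also have "\<bar>\<dots>\<bar> \<le> \<bar>X1 - X2\<bar> + \<bar>X2 - X3\<bar> + \<bar>X3 - X4\<bar> + 1 / \<tau> * \<bar>Y1 - Y4\<bar>"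
    proof -
      have "\<bar>1 / \<tau> * (Y1 - Y4)\<bar> = 1 / \<tau> * \<bar>Y1 - Y4\<bar>" using \<tau> by (simp add: abs_mult)
      moreover have "\<bar>a + b + c + d\<bar> \<le> \<bar>a\<bar> + \<bar>b\<bar> + \<bar>c\<bar> + \<bar>d\<bar>" for a b c d :: real by linarith
      ultimately show ?thesis by metis
    qed
    also have "\<dots> \<le> \<rho> * ?N + s * K * sob_norm w (gradient w) * ?N + K * \<delta> * ?N + 1 / \<tau> * ((b + s * L2_norm w + \<delta> + q) * ?N)"
      using \<tau> by (intro add_mono 12 23 34 mult_left_mono Y) auto
    also have "\<dots> = \<kappa> * ?N" by (simp add: \<kappa>_def distrib_right)
    finally show "\<bar>(\<integral>x. flux_form p ?Ae (gradient z) (gradient \<phi>) x \<partial>torus) + 1 / \<tau> * (\<integral>x. (p x * z x - prev x) * \<phi> x \<partial>torus)\<bar> \<le> \<kappa> * ?N"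
      unfolding X1_def Y1_def .
  qed
  moreover have "L2_norm (\<lambda>x. m x - ms x) \<le> L2_norm (\<lambda>x. u x - z x) + b + \<delta> + s * L2_norm us"
  proof -
    \<comment> \<open>Back from quotients to densities: since the weights differ, a multiple of the
      limit quotient with factor \<open>p - ps\<close> remains.\<close>
    have "L2_norm (\<lambda>x. m x - ms x) = L2_norm (\<lambda>x. p x * (u x - us x) + (p x - ps x) * us x)"
      by (intro arg_cong[of _ _ L2_norm] ext) (simp add: mu[symmetric] algebra_simps)
    also have "\<dots> \<le> L2_norm (\<lambda>x. p x * (u x - us x)) + L2_norm (\<lambda>x. (p x - ps x) * us x)"
      by (intro L2_norm_triangle L2_mult_continuous L2_diff uL p(1,2) ps(1,2) periodic_diff continuous_on_diff)
    also have "\<dots> \<le> 1 * L2_norm (\<lambda>x. u x - us x) + s * L2_norm us"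
      by (intro add_mono L2_norm_mult_bounded L2_diff uL pm pb s)
    finally have "L2_norm (\<lambda>x. m x - ms x) \<le> L2_norm (\<lambda>x. u x - us x) + s * L2_norm us" by simp
    moreover have "L2_norm (\<lambda>x. u x - us x) \<le> L2_norm (\<lambda>x. u x - z x) + L2_norm (\<lambda>x. z x - us x)"
      by (intro L2_norm_triangle_diff uL zL)
    moreover have "L2_norm (\<lambda>x. z x - us x) \<le> L2_norm (\<lambda>x. z x - w x) + L2_norm (\<lambda>x. w x - us x)"
      by (intro L2_norm_triangle_diff uL zL wL(1))
    ultimately show ?thesis using zw wu by linarith
  qed
  ultimately show ?thesis unfolding \<kappa>_def q_def us_def by linarith
qed

text \<open>The parameters of the one-step estimate are chosen in the order forced by their
  dependence: \<delta> from \<open>e\<close>, then \<open>w\<close>, then \<open>C\<close>, then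
  \<open>P\<close>, then \<open>C'\<close>, then the tolerance \<open>s\<close> for the weights, and
  the scale last. Three groups of errors contribute at most \<open>e / 4\<close> each. Convergence
  of the previous densities is an assumption and that of the new ones the conclusion, which fits an
  induction over the steps.\<close>

lemma scheme_step_convergence:
  fixes p :: "real \<Rightarrow> real^'n \<Rightarrow> real" and ps :: "real^'n \<Rightarrow> real"
  assumes E: "E \<subseteq> admissible_scales A" and \<tau>: "\<tau> > 0" and c0: "c0 > 0"
    and p: "\<And>\<epsilon>. \<epsilon> \<in> E \<Longrightarrow> periodic (p \<epsilon>)" "\<And>\<epsilon>. \<epsilon> \<in> E \<Longrightarrow> continuous_on UNIV (p \<epsilon>)"
      "\<And>\<epsilon> x. \<epsilon> \<in> E \<Longrightarrow> c0 \<le> p \<epsilon> x" "\<And>\<epsilon> x. \<epsilon> \<in> E \<Longrightarrow> p \<epsilon> x \<le> 1"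
    and ps: "periodic ps" "continuous_on UNIV ps" "\<And>x. c0 \<le> ps x" "\<And>x. ps x \<le> 1"
    and lim: "uniform_limit UNIV p ps (at 0 within E)"
    and mul: "\<And>\<epsilon> u. \<epsilon> \<in> E \<Longrightarrow> u \<in> H1 \<Longrightarrow> (\<lambda>x. p \<epsilon> x * u x) \<in> H1" "\<And>\<epsilon> u. \<epsilon> \<in> E \<Longrightarrow> u \<in> H1 \<Longrightarrow> (\<lambda>x. u x / p \<epsilon> x) \<in> H1"
    and muls: "\<And>u. u \<in> H1 \<Longrightarrow> (\<lambda>x. ps x * u x) \<in> H1" "\<And>u. u \<in> H1 \<Longrightarrow> (\<lambda>x. u x / ps x) \<in> H1"
    and prev: "\<And>\<epsilon>. \<epsilon> \<in> E \<Longrightarrow> prev \<epsilon> \<in> L2" "prevs \<in> L2"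
      "((\<lambda>\<epsilon>. L2_norm (\<lambda>x. prev \<epsilon> x - prevs x)) \<longlongrightarrow> 0) (at 0 within E)"
    and min: "\<And>\<epsilon>. \<epsilon> \<in> E \<Longrightarrow> is_arg_min (\<lambda>\<nu>. energy (p \<epsilon>) (\<lambda>x. A (x /\<^sub>R \<epsilon>)) \<nu> + 1 / (2 * \<tau>) * (weighted_dist (p \<epsilon>) \<nu> (prev \<epsilon>))\<^sup>2) (\<lambda>\<nu>. \<nu> \<in> H1) (m \<epsilon>)"
    and mins: "is_arg_min (\<lambda>\<nu>. energy ps (\<lambda>x. effective_matrix A cor) \<nu> + 1 / (2 * \<tau>) * (weighted_dist ps \<nu> prevs)\<^sup>2) (\<lambda>\<nu>. \<nu> \<in> H1) ms"
  shows "((\<lambda>\<epsilon>. L2_norm (\<lambda>x. m \<epsilon> x - ms x)) \<longlongrightarrow> 0) (at 0 within E)"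
proof (rule tendstoI)
  fix e :: real assume e: "e > 0"
  define K where "K = (\<Sum>j\<in>UNIV. \<Sum>k\<in>UNIV. \<bar>effective_matrix A cor $ j $ k\<bar>)"
  define D where "D = (real CARD('n) + 1) / (c0 * min \<Lambda>0 (1 / \<tau>))"
  have D0: "D \<ge> 0" unfolding D_def using c0 \<Lambda>0_pos \<tau> by (intro divide_nonneg_pos) auto
  have K0: "K \<ge> 0" unfolding K_def by (intro sum_nonneg) auto
  have \<epsilon>adm: "\<epsilon> \<in> admissible_scales A" if "\<epsilon> \<in> E" for \<epsilon> using that E by blast
  have mH: "m \<epsilon> \<in> H1" if "\<epsilon> \<in> E" for \<epsilon> using min[OF that] by (simp add: is_arg_min_def)
  have msH: "ms \<in> H1" using mins by (simp add: is_arg_min_def)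
  have mL: "m \<epsilon> \<in> L2" if "\<epsilon> \<in> E" for \<epsilon> using mH[OF that] by (simp add: H1_def)
  have msL: "ms \<in> L2" using msH by (simp add: H1_def)
  define us gs where "us = (\<lambda>x. ms x / ps x)" and "gs = weak_gradient (\<lambda>x. ms x / ps x)"
  have usH: "us \<in> H1" unfolding us_def by (rule muls(2)[OF msH])
  have usL: "us \<in> L2" using usH by (simp add: H1_def)
  have gs: "is_weak_gradient us gs" unfolding gs_def us_def[symmetric] by (rule weak_gradient_is[OF usH])
  \<comment> \<open>Chosen so that all contributions proportional to \<delta>, with total
    coefficient \<open>D * (K + 1 / \<tau> + 1) + 1\<close>, add up to exactly
    \<open>e / 4\<close>.\<close>
  define \<delta> where "\<delta> = e / (4 * (D * (K + 1 / \<tau> + 1) + 1))"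
  have D1: "D * (K + 1 / \<tau> + 1) \<ge> 0" using D0 K0 \<tau> by (intro mult_nonneg_nonneg add_nonneg_nonneg) auto
  have \<delta>0: "\<delta> > 0" unfolding \<delta>_def using e D1 by (intro divide_pos_pos) auto
  have \<delta>e: "(D * (K + 1 / \<tau> + 1) + 1) * \<delta> = e / 4"
  proof -
    have "c * (e / (4 * c)) = e / 4" if "c > 0" for c :: real using that by simp
    from this[of "D * (K + 1 / \<tau> + 1) + 1"] show ?thesis unfolding \<delta>_def using D1 by linarith
  qed
  obtain w where w: "trig_poly w" "sob_norm (\<lambda>x. w x - us x) (\<lambda>x. gradient w x - gs x) < \<delta>"
    using H1_approx_trig[OF usL gs \<delta>0] by blast
  obtain C where C: "C \<ge> 0" "\<And>P. trig_poly P \<Longrightarrow> \<exists>C'\<ge>0. \<forall>\<epsilon> p \<delta> \<phi>. \<epsilon> \<in> admissible_scales A \<longrightarrow> periodic p \<longrightarrow>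
    continuous_on UNIV p \<longrightarrow> (\<forall>x. \<bar>p x\<bar> \<le> 1) \<longrightarrow> (\<forall>x. \<bar>p x - P x\<bar> \<le> \<delta>) \<longrightarrow> trig_poly \<phi> \<longrightarrow>
    \<bar>flux_gap \<epsilon> p w \<phi>\<bar>
    \<le> (C * \<delta> + C' * \<epsilon>) * sob_norm \<phi> (gradient \<phi>)"
    using two_scale_consistency[OF w(1)] by blast
  \<comment> \<open>The tolerance for \<open>P\<close> makes \<open>C * (\<delta> / (1 + C))\<close>
    at most \<delta>; it may depend on \<open>C\<close> because \<open>C\<close> was fixed by
    \<open>w\<close> alone.\<close>
  have "\<delta> / (1 + C) > 0" using \<delta>0 C(1) by simp
  then obtain P where P: "trig_poly P" "\<And>x. \<bar>ps x - P x\<bar> \<le> \<delta> / (1 + C)"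
    using approx_trig_uniform[OF ps(1,2)] by blast
  obtain C' where C': "C' \<ge> 0" "\<And>\<epsilon> p \<delta> \<phi>. \<epsilon> \<in> admissible_scales A \<Longrightarrow> periodic p \<Longrightarrow>
    continuous_on UNIV p \<Longrightarrow> (\<forall>x. \<bar>p x\<bar> \<le> 1) \<Longrightarrow> (\<forall>x. \<bar>p x - P x\<bar> \<le> \<delta>) \<Longrightarrow> trig_poly \<phi> \<Longrightarrow>
    \<bar>flux_gap \<epsilon> p w \<phi>\<bar>
    \<le> (C * \<delta> + C' * \<epsilon>) * sob_norm \<phi> (gradient \<phi>)"
    using C(2)[OF P(1)] by blast
  obtain Cw where Cw: "Cw \<ge> 0" "\<And>\<epsilon> x. \<epsilon> > 0 \<Longrightarrow> \<bar>two_scale \<epsilon> w x - w x\<bar> \<le> Cw * \<epsilon>"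
    using two_scale_close[OF w(1)] by blast
  \<comment> \<open>The total coefficient of the weight distance. Its summand \<open>C\<close>
    arises because the weight at scale \<epsilon> is within \<open>s + \<delta> / (1 + C)\<close> of
    \<open>P\<close>.\<close>
  define S where "S = D * (C + K * sob_norm w (gradient w) + L2_norm w / \<tau>) + L2_norm us"
  have S0: "S \<ge> 0" unfolding S_def using D0 C(1) K0 \<tau> sob_norm_ge(3)[of w "gradient w"]
    by (intro add_nonneg_nonneg mult_nonneg_nonneg divide_nonneg_pos) auto
  define s where "s = e / (4 * (S + 1))"
  have s0: "s > 0" unfolding s_def using e S0 by simp
  have Ss: "S * s \<le> e / 4"
  proof -
    have "S * s \<le> (S + 1) * s" using s0 by simp
    also have "\<dots> = e / 4"
    proof -
      have "c * (e / (4 * c)) = e / 4" if "c > 0" for c :: real using that by simp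
      from this[of "S + 1"] show ?thesis unfolding s_def using S0 by linarith
    qed
    finally show ?thesis .
  qed
  \<comment> \<open>What vanishes as \<epsilon> tends to 0 once \<open>w\<close> and
    \<open>P\<close> are fixed: the terms proportional to \<epsilon> and the error inherited from
    the previous step.\<close>
  define R where "R = (\<lambda>\<epsilon>. D * (C' * \<epsilon> + (Cw * \<epsilon> + L2_norm (\<lambda>x. prev \<epsilon> x - prevs x)) / \<tau>) + Cw * \<epsilon>)"
  have "(R \<longlongrightarrow> D * (C' * 0 + (Cw * 0 + 0) / \<tau>) + Cw * 0) (at 0 within E)"
    unfolding R_def using \<tau> by (intro tendsto_add tendsto_mult tendsto_divide tendsto_const prev(3) tendsto_ident_at) auto
  then have "(R \<longlongrightarrow> 0) (at 0 within E)" by simp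
  then have "\<forall>\<^sub>F \<epsilon> in at 0 within E. R \<epsilon> < e / 4"
    by (rule order_tendstoD) (use e in simp)
  moreover have "\<forall>\<^sub>F \<epsilon> in at 0 within E. \<forall>x\<in>UNIV. dist (p \<epsilon> x) (ps x) < s"
    using lim s0 by (rule uniform_limitD)
  moreover have "\<forall>\<^sub>F \<epsilon> in at 0 within E. \<epsilon> \<in> E" by (simp add: eventually_at_filter)
  ultimately show "\<forall>\<^sub>F \<epsilon> in at 0 within E. dist (L2_norm (\<lambda>x. m \<epsilon> x - ms x)) 0 < e"
  proof eventually_elim
    case (elim \<epsilon>)
    have \<epsilon>E: "\<epsilon> \<in> E" by (rule elim(3))
    have \<epsilon>0: "\<epsilon> > 0" by (rule \<epsilon>_pos[OF \<epsilon>adm[OF \<epsilon>E]])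
    have pss: "\<bar>p \<epsilon> x - ps x\<bar> \<le> s" for x using elim(2) by (simp add: dist_real_def less_imp_le)
    have p0: "p \<epsilon> x > 0" "ps x > 0" for x using p(3)[OF \<epsilon>E, of x] ps(3)[of x] c0 by linarith+
    have pb: "\<forall>x. \<bar>p \<epsilon> x\<bar> \<le> 1"
    proof
      fix x show "\<bar>p \<epsilon> x\<bar> \<le> 1" using p0(1)[of x] p(4)[OF \<epsilon>E, of x] by linarith
    qed
    have adm: "admissible_coeff (p \<epsilon>) (\<lambda>x. A (x /\<^sub>R \<epsilon>))"
      by (rule admissible_coeff_scaled[OF \<epsilon>adm[OF \<epsilon>E] p(1,2)[OF \<epsilon>E] p0(1)])
    have adms: "admissible_coeff ps (\<lambda>x. effective_matrix A cor)"
      by (rule admissible_coeff_effective[OF ps(1,2) p0(2)])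
    define g where "g = weak_gradient (\<lambda>x. m \<epsilon> x / p \<epsilon> x)"
    have g: "is_weak_gradient (\<lambda>x. m \<epsilon> x / p \<epsilon> x) g"
      unfolding g_def by (rule weak_gradient_is[OF mul(2)[OF \<epsilon>E mH[OF \<epsilon>E]]])
    have "L2_norm (\<lambda>x. m \<epsilon> x - ms x) \<le> (real CARD('n) + 1) *
      ((C * (s + \<delta> / (1 + C)) + C' * \<epsilon>) + s * K * sob_norm w (gradient w) + K * \<delta>
        + (Cw * \<epsilon> + s * L2_norm w + \<delta> + L2_norm (\<lambda>x. prev \<epsilon> x - prevs x)) / \<tau>)
        / (c0 * min \<Lambda>0 (1 / \<tau>)) + Cw * \<epsilon> + \<delta> + s * L2_norm (\<lambda>x. ms x / ps x)"
      unfolding K_def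
    proof (rule scheme_step_estimate[OF \<epsilon>adm[OF \<epsilon>E] \<tau> c0 p(1,2)[OF \<epsilon>E] p(3,4)[OF \<epsilon>E] ps pss prev(1)[OF \<epsilon>E] prev(2)
          mL[OF \<epsilon>E] msL g gs[unfolded us_def] _ _ w(1)])
      show "sob_norm (\<lambda>x. w x - ms x / ps x) (\<lambda>x. gradient w x - gs x) \<le> \<delta>" using w(2) by (simp add: us_def)
      show "\<bar>two_scale \<epsilon> w x - w x\<bar> \<le> Cw * \<epsilon>" for x by (rule Cw(2)[OF \<epsilon>0])
      show "(\<integral>x. flux_form (p \<epsilon>) (\<lambda>x. A (x /\<^sub>R \<epsilon>)) g h x \<partial>torus) + 1 / \<tau> * (\<integral>x. (m \<epsilon> x - prev \<epsilon> x) * \<phi> x \<partial>torus) = 0"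
        if "\<phi> \<in> L2" "is_weak_gradient \<phi> h" for \<phi> h
        by (rule euler_lagrange[OF adm mul(1)[OF \<epsilon>E] mul(2)[OF \<epsilon>E] prev(1)[OF \<epsilon>E] \<tau> min[OF \<epsilon>E] g that])
      show "(\<integral>x. flux_form ps (\<lambda>x. effective_matrix A cor) gs h x \<partial>torus) + 1 / \<tau> * (\<integral>x. (ms x - prevs x) * \<phi> x \<partial>torus) = 0"
        if "\<phi> \<in> L2" "is_weak_gradient \<phi> h" for \<phi> h
        by (rule euler_lagrange[OF adms muls prev(2) \<tau> mins gs[unfolded us_def] that])
      fix \<phi> :: "real^'n \<Rightarrow> real" assume \<phi>: "trig_poly \<phi>"
      have "\<forall>x. \<bar>p \<epsilon> x - P x\<bar> \<le> s + \<delta> / (1 + C)"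
      proof
        fix x show "\<bar>p \<epsilon> x - P x\<bar> \<le> s + \<delta> / (1 + C)" using pss[of x] P(2)[of x] by linarith
      qed
      then show "\<bar>flux_gap \<epsilon> (p \<epsilon>) w \<phi>\<bar>
        \<le> (C * (s + \<delta> / (1 + C)) + C' * \<epsilon>) * sob_norm \<phi> (gradient \<phi>)"
        by (rule C'(2)[OF \<epsilon>adm[OF \<epsilon>E] p(1,2)[OF \<epsilon>E] pb _ \<phi>])
    qed
    also have "\<dots> = D * (C * (\<delta> / (1 + C)) + K * \<delta> + \<delta> / \<tau>) + \<delta> + S * s + R \<epsilon>"
      by (simp add: D_def S_def R_def us_def algebra_simps add_divide_distrib)
    also have "\<dots> \<le> D * (\<delta> + K * \<delta> + \<delta> / \<tau>) + \<delta> + S * s + R \<epsilon>"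
    proof -
      have "C * (\<delta> / (1 + C)) \<le> \<delta>" using C(1) \<delta>0 by (simp add: field_simps)
      then have "D * (C * (\<delta> / (1 + C)) + K * \<delta> + \<delta> / \<tau>) \<le> D * (\<delta> + K * \<delta> + \<delta> / \<tau>)"
        by (intro mult_left_mono D0) simp
      then show ?thesis by simp
    qed
    also have "D * (\<delta> + K * \<delta> + \<delta> / \<tau>) + \<delta> = (D * (K + 1 / \<tau> + 1) + 1) * \<delta>"
      by (simp add: algebra_simps)
    also have "\<dots> + S * s + R \<epsilon> < e" unfolding \<delta>e using Ss elim(1) e by argo
    finally show ?case by simp
  qed
qed

end

section \<open>Induction over the time steps and passage to the piecewise constant
  interpolants\<close>

theorem theorem1p4:
  fixes A :: "real^'n \<Rightarrow> real^'n^'n"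
    and \<Lambda>0 \<Lambda>1 lam \<tau> :: real
    and E :: "real set"
    and V\<epsilon> :: "real \<Rightarrow> real^'n \<Rightarrow> real"
    and V :: "real^'n \<Rightarrow> real"
    and cor :: "'n \<Rightarrow> real^'n \<Rightarrow> real"
    and \<mu>0 :: "real^'n \<Rightarrow> real"
    and \<mu>\<epsilon> :: "real \<Rightarrow> real \<Rightarrow> real^'n \<Rightarrow> real"
    and \<mu> :: "real \<Rightarrow> real^'n \<Rightarrow> real"
  assumes A_periodic: "periodic A"
    and A_C2: "\<And>j k. Ck 2 (\<lambda>x. A x $ j $ k)"
    and A_elliptic: "\<Lambda>0 > 0" "\<Lambda>1 > 0"
      "\<And>x. loewner_le (mat \<Lambda>0) (A x)" "\<And>x. loewner_le (A x) (mat \<Lambda>1)"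
    and scales: "E \<subseteq> admissible_scales A" "0 islimpt E"
    and V\<epsilon>_C1: "\<And>\<epsilon>. \<epsilon> \<in> E \<Longrightarrow> periodic (V\<epsilon> \<epsilon>) \<and> Ck 1 (V\<epsilon> \<epsilon>)"
    and V\<epsilon>_nonneg: "\<And>\<epsilon> x. \<epsilon> \<in> E \<Longrightarrow> V\<epsilon> \<epsilon> x \<ge> 0"
    and lambda_pos: "lam > 0"
    and V\<epsilon>_bounded: "\<And>\<epsilon> x. \<epsilon> \<in> E \<Longrightarrow> V\<epsilon> \<epsilon> x \<le> lam \<and> norm (gradient (V\<epsilon> \<epsilon>) x) \<le> lam"
    and V_periodic: "periodic V"
    and V\<epsilon>_limit: "uniform_limit UNIV V\<epsilon> V (at 0 within E)"
    and corrector: "cell_solution A cor"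
    and tau_pos: "\<tau> > 0"
    and initial: "\<mu>0 \<in> H1"
    and scheme_eps: "\<And>\<epsilon>. \<epsilon> \<in> E \<Longrightarrow>
      weighted_L2_scheme (\<lambda>x. exp (- V\<epsilon> \<epsilon> x)) (\<lambda>x. A (x /\<^sub>R \<epsilon>)) \<tau> \<mu>0 (\<mu>\<epsilon> \<epsilon>)"
    and scheme_lim:
      "weighted_L2_scheme (\<lambda>x. exp (- V x)) (\<lambda>x. effective_matrix A cor) \<tau> \<mu>0 \<mu>"
  shows "\<forall>t>0. ((\<lambda>\<epsilon>. L2_norm (\<lambda>x. \<mu>\<epsilon> \<epsilon> t x - \<mu> t x)) \<longlongrightarrow> 0) (at 0 within E)"
proof -
  interpret cell_problem A cor \<Lambda>0
  proof
    fix x :: "real^'n" and v :: "real^'n" and j k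
    have "v \<bullet> (mat \<Lambda>0 *v v) = \<Lambda>0 * (v \<bullet> v)"
      by (simp add: inner_vec_def matrix_vector_mult_def mat_def if_distrib[of "\<lambda>a. a * _"] sum_distrib_left mult.left_commute cong: if_cong)
    then show "\<Lambda>0 * (v \<bullet> v) \<le> v \<bullet> (A x *v v)"
      using A_elliptic(3)[of x] unfolding loewner_le_def by metis
    have "transpose (A x) = A x" using A_elliptic(3)[of x] by (simp add: loewner_le_def)
    then have "transpose (A x) $ j $ k = A x $ j $ k" by simp
    then show "A x $ j $ k = A x $ k $ j" by (simp add: transpose_def)
  qed (use A_periodic A_C2 A_elliptic corrector in auto)
  \<comment> \<open>Since 0 is a limit point of \<open>E\<close>, the filter is proper, and
    continuity and bounds pass from the potentials at scale \<epsilon> to their uniform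
    limit.\<close>
  have nontriv: "at 0 within E \<noteq> bot" using scales(2) by (simp add: trivial_limit_within)
  have VC: "C1 (V\<epsilon> \<epsilon>)" if "\<epsilon> \<in> E" for \<epsilon> using V\<epsilon>_C1[OF that] C1_iff_Ck by blast
  have inE: "\<forall>\<^sub>F \<epsilon> in at 0 within E. \<epsilon> \<in> E" by (simp add: eventually_at_filter)
  have V_cont: "continuous_on UNIV V"
  proof (rule uniform_limit_theorem[OF _ V\<epsilon>_limit nontriv])
    show "\<forall>\<^sub>F \<epsilon> in at 0 within E. continuous_on UNIV (V\<epsilon> \<epsilon>)"
      using inE by eventually_elim (rule C1_continuous[OF VC])
  qed
  have near: "\<exists>\<epsilon>\<in>E. \<forall>x. \<bar>V\<epsilon> \<epsilon> x - V x\<bar> \<le> r" if "r > 0" for r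
  proof -
    have "\<forall>\<^sub>F \<epsilon> in at 0 within E. \<forall>x\<in>UNIV. dist (V\<epsilon> \<epsilon> x) (V x) < r"
      using V\<epsilon>_limit that by (rule uniform_limitD)
    with inE have "\<forall>\<^sub>F \<epsilon> in at 0 within E. \<epsilon> \<in> E \<and> (\<forall>x\<in>UNIV. dist (V\<epsilon> \<epsilon> x) (V x) < r)"
      by (rule eventually_conj)
    then obtain \<epsilon> where "\<epsilon> \<in> E" "\<forall>x. dist (V\<epsilon> \<epsilon> x) (V x) < r"
      using eventually_happens'[OF nontriv] by blast
    then show ?thesis by (auto simp: dist_real_def less_imp_le intro!: bexI[of _ \<epsilon>])
  qed
  have V_lim: "((\<lambda>\<epsilon>. V\<epsilon> \<epsilon> x) \<longlongrightarrow> V x) (at 0 within E)" for x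
    by (rule tendsto_uniform_limitI[OF V\<epsilon>_limit]) simp
  have V0: "V x \<ge> 0" for x
    by (rule tendsto_lowerbound[OF V_lim _ nontriv]) (use inE in eventually_elim, simp add: V\<epsilon>_nonneg)
  have Vlam: "V x \<le> lam" for x
    by (rule tendsto_upperbound[OF V_lim _ nontriv]) (use inE in eventually_elim, simp add: V\<epsilon>_bounded)
  have partial_bound: "\<bar>partial j (V\<epsilon> \<epsilon>) x\<bar> \<le> lam" if "\<epsilon> \<in> E" for \<epsilon> j x
    using component_le_norm_cart[of "gradient (V\<epsilon> \<epsilon>) x" j] V\<epsilon>_bounded[OF that, of x] by simp
  \<comment> \<open>The potentials at small scales are themselves the approximants of
    \<open>V\<close> with a common bound on the partial derivatives.\<close>
  have approx: "\<exists>q. C1 q \<and> (\<forall>j x. \<bar>partial j q x\<bar> \<le> lam) \<and> (\<forall>x. \<bar>q x - V x\<bar> \<le> 1 / real (Suc k))" for k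
  proof -
    have "1 / real (Suc k) > 0" by simp
    from near[OF this] obtain \<epsilon> where "\<epsilon> \<in> E" "\<forall>x. \<bar>V\<epsilon> \<epsilon> x - V x\<bar> \<le> 1 / real (Suc k)" by blast
    then show ?thesis using VC partial_bound by blast
  qed
  have Vabs: "\<bar>V x\<bar> \<le> lam" for x using V0[of x] Vlam[of x] by simp
  define p ps where "p = (\<lambda>\<epsilon> x. exp (- V\<epsilon> \<epsilon> x))" and "ps = (\<lambda>x. exp (- V x))"
  have step: "((\<lambda>\<epsilon>. L2_norm (\<lambda>x. m \<epsilon> x - ms x)) \<longlongrightarrow> 0) (at 0 within E)"
    if prev: "\<And>\<epsilon>. \<epsilon> \<in> E \<Longrightarrow> prev \<epsilon> \<in> L2" "prevs \<in> L2" "((\<lambda>\<epsilon>. L2_norm (\<lambda>x. prev \<epsilon> x - prevs x)) \<longlongrightarrow> 0) (at 0 within E)"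
    and min: "\<And>\<epsilon>. \<epsilon> \<in> E \<Longrightarrow> is_arg_min (\<lambda>\<nu>. energy (p \<epsilon>) (\<lambda>x. A (x /\<^sub>R \<epsilon>)) \<nu> + 1 / (2 * \<tau>) * (weighted_dist (p \<epsilon>) \<nu> (prev \<epsilon>))\<^sup>2) (\<lambda>\<nu>. \<nu> \<in> H1) (m \<epsilon>)"
    and mins: "is_arg_min (\<lambda>\<nu>. energy ps (\<lambda>x. effective_matrix A cor) \<nu> + 1 / (2 * \<tau>) * (weighted_dist ps \<nu> prevs)\<^sup>2) (\<lambda>\<nu>. \<nu> \<in> H1) ms"
    for prev m :: "real \<Rightarrow> real^'n \<Rightarrow> real" and prevs ms
  proof (rule scheme_step_convergence[OF scales(1) tau_pos _ _ _ _ _ _ _ _ _ _ _ _ _ _ prev min mins])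
    show "exp (- lam) > 0" by simp
    show "periodic (p \<epsilon>)" "continuous_on UNIV (p \<epsilon>)" if "\<epsilon> \<in> E" for \<epsilon>
      using C1_exp(1)[OF VC[OF that], of "-1"] C1_continuous[OF C1_exp(1)[OF VC[OF that], of "-1"]]
      by (simp_all add: p_def C1_simps)
    show "exp (- lam) \<le> p \<epsilon> x" "p \<epsilon> x \<le> 1" if "\<epsilon> \<in> E" for \<epsilon> x
      using V\<epsilon>_bounded[OF that, of x] V\<epsilon>_nonneg[OF that, of x] by (simp_all add: p_def)
    show "periodic ps" unfolding ps_def by (rule periodic_compose[OF V_periodic])
    show "continuous_on UNIV ps" unfolding ps_def by (intro continuous_intros V_cont)
    show "exp (- lam) \<le> ps x" "ps x \<le> 1" for x using V0[of x] Vlam[of x] by (simp_all add: ps_def)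
    show "uniform_limit UNIV p ps (at 0 within E)"
    proof (rule uniform_limitI)
      fix e :: real assume "e > 0"
      with V\<epsilon>_limit have "\<forall>\<^sub>F \<epsilon> in at 0 within E. \<forall>x\<in>UNIV. dist (V\<epsilon> \<epsilon> x) (V x) < e" by (rule uniform_limitD)
      with inE show "\<forall>\<^sub>F \<epsilon> in at 0 within E. \<forall>x\<in>UNIV. dist (p \<epsilon> x) (ps x) < e"
      proof eventually_elim
        case (elim \<epsilon>)
        show ?case
        proof
          fix x
          \<comment> \<open>On the nonnegative half-line \<open>exp (- t)\<close> is 1-Lipschitz, so
            uniform convergence of the potentials gives that of the weights with the same
            tolerance.\<close>
          have lip: "\<bar>exp (- a) - exp (- b)\<bar> \<le> \<bar>a - b\<bar>" if "a \<ge> 0" "b \<ge> 0" for a b :: real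
          proof -
            have *: "exp (- a) - exp (- b) \<le> b - a" if "0 \<le> a" "a \<le> b" for a b :: real
            proof -
              have "exp (- a) - exp (- b) = exp (- a) * (1 - exp (- (b - a)))"
                by (simp add: right_diff_distrib flip: exp_add)
              also have "\<dots> \<le> 1 * (b - a)"
              proof (rule mult_mono)
                show "1 - exp (- (b - a)) \<le> b - a" using exp_ge_add_one_self[of "- (b - a)"] by linarith
              qed (use that in simp_all)
              finally show ?thesis by simp
            qed
            show ?thesis
            proof (cases "a \<le> b")
              case True
              then show ?thesis using *[of a b] that by simp
            next
              case False
              then show ?thesis using *[of b a] that by simp
            qed
          qed
          have "dist (p \<epsilon> x) (ps x) \<le> dist (V\<epsilon> \<epsilon> x) (V x)"
            unfolding p_def ps_def dist_real_def by (rule lip[OF V\<epsilon>_nonneg[OF elim(1)] V0])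
          then show "dist (p \<epsilon> x) (ps x) < e" using elim(2) by (meson UNIV_I le_less_trans)
        qed
      qed
    qed
    show "(\<lambda>x. p \<epsilon> x * u x) \<in> H1" "(\<lambda>x. u x / p \<epsilon> x) \<in> H1" if "\<epsilon> \<in> E" "u \<in> H1" for \<epsilon> u
      using H1_mult_C1[OF that(2) C1_exp(1)[OF VC[OF that(1)], of "-1"]] H1_mult_C1[OF that(2) C1_exp(1)[OF VC[OF that(1)], of 1]]
      by (simp_all add: p_def exp_minus field_simps)
    show "(\<lambda>x. ps x * u x) \<in> H1" "(\<lambda>x. u x / ps x) \<in> H1" if "u \<in> H1" for u
      using H1_mult_exp_limit[OF approx V_periodic V_cont Vabs that, of "-1"] H1_mult_exp_limit[OF approx V_periodic V_cont Vabs that, of 1]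
      by (simp_all add: ps_def exp_minus field_simps)
  qed
  \<comment> \<open>The scheme with its sequence of iterates as an argument, so that iterates can be
    selected for all scales at once and compared index by index.\<close>
  define scheme where "scheme = (\<lambda>p a (m :: nat \<Rightarrow> real^'n \<Rightarrow> real) (\<mu> :: real \<Rightarrow> real^'n \<Rightarrow> real). m 0 = \<mu>0 \<and>
        (\<forall>n\<ge>1. is_arg_min (\<lambda>\<nu>. energy p a \<nu> + 1 / (2 * \<tau>) * (weighted_dist p \<nu> (m (n - 1)))\<^sup>2)
                   (\<lambda>\<nu>. \<nu> \<in> H1) (m n)) \<and>
        (\<forall>n\<ge>1. \<forall>t. (real n - 1) * \<tau> < t \<and> t \<le> real n * \<tau> \<longrightarrow> \<mu> t = m n))"
  have "\<forall>\<epsilon>. \<exists>m. \<epsilon> \<in> E \<longrightarrow> scheme (p \<epsilon>) (\<lambda>x. A (x /\<^sub>R \<epsilon>)) m (\<mu>\<epsilon> \<epsilon>)"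
    using scheme_eps unfolding weighted_L2_scheme_def scheme_def p_def by blast
  then obtain m where "\<forall>\<epsilon>. \<epsilon> \<in> E \<longrightarrow> scheme (p \<epsilon>) (\<lambda>x. A (x /\<^sub>R \<epsilon>)) (m \<epsilon>) (\<mu>\<epsilon> \<epsilon>)" by metis
  then have m: "scheme (p \<epsilon>) (\<lambda>x. A (x /\<^sub>R \<epsilon>)) (m \<epsilon>) (\<mu>\<epsilon> \<epsilon>)" if "\<epsilon> \<in> E" for \<epsilon> using that by blast
  obtain ms where ms: "scheme ps (\<lambda>x. effective_matrix A cor) ms \<mu>"
    using scheme_lim unfolding weighted_L2_scheme_def scheme_def ps_def by blast
  have arg: "is_arg_min (\<lambda>\<nu>. energy p a \<nu> + 1 / (2 * \<tau>) * (weighted_dist p \<nu> (m n))\<^sup>2) (\<lambda>\<nu>. \<nu> \<in> H1) (m (Suc n))"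
    if "scheme p a m \<mu>" for p a m \<mu> n
  proof -
    have "\<forall>n\<ge>1. is_arg_min (\<lambda>\<nu>. energy p a \<nu> + 1 / (2 * \<tau>) * (weighted_dist p \<nu> (m (n - 1)))\<^sup>2) (\<lambda>\<nu>. \<nu> \<in> H1) (m n)"
      using that unfolding scheme_def by blast
    from this[rule_format, of "Suc n"] show ?thesis by simp
  qed
  have inL2: "m n \<in> L2" if "scheme p a m \<mu>" for p a m \<mu> n
  proof (cases n)
    case 0
    then show ?thesis using that initial by (simp add: scheme_def H1_def)
  next
    case (Suc k)
    then show ?thesis using arg[OF that, of k] by (simp add: is_arg_min_def H1_def)
  qed
  \<comment> \<open>At index 0 both sequences equal the common initial datum. In the step,
    convergence at index \<open>n\<close> is the required convergence of the previous
    densities.\<close>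
  have conv: "((\<lambda>\<epsilon>. L2_norm (\<lambda>x. m \<epsilon> n x - ms n x)) \<longlongrightarrow> 0) (at 0 within E)" for n
  proof (induction n)
    case 0
    have "\<forall>\<^sub>F \<epsilon> in at 0 within E. L2_norm (\<lambda>x. m \<epsilon> 0 x - ms 0 x) = 0"
      using inE
    proof eventually_elim
      case (elim \<epsilon>)
      then have "m \<epsilon> 0 = ms 0" using m[OF elim] ms by (simp add: scheme_def)
      then show ?case by (simp add: L2_norm_def)
    qed
    then show ?case by (rule tendsto_eventually)
  next
    case (Suc n)
    show ?case
      by (rule step[of "\<lambda>\<epsilon>. m \<epsilon> n" "ms n" "\<lambda>\<epsilon>. m \<epsilon> (Suc n)" "ms (Suc n)"])
         (rule inL2[OF m] inL2[OF ms] Suc arg[OF m] arg[OF ms]; assumption?)+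
  qed
  show ?thesis
  proof (intro allI impI)
    fix t :: real assume t: "t > 0"
    \<comment> \<open>The interpolant is constant on intervals that are open on the left and closed
      on the right, hence the ceiling; \<open>t > 0\<close> gives \<open>n \<ge> 1\<close>.\<close>
    define n where "n = nat \<lceil>t / \<tau>\<rceil>"
    have "t / \<tau> > 0" using t tau_pos by simp
    then have ceil: "\<lceil>t / \<tau>\<rceil> \<ge> 1" by linarith
    have "real n = of_int \<lceil>t / \<tau>\<rceil>" unfolding n_def using ceil by simp
    then have "real n - 1 < t / \<tau>" "t / \<tau> \<le> real n" "n \<ge> 1"
      using ceiling_correct[of "t / \<tau>"] ceil by linarith+
    then have tn: "(real n - 1) * \<tau> < t" "t \<le> real n * \<tau>" "n \<ge> 1"
      using tau_pos by (simp_all add: pos_less_divide_eq pos_divide_le_eq)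
    have at: "\<mu> t = m n" if "scheme p a m \<mu>" for p a m \<mu>
      using that tn unfolding scheme_def by blast
    have "\<forall>\<^sub>F \<epsilon> in at 0 within E. L2_norm (\<lambda>x. m \<epsilon> n x - ms n x) = L2_norm (\<lambda>x. \<mu>\<epsilon> \<epsilon> t x - \<mu> t x)"
      using inE
    proof eventually_elim
      case (elim \<epsilon>)
      show ?case using at[OF m[OF elim]] at[OF ms] by simp
    qed
    then show "((\<lambda>\<epsilon>. L2_norm (\<lambda>x. \<mu>\<epsilon> \<epsilon> t x - \<mu> t x)) \<longlongrightarrow> 0) (at 0 within E)"
      using conv[of n] by (rule Lim_transform_eventually[rotated])
  qed
qed

end
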